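(* Let $X\sim\mathsf N(0,I_d)$, $\theta^\star\in\mathbb R^d\setminus\{0\}$, $t^\star=\|\theta^\star\|_2$ and $u^\star=\theta^\star/t^\star$. Let the labels follow the logistic model with parameter $\theta^\star$ and $m$ labels per example. The maximum likelihood estimator $\hat\theta^{\rm lr}_{n,m}$ is consistent, $\hat\theta^{\rm lr}_{n,m}\xrightarrow{p}\theta^\star$ as $n\to\infty$, and for $\hat u^{\rm lr}_{n,m}=\hat\theta^{\rm lr}_{n,m}/\|\hat\theta^{\rm lr}_{n,m}\|_2$ and $\mathsf P_{u^\star}^\perp=I_d-u^\star u^{\star\top}$, $$\sqrt n(\hat u^{\rm lr}_{n,m}-u^\star)\xrightarrow{d}\mathsf N\Big(0,\ m^{-1}(t^\star)^{-2}\,\mathbb E\big[\sigma^{\rm lr}(\langle\theta^\star,X\rangle)(1-\sigma^{\rm lr}(\langle\theta^\star,X\rangle))\big]^{-1}\,\mathsf P_{u^\star}^\perp\Big).$$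
   Context: Logistic model: $\sigma^{\rm lr}(t)=1/(1+e^{-t})$; $X_1,\dots,X_n$ are i.i.d. copies of $X$; given $X_i$ the labels $Y_{i1},\dots,Y_{im}\in\{-1,1\}$ are i.i.d. with $\mathbb P(Y_{ij}=y\mid X_i=x)=\sigma^{\rm lr}(y\langle\theta^\star,x\rangle)$. The estimator is $$\hat\theta^{\rm lr}_{n,m}\in\operatorname*{argmin}_{\theta\in\mathbb R^d}\frac1{nm}\sum_{i=1}^n\sum_{j=1}^m\log\big(1+e^{-Y_{ij}\langle X_i,\theta\rangle}\big),$$ any measurable choice of minimizer, defined arbitrarily on the event where no minimizer exists. *)

theory Defs
  imports "HOL-Probability.Probability"
begin

definition sigma_lr :: "real \<Rightarrow> real" where
  "sigma_lr t = 1 / (1 + exp (- t))"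

definition std_gaussian :: "(real ^ 'd) measure" where
  "std_gaussian = density lborel (\<lambda>x. ennreal (\<Prod>i\<in>UNIV. std_normal_density (x $ i)))"

text \<open>
  The law \<open>N(0, \<Sigma>)\<close> of \<open>A Z\<close>, where \<open>Z\<close> is standard Gaussian and \<open>A A\<^sup>T = \<Sigma>\<close>. It does not depend
  on which such \<open>A\<close> is chosen, and \<open>\<Sigma>\<close> may be singular, so that the law need not have a
  density. Such an \<open>A\<close> exists exactly when \<open>\<Sigma>\<close> is symmetric positive semidefinite; for other
  \<open>\<Sigma>\<close> the value is meaningless.
\<close>

definition centered_gaussian :: "real ^ 'd ^ 'd \<Rightarrow> (real ^ 'd) measure" where
  "centered_gaussian \<Sigma> =
     distr std_gaussian borel (\<lambda>z. (SOME A :: real ^ 'd ^ 'd. A ** transpose A = \<Sigma>) *v z)"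

definition perp_proj :: "real ^ 'd \<Rightarrow> real ^ 'd ^ 'd" where
  "perp_proj u = mat 1 - (\<chi> i j. u $ i * u $ j)"

lemma perp_proj_square_root:
  assumes "norm u = 1" and "c \<ge> 0"
  shows "(sqrt c *\<^sub>R perp_proj u) ** transpose (sqrt c *\<^sub>R perp_proj u) = c *\<^sub>R perp_proj u"
proof -
  have uu: "(\<Sum>k\<in>UNIV. u $ k * u $ k) = 1"
    using assms(1) by (simp add: norm_eq_1 inner_vec_def)
  have P: "(\<Sum>k\<in>UNIV. perp_proj u $ i $ k * perp_proj u $ j $ k) = perp_proj u $ i $ j" for i j
  proof -
    have "perp_proj u $ i $ k * perp_proj u $ j $ k =
        (if k = i then (if i = j then 1 else 0) - u $ j * u $ i else 0)
        - (if k = j then u $ i * u $ j else 0) + u $ i * u $ j * (u $ k * u $ k)" for k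
      by (auto simp: perp_proj_def mat_def algebra_simps)
    then have "(\<Sum>k\<in>UNIV. perp_proj u $ i $ k * perp_proj u $ j $ k) =
        (if i = j then 1 else 0) - u $ j * u $ i - u $ i * u $ j + u $ i * u $ j * 1"
      by (simp only: sum.distrib sum_subtractf flip: sum_distrib_left) (simp add: uu)
    then show ?thesis by (simp add: perp_proj_def mat_def)
  qed
  have c: "(sqrt c * a) * (sqrt c * b) = c * (a * b)" for a b
    using assms(2) real_sqrt_mult_self[of c] by (metis abs_of_nonneg mult.assoc mult.left_commute)
  show ?thesis
    unfolding vec_eq_iff matrix_matrix_mult_def transpose_def
    by (simp only: vec_lambda_beta vector_scaleR_component real_scaleR_def c P
        flip: sum_distrib_left) simp
qed

definition converges_in_probability ::
  "'a measure \<Rightarrow> (nat \<Rightarrow> 'a \<Rightarrow> 'b::metric_space) \<Rightarrow> 'b \<Rightarrow> bool" where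
  "converges_in_probability M Z c \<longleftrightarrow>
     (\<forall>n. Z n \<in> borel_measurable M) \<and>
     (\<forall>\<epsilon>>0. (\<lambda>n. measure M {\<omega> \<in> space M. dist (Z n \<omega>) c > \<epsilon>}) \<longlonglongrightarrow> 0)"

definition converges_in_distribution ::
  "'a measure \<Rightarrow> (nat \<Rightarrow> 'a \<Rightarrow> 'b::metric_space) \<Rightarrow> 'b measure \<Rightarrow> bool" where
  "converges_in_distribution M Z \<mu> \<longleftrightarrow>
     (\<forall>n. Z n \<in> borel_measurable M) \<and>
     (\<forall>f :: 'b \<Rightarrow> real. continuous_on UNIV f \<longrightarrow> bounded (range f) \<longrightarrow>
        (\<lambda>n. \<integral>\<omega>. f (Z n \<omega>) \<partial>M) \<longlonglongrightarrow> (\<integral>x. f x \<partial>\<mu>))"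

definition cond_prob_given ::
  "'a measure \<Rightarrow> ('a \<Rightarrow> 'b::topological_space) \<Rightarrow> 'a set \<Rightarrow> 'a \<Rightarrow> real" where
  "cond_prob_given M Z A = real_cond_exp M (vimage_algebra (space M) Z borel) (indicator A)"

text \<open>
  Indices are zero-based: the labels of example \<open>i\<close> are \<open>Y i j\<close> for \<open>j < m\<close>; the values \<open>Y i j\<close>
  for \<open>j \<ge> m\<close> are irrelevant. The two almost sure statements say that, given \<open>X i\<close>, the labels of
  example \<open>i\<close> have the logistic marginals and are independent.
\<close>

definition logistic_model ::
  "'a measure \<Rightarrow> (real ^ 'd) measure \<Rightarrow> real ^ 'd \<Rightarrow> nat \<Rightarrow>
   (nat \<Rightarrow> 'a \<Rightarrow> real ^ 'd) \<Rightarrow> (nat \<Rightarrow> nat \<Rightarrow> 'a \<Rightarrow> real) \<Rightarrow> bool" where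
  "logistic_model M \<mu> \<theta> m X Y \<longleftrightarrow>
     prob_space M \<and>
     (\<forall>i. X i \<in> borel_measurable M \<and> distr M borel (X i) = \<mu>) \<and>
     (\<forall>i. \<forall>j<m. Y i j \<in> borel_measurable M \<and> (\<forall>\<omega>\<in>space M. Y i j \<omega> \<in> {-1, 1})) \<and>
     prob_space.indep_vars M (\<lambda>_. borel \<Otimes>\<^sub>M (\<Pi>\<^sub>M j\<in>{..<m}. borel))
       (\<lambda>i \<omega>. (X i \<omega>, \<lambda>j\<in>{..<m}. Y i j \<omega>)) UNIV \<and>
     (\<forall>i. \<forall>j<m. \<forall>y\<in>{-1, 1}. AE \<omega> in M.
        cond_prob_given M (X i) {\<omega> \<in> space M. Y i j \<omega> = y} \<omega> = sigma_lr (y * (\<theta> \<bullet> X i \<omega>))) \<and>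
     (\<forall>i. \<forall>y\<in>{..<m} \<rightarrow> {-1, 1}. AE \<omega> in M.
        cond_prob_given M (X i) {\<omega> \<in> space M. \<forall>j<m. Y i j \<omega> = y j} \<omega> =
        (\<Prod>j<m. cond_prob_given M (X i) {\<omega> \<in> space M. Y i j \<omega> = y j} \<omega>))"

definition logistic_loss ::
  "nat \<Rightarrow> nat \<Rightarrow> (nat \<Rightarrow> real ^ 'd) \<Rightarrow> (nat \<Rightarrow> nat \<Rightarrow> real) \<Rightarrow> real ^ 'd \<Rightarrow> real" where
  "logistic_loss n m x y \<theta> =
     1 / (real n * real m) * (\<Sum>i<n. \<Sum>j<m. ln (1 + exp (- y i j * (x i \<bullet> \<theta>))))"

definition logistic_mle ::
  "'a measure \<Rightarrow> nat \<Rightarrow> (nat \<Rightarrow> 'a \<Rightarrow> real ^ 'd) \<Rightarrow> (nat \<Rightarrow> nat \<Rightarrow> 'a \<Rightarrow> real) \<Rightarrow>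
   (nat \<Rightarrow> 'a \<Rightarrow> real ^ 'd) \<Rightarrow> bool" where
  "logistic_mle M m X Y \<theta>hat \<longleftrightarrow>
     (\<forall>n. \<theta>hat n \<in> borel_measurable M \<and>
       (\<forall>\<omega>\<in>space M.
          let L = logistic_loss n m (\<lambda>i. X i \<omega>) (\<lambda>i j. Y i j \<omega>)
          in (\<exists>\<theta>. is_arg_min L (\<lambda>_. True) \<theta>) \<longrightarrow> is_arg_min L (\<lambda>_. True) (\<theta>hat n \<omega>)))"

end

theory Submission
  imports Defs
begin

text \<open>
  In the local variable \<open>s = sqrt n (\<theta> - \<theta>\<^sup>\<star>)\<close> the increment of \<open>n\<close> times the loss is
  \<open>\<langle>U\<^sub>n, s\<rangle> + H(s)/2\<close> up to an error that is uniformly small on balls, by Taylor's formula with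
  bounded third derivative; here \<open>U\<^sub>n\<close> is the normalized score and \<open>H\<close> the Fisher information. As the
  loss is convex, strict increase on a small sphere around \<open>- H\<^sup>-\<^sup>1 U\<^sub>n\<close> already forces a minimizer to
  exist and every minimizer to lie inside the sphere. Existence, consistency and the linearization
  \<open>sqrt n (\<theta>hat - \<theta>\<^sup>\<star>) = - H\<^sup>-\<^sup>1 U\<^sub>n + o\<^sub>P(1)\<close> thus come at once, from second moment bounds only.
  Rotation invariance of the Gaussian gives \<open>H = a u u\<^sup>T + b (I - u u\<^sup>T)\<close> with \<open>u\<close> the true direction, so
  that normalizing \<open>\<theta>hat\<close> only sees the eigenvalue \<open>b\<close>. The limit law follows from the one-dimensional
  central limit theorem for all projections of \<open>U\<^sub>n\<close> and a multivariate continuity theorem.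
\<close>

section \<open>Weak convergence in Euclidean space\<close>

text \<open>The loss averages over the \<open>m\<close> labels of an example, so its Hessian is near
  H while the score has covariance H/m. The sandwich H^-1 (H/m) H^-1 is therefore H^-1/m, and the
  derivative (I - u u^T)/t of normalization, with t the norm of the true parameter, leaves (I - u
  u^T)/(m t^2 b), where b is the expectation of sigma (1 - sigma). The other eigenvalue a must be
  positive but leaves no trace in the limit law. The obstacle is that the estimator is arbitrary
  whenever no minimizer exists, for instance on separable data, so no argument may start from its
  first-order condition. Everything is therefore argued pointwise, outside an exceptional event on
  which the score, the Hessian error or the cubic remainder is large. The limit covariance is
  singular, so there is no density to work with, and weak convergence is reduced to trigonometric
  polynomials. The labels are given only through conditional probabilities, which are turned into
  finite sums over label vectors inside Gaussian integrals.\<close>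

inductive trig_poly :: "('b::euclidean_space \<Rightarrow> complex) \<Rightarrow> bool" where
  cis: "trig_poly (\<lambda>x. c * cis (t \<bullet> x))"
| add: "trig_poly f \<Longrightarrow> trig_poly g \<Longrightarrow> trig_poly (\<lambda>x. f x + g x)"

lemma trig_poly_const: "trig_poly (\<lambda>_. c)"
  using trig_poly.cis[of c 0] by simp

text \<open>Multiplying two exponentials adds their frequencies, so these functions form an algebra;
  this is what admits polynomials in sines.\<close>

lemma trig_poly_mult:
  assumes "trig_poly f" and "trig_poly g"
  shows "trig_poly (\<lambda>x. f x * g x)"
  using assms(1)
proof induction
  case (cis c t)
  from assms(2) show ?case
  proof induction
    case (cis c' t')
    have "(\<lambda>x. c * cis (t \<bullet> x) * (c' * cis (t' \<bullet> x))) = (\<lambda>x. (c * c') * cis ((t + t') \<bullet> x))"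
      by (simp add: inner_add_left fun_eq_iff mult_ac flip: cis_mult)
    then show ?case by (simp only: trig_poly.cis)
  qed (simp add: distrib_left trig_poly.add)
qed (simp add: distrib_right trig_poly.add)

lemma trig_poly_sum:
  assumes "\<And>b. b \<in> A \<Longrightarrow> trig_poly (f b)"
  shows "trig_poly (\<lambda>x. \<Sum>b\<in>A. f b x)"
  using assms by (induction A rule: infinite_finite_induct) (auto intro: trig_poly_const trig_poly.add)

lemma trig_poly_sin: "trig_poly (\<lambda>x. complex_of_real (sin (t \<bullet> x)))"
proof -
  have "(\<lambda>x. complex_of_real (sin (t \<bullet> x))) =
      (\<lambda>x. (- \<i> / 2) * cis (t \<bullet> x) + (\<i> / 2) * cis ((- t) \<bullet> x))"
    by (auto simp: fun_eq_iff complex_eq_iff)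
  then show ?thesis by (simp only: trig_poly.intros)
qed

text \<open>Links Stone-Weierstrass to characteristic functions: a polynomial approximation on a
  cube, with scaled sines substituted for the coordinates, is a trigonometric polynomial on the
  whole space.\<close>

lemma trig_poly_polynomial_sin:
  assumes "real_polynomial_function p"
  shows "trig_poly (\<lambda>x::'b::euclidean_space.
    complex_of_real (p (\<Sum>b\<in>Basis. sin (a * (x \<bullet> b)) *\<^sub>R (b::'b))))"
  using assms
proof induction
  case (linear f)
  then interpret bounded_linear f .
  have "trig_poly (\<lambda>x::'b. complex_of_real (sin (a * (x \<bullet> b))))" for b :: 'b
    using trig_poly_sin[of "a *\<^sub>R b"] by (simp add: inner_commute)
  then show ?case
    by (auto simp: sum scaleR intro!: trig_poly_sum trig_poly_mult trig_poly_const)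
qed (auto intro: trig_poly_const trig_poly.add trig_poly_mult)

lemma trig_poly_continuous: "trig_poly f \<Longrightarrow> continuous_on UNIV f"
proof (induction rule: trig_poly.induct)
  case (cis c t)
  then show ?case unfolding cis_conv_exp by (intro continuous_intros)
qed (intro continuous_intros)

lemma trig_poly_bounded: "trig_poly f \<Longrightarrow> \<exists>B. \<forall>x. norm (f x) \<le> B"
proof (induction rule: trig_poly.induct)
  case (add f g)
  then obtain B B' where "\<forall>x. norm (f x) \<le> B" "\<forall>x. norm (g x) \<le> B'" by auto
  then have "\<forall>x. norm (f x + g x) \<le> B + B'" by (meson add_mono norm_triangle_ineq order_trans)
  then show ?case by blast
qed (auto simp: norm_mult)

lemma trig_poly_measurable: "trig_poly f \<Longrightarrow> f \<in> borel_measurable borel"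
  by (rule borel_measurable_continuous_onI) (rule trig_poly_continuous)

lemma trig_poly_integrable:
  assumes "trig_poly f" and "finite_measure N" and "Z \<in> borel_measurable N"
  shows "integrable N (\<lambda>\<omega>. f (Z \<omega>))"
proof -
  interpret finite_measure N by fact
  obtain B where "\<forall>x. norm (f x) \<le> B" using trig_poly_bounded[OF assms(1)] by auto
  then show ?thesis
    using trig_poly_measurable[OF assms(1)] assms(3)
    by (intro integrable_const_bound[of _ B]) (auto intro: measurable_compose)
qed

text \<open>The last hypothesis is the case of a single exponential; linearity of the integral and
  of limits gives the rest.\<close>

lemma trig_poly_integral_tendsto:
  assumes "trig_poly f" and "prob_space M" and "prob_space \<mu>" and "sets \<mu> = sets borel"
    and "\<And>n. Z n \<in> borel_measurable M"
    and "\<And>t. (\<lambda>n. \<integral>\<omega>. cis (t \<bullet> Z n \<omega>) \<partial>M) \<longlonglongrightarrow> (\<integral>x. cis (t \<bullet> x) \<partial>\<mu>)"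
  shows "(\<lambda>n. \<integral>\<omega>. f (Z n \<omega>) \<partial>M) \<longlonglongrightarrow> (\<integral>x. f x \<partial>\<mu>)"
  using assms(1)
proof induction
  case (cis c t)
  show ?case using tendsto_mult_left[OF assms(6), of c] by simp
next
  case (add f g)
  interpret M: prob_space M by fact
  interpret \<mu>: prob_space \<mu> by fact
  have int: "integrable M (\<lambda>\<omega>. h (Z n \<omega>))" "integrable \<mu> h" if "trig_poly h" for h n
    using trig_poly_integrable[OF that M.finite_measure_axioms assms(5)]
      trig_poly_integrable[OF that \<mu>.finite_measure_axioms, of "\<lambda>x. x"]
    by (auto simp: measurable_cong_sets[OF assms(4) refl])
  from add show ?case by (simp add: int tendsto_add)
qed

text \<open>Truncation estimate shared by the continuity theorem and Slutsky's lemma: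
  \<open>A\<close> is the event where only the crude bound on the test function is
  available.\<close>

lemma (in prob_space) integral_diff_le_indicator:
  fixes f g :: "'a \<Rightarrow> real"
  assumes "integrable M f" and "integrable M g" and "A \<in> events"
    and "\<And>\<omega>. \<omega> \<in> space M \<Longrightarrow> \<bar>f \<omega> - g \<omega>\<bar> \<le> e + K * indicator A \<omega>"
  shows "\<bar>(\<integral>\<omega>. f \<omega> \<partial>M) - (\<integral>\<omega>. g \<omega> \<partial>M)\<bar> \<le> e + K * prob A"
proof -
  have "\<bar>(\<integral>\<omega>. f \<omega> \<partial>M) - (\<integral>\<omega>. g \<omega> \<partial>M)\<bar> = \<bar>\<integral>\<omega>. f \<omega> - g \<omega> \<partial>M\<bar>"
    using assms by simp
  also have "\<dots> \<le> (\<integral>\<omega>. \<bar>f \<omega> - g \<omega>\<bar> \<partial>M)"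
    by (rule integral_abs_bound)
  also have "\<dots> \<le> (\<integral>\<omega>. e + K * indicator A \<omega> \<partial>M)"
    using assms by (intro integral_mono) (auto simp: integrable_real_indicator emeasure_eq_measure)
  also have "\<dots> = e + K * prob A"
    using assms(3) by (simp add: prob_space integrable_real_indicator emeasure_eq_measure)
  finally show ?thesis .
qed

text \<open>
  Precomposing \<open>f\<close> with a triangle wave of long period in each coordinate makes it a continuous
  function of finitely many sines, hence a uniform limit of trigonometric polynomials, without
  increasing its supremum norm.
\<close>
lemma trig_poly_approx:
  fixes f :: "'b::euclidean_space \<Rightarrow> real"
  assumes cont: "continuous_on UNIV f" and B: "\<And>x. \<bar>f x\<bar> \<le> B" and "e > 0"
  obtains P where "trig_poly P" and "\<And>x. norm x \<le> R \<Longrightarrow> \<bar>f x - Re (P x)\<bar> \<le> e"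
    and "\<And>x. \<bar>f x - Re (P x)\<bar> \<le> 2 * B + e"
proof -
  \<comment> \<open>The maximum with 1 makes \<open>L\<close> positive whatever \<open>R\<close> is.
    The frequency \<open>a\<close> then maps [-L, L] onto [-pi/2, pi/2], where \<open>arcsin\<close>
    inverts \<open>sin\<close>.\<close>
  define L where "L = max R 1"
  define a where "a = pi / (2 * L)"
  have L: "L > 0" "L \<ge> R" and a: "a > 0" by (auto simp: L_def a_def)
  \<comment> \<open>\<open>F (S x)\<close> is \<open>f\<close> precomposed with the triangle wave.
    As a value of \<open>f\<close>, \<open>F s\<close> inherits the bound \<open>B\<close> for every
    \<open>s\<close>, which later controls the approximation outside the ball.\<close>
  define F where "F s = f (\<Sum>b\<in>Basis. (arcsin (s \<bullet> b) / a) *\<^sub>R b)" for s :: 'b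
  define S where "S x = (\<Sum>b\<in>Basis. sin (a * (x \<bullet> b)) *\<^sub>R b)" for x :: 'b
  have "continuous_on (cbox (- One) One) F"
    unfolding F_def using a
    by (intro continuous_on_compose2[OF cont] continuous_intros) (auto simp: mem_box)
  then obtain p where p: "real_polynomial_function p"
    and pF: "\<And>s. s \<in> cbox (- One) One \<Longrightarrow> \<bar>F s - p s\<bar> < e"
    using Stone_Weierstrass_real_polynomial_function[of "cbox (- One) One :: 'b set" F e] \<open>e > 0\<close>
    by auto
  have S: "S x \<in> cbox (- One) One" for x
    by (simp add: mem_box S_def)
  have FB: "\<bar>F s\<bar> \<le> B" for s unfolding F_def by (rule B)
  have Ff: "F (S x) = f x" if "norm x \<le> R" for x
  proof -
    have "arcsin (S x \<bullet> b) / a = x \<bullet> b" if "b \<in> Basis" for b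
    proof -
      have "\<bar>x \<bullet> b\<bar> \<le> L"
        using Basis_le_norm[OF \<open>b \<in> Basis\<close>, of x] \<open>norm x \<le> R\<close> L by linarith
      then have "\<bar>a * (x \<bullet> b)\<bar> \<le> pi / 2"
        using a L by (simp add: abs_mult a_def field_simps)
      then have "arcsin (sin (a * (x \<bullet> b))) = a * (x \<bullet> b)"
        by (intro arcsin_sin) auto
      then show ?thesis using a that by (simp add: S_def)
    qed
    then show ?thesis by (simp add: F_def euclidean_representation)
  qed
  define P where "P x = complex_of_real (p (S x))" for x
  show ?thesis
  proof
    show "trig_poly P"
      unfolding P_def S_def by (rule trig_poly_polynomial_sin[OF p])
    show "\<bar>f x - Re (P x)\<bar> \<le> e" if "norm x \<le> R" for x
      using pF[OF S, of x] Ff[OF that] by (simp add: P_def)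
    show "\<bar>f x - Re (P x)\<bar> \<le> 2 * B + e" for x
      using pF[OF S, of x] FB[of "S x"] B[of x] by (simp add: P_def)
  qed
qed

text \<open>The bound is uniform over all \<open>n\<close>, not merely eventual: it will come from
  second moments that are bounded for every \<open>n\<close>, including 0.\<close>

definition tight_family :: "'a measure \<Rightarrow> (nat \<Rightarrow> 'a \<Rightarrow> 'b::real_normed_vector) \<Rightarrow> bool" where
  "tight_family M Z \<longleftrightarrow> (\<forall>e>0. \<exists>R. \<forall>n. measure M {\<omega> \<in> space M. norm (Z n \<omega>) > R} < e)"

lemma (in prob_space) ex_prob_norm_gt_less:
  fixes Z :: "'a \<Rightarrow> 'b::{real_normed_vector, second_countable_topology}"
  assumes [measurable]: "Z \<in> borel_measurable M" and "e > 0"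
  shows "\<exists>R. prob {\<omega> \<in> space M. norm (Z \<omega>) > R} < e"
proof -
  have "(\<lambda>k. prob {\<omega> \<in> space M. norm (Z \<omega>) > real k}) \<longlonglongrightarrow>
      prob (\<Inter>k. {\<omega> \<in> space M. norm (Z \<omega>) > real k})"
    by (intro finite_Lim_measure_decseq) (auto simp: decseq_def)
  also have "(\<Inter>k. {\<omega> \<in> space M. norm (Z \<omega>) > real k}) = {}"
  proof -
    have "\<exists>k. \<not> norm (Z \<omega>) > real k" for \<omega>
      using real_nat_ceiling_ge[of "norm (Z \<omega>)"] by (meson not_less)
    then show ?thesis by blast
  qed
  finally have "(\<lambda>k. prob {\<omega> \<in> space M. norm (Z \<omega>) > real k}) \<longlonglongrightarrow> 0" by simp
  then have "\<forall>\<^sub>F k in sequentially. prob {\<omega> \<in> space M. norm (Z \<omega>) > real k} < e"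
    using \<open>e > 0\<close> by (rule order_tendstoD)
  then obtain k where "prob {\<omega> \<in> space M. norm (Z \<omega>) > real k} < e"
    by (auto simp: eventually_sequentially)
  then show ?thesis by blast
qed

text \<open>The continuity theorem with tightness as a hypothesis. The test function is replaced by
  a trigonometric polynomial that is close on a ball carrying almost all mass and bounded elsewhere;
  the integrals of the polynomial converge.\<close>

lemma converges_in_distribution_charI:
  fixes Z :: "nat \<Rightarrow> 'a \<Rightarrow> 'b::euclidean_space"
  assumes "prob_space M" and "prob_space \<mu>" and sets: "sets \<mu> = sets borel"
    and Z[measurable]: "\<And>n. Z n \<in> borel_measurable M"
    and char: "\<And>t. (\<lambda>n. \<integral>\<omega>. cis (t \<bullet> Z n \<omega>) \<partial>M) \<longlonglongrightarrow> (\<integral>x. cis (t \<bullet> x) \<partial>\<mu>)"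
    and tight: "tight_family M Z"
  shows "converges_in_distribution M Z \<mu>"
  unfolding converges_in_distribution_def
proof (intro conjI allI impI)
  interpret M: prob_space M by fact
  interpret \<mu>: prob_space \<mu> by fact
  note [measurable_cong] = sets
  have sp: "space \<mu> = UNIV" using sets_eq_imp_space_eq[OF sets] by simp
  fix f :: "'b \<Rightarrow> real"
  assume cont: "continuous_on UNIV f" and "bounded (range f)"
  then obtain B where B: "\<And>x. \<bar>f x\<bar> \<le> B" and "B > 0" unfolding bounded_pos by auto
  have [measurable]: "f \<in> borel_measurable borel"
    using cont by (rule borel_measurable_continuous_onI)
  have f_int: "integrable M (\<lambda>\<omega>. f (Z n \<omega>))" "integrable \<mu> f" for n
    using B by (auto intro!: M.integrable_const_bound[of _ B] \<mu>.integrable_const_bound[of _ B])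
  show "(\<lambda>n. \<integral>\<omega>. f (Z n \<omega>) \<partial>M) \<longlonglongrightarrow> (\<integral>x. f x \<partial>\<mu>)"
  proof (rule LIMSEQ_I)
    fix r :: real assume "r > 0"
    \<comment> \<open>Each of the two replacements, under \<open>M\<close> and under
      \<open>\<mu>\<close>, costs \<open>e + 2 * B * e\<close>, and the convergence of the
      polynomial integrals costs another \<open>e\<close>.\<close>
    define e where "e = r / (3 + 4 * B)"
    have "e > 0" and "(3 + 4 * B) * e = r"
      using \<open>r > 0\<close> \<open>B > 0\<close> by (auto simp: e_def)
    then have e: "e > 0" "3 * e + 4 * B * e = r" "B * e > 0"
      using \<open>B > 0\<close> by (auto simp: algebra_simps)
    obtain R1 where R1: "\<And>n. M.prob {\<omega> \<in> space M. norm (Z n \<omega>) > R1} < e"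
      using tight e unfolding tight_family_def by blast
    obtain R2 where R2: "\<mu>.prob {x \<in> space \<mu>. norm x > R2} < e"
      using \<mu>.ex_prob_norm_gt_less[of "\<lambda>x. x" e] e by auto
    define R where "R = max R1 R2"
    have "M.prob {\<omega> \<in> space M. norm (Z n \<omega>) > R} \<le> M.prob {\<omega> \<in> space M. norm (Z n \<omega>) > R1}" for n
      by (intro M.finite_measure_mono) (auto simp: R_def)
    then have RM: "M.prob {\<omega> \<in> space M. norm (Z n \<omega>) > R} \<le> e" for n
      using R1[of n] by (rule order_trans[OF _ less_imp_le])
    have "\<mu>.prob {x \<in> space \<mu>. norm x > R} \<le> \<mu>.prob {x \<in> space \<mu>. norm x > R2}"
      by (intro \<mu>.finite_measure_mono) (auto simp: R_def)
    then have R\<mu>: "\<mu>.prob {x \<in> space \<mu>. norm x > R} \<le> e" using R2 by linarith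
    obtain P where P: "trig_poly P" and P1: "\<And>x. norm x \<le> R \<Longrightarrow> \<bar>f x - Re (P x)\<bar> \<le> e"
      and P2: "\<And>x. \<bar>f x - Re (P x)\<bar> \<le> 2 * B + e"
      using trig_poly_approx[OF cont B \<open>e > 0\<close>] by metis
    have P_int: "integrable M (\<lambda>\<omega>. P (Z n \<omega>))" "integrable \<mu> P" for n
      using trig_poly_integrable[OF P M.finite_measure_axioms Z]
        trig_poly_integrable[OF P \<mu>.finite_measure_axioms, of "\<lambda>x. x"] by auto
    have dM: "\<bar>(\<integral>\<omega>. f (Z n \<omega>) \<partial>M) - (\<integral>\<omega>. Re (P (Z n \<omega>)) \<partial>M)\<bar> \<le> e + 2 * B * e" for n
    proof -
      have "\<bar>(\<integral>\<omega>. f (Z n \<omega>) \<partial>M) - (\<integral>\<omega>. Re (P (Z n \<omega>)) \<partial>M)\<bar>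
          \<le> e + 2 * B * M.prob {\<omega> \<in> space M. norm (Z n \<omega>) > R}"
        using P1 P2 f_int P_int \<open>B > 0\<close>
        by (intro M.integral_diff_le_indicator)
          (auto split: split_indicator simp: not_less algebra_simps)
      also have "\<dots> \<le> e + 2 * B * e"
        using RM[of n] \<open>B > 0\<close> by (intro add_left_mono mult_left_mono) auto
      finally show ?thesis .
    qed
    have d\<mu>: "\<bar>(\<integral>x. f x \<partial>\<mu>) - (\<integral>x. Re (P x) \<partial>\<mu>)\<bar> \<le> e + 2 * B * e"
    proof -
      have "\<bar>(\<integral>x. f x \<partial>\<mu>) - (\<integral>x. Re (P x) \<partial>\<mu>)\<bar> \<le> e + 2 * B * \<mu>.prob {x \<in> space \<mu>. norm x > R}"
        using P1 P2 f_int P_int \<open>B > 0\<close>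
        by (intro \<mu>.integral_diff_le_indicator)
          (auto split: split_indicator simp: not_less algebra_simps)
      also have "\<dots> \<le> e + 2 * B * e"
        using R\<mu> \<open>B > 0\<close> by (intro add_left_mono mult_left_mono) auto
      finally show ?thesis .
    qed
    have "(\<lambda>n. Re (\<integral>\<omega>. P (Z n \<omega>) \<partial>M)) \<longlonglongrightarrow> Re (\<integral>x. P x \<partial>\<mu>)"
      by (rule tendsto_Re[OF trig_poly_integral_tendsto[OF P assms(1,2) sets Z char]])
    then have "(\<lambda>n. \<integral>\<omega>. Re (P (Z n \<omega>)) \<partial>M) \<longlonglongrightarrow> (\<integral>x. Re (P x) \<partial>\<mu>)"
      using P_int by simp
    then obtain n0 where n0: "\<And>n. n \<ge> n0 \<Longrightarrow>
        \<bar>(\<integral>\<omega>. Re (P (Z n \<omega>)) \<partial>M) - (\<integral>x. Re (P x) \<partial>\<mu>)\<bar> < e"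
      using LIMSEQ_D[OF _ \<open>e > 0\<close>] by (metis real_norm_def)
    have "norm ((\<integral>\<omega>. f (Z n \<omega>) \<partial>M) - (\<integral>x. f x \<partial>\<mu>)) < r" if "n \<ge> n0" for n
      using n0[OF that] dM[of n] d\<mu> e unfolding real_norm_def by linarith
    then show "\<exists>n0. \<forall>n\<ge>n0. norm ((\<integral>\<omega>. f (Z n \<omega>) \<partial>M) - (\<integral>x. f x \<partial>\<mu>)) < r" by blast
  qed
qed (rule Z)

text \<open>Closed sets form an intersection-stable generator of the Borel sets, and the indicator
  of a closed set is the pointwise limit of continuous functions of the distance to it.\<close>

lemma measure_eqI_bounded_continuous:
  fixes \<mu> \<nu> :: "'b::euclidean_space measure"
  assumes "finite_measure \<mu>" and "finite_measure \<nu>"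
    and sets: "sets \<mu> = sets borel" "sets \<nu> = sets borel"
    and eq: "\<And>f :: 'b \<Rightarrow> real. continuous_on UNIV f \<Longrightarrow> bounded (range f) \<Longrightarrow>
      (\<integral>x. f x \<partial>\<mu>) = (\<integral>x. f x \<partial>\<nu>)"
  shows "\<mu> = \<nu>"
proof (rule measure_eqI_generator_eq[where E = "Collect closed" and \<Omega> = UNIV and A = "\<lambda>_. UNIV"])
  interpret \<mu>: finite_measure \<mu> by fact
  interpret \<nu>: finite_measure \<nu> by fact
  fix C :: "'b set" assume "C \<in> Collect closed"
  then have "closed C" by simp
  show "emeasure \<mu> C = emeasure \<nu> C"
  \<comment> \<open>By convention \<open>infdist x {}\<close> is 0, so for empty \<open>C\<close>
    the functions \<open>f k\<close> would be constantly 1.\<close>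
  proof (cases "C = {}")
    case False
    define f where "f k x = max 0 (1 - real k * infdist x C)" for k x
    have cont: "continuous_on UNIV (f k)" for k
      unfolding f_def by (intro continuous_intros)
    have f01: "0 \<le> f k x" "f k x \<le> 1" for k x
      by (auto simp: f_def infdist_nonneg)
    have lim: "(\<lambda>k. f k x) \<longlonglongrightarrow> indicator C x" for x
    proof (cases "x \<in> C")
      case True
      then show ?thesis by (simp add: f_def)
    next
      case x: False
      then have d: "infdist x C > 0"
        using \<open>closed C\<close> False infdist_pos_not_in_closed by blast
      have "\<forall>\<^sub>F k in sequentially. real k \<ge> 1 / infdist x C"
        using filterlim_real_sequentially by (simp add: filterlim_at_top)
      then have "\<forall>\<^sub>F k in sequentially. f k x = 0"
        by eventually_elim (use d in \<open>simp add: f_def field_simps\<close>)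
      then show ?thesis using x by (simp add: tendsto_eventually)
    qed
    have conv: "(\<lambda>k. \<integral>x. f k x \<partial>N) \<longlonglongrightarrow> measure N C"
      if N: "finite_measure N" "sets N = sets borel" for N
    proof -
      interpret finite_measure N by fact
      have "(\<lambda>k. \<integral>x. f k x \<partial>N) \<longlonglongrightarrow> (\<integral>x. indicator C x \<partial>N)"
      proof (rule integral_dominated_convergence[where w = "\<lambda>_. 1"])
        show "f k \<in> borel_measurable N" for k
          using borel_measurable_continuous_onI[OF cont] by (simp add: measurable_cong_sets[OF N(2) refl])
        show "indicat_real C \<in> borel_measurable N"
          using \<open>closed C\<close> by (intro borel_measurable_indicator) (simp add: N borel_closed)
      qed (use lim f01 in auto)
      then show ?thesis
        using \<open>closed C\<close> by (simp add: N borel_closed)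
    qed
    have "(\<integral>x. f k x \<partial>\<mu>) = (\<integral>x. f k x \<partial>\<nu>)" for k
      using f01 by (intro eq cont) (auto simp: bounded_iff intro!: exI[of _ 1])
    then have "measure \<mu> C = measure \<nu> C"
      using LIMSEQ_unique[OF conv[OF assms(1) sets(1)]] conv[OF assms(2) sets(2)] by simp
    then show ?thesis by (simp add: \<mu>.emeasure_eq_measure \<nu>.emeasure_eq_measure)
  qed simp
qed (use assms in \<open>auto simp: Int_stable_def borel_eq_closed finite_measure.emeasure_finite\<close>)

text \<open>The continuity theorem applied to a constant sequence: the identity map under
  \<open>\<mu>\<close> converges in distribution to \<open>\<nu>\<close>, and a constant sequence of
  integrals equals its limit.\<close>

lemma measure_eqI_char:
  fixes \<mu> \<nu> :: "'b::euclidean_space measure"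
  assumes "prob_space \<mu>" and "prob_space \<nu>"
    and sets: "sets \<mu> = sets borel" "sets \<nu> = sets borel"
    and eq: "\<And>t. (\<integral>x. cis (t \<bullet> x) \<partial>\<mu>) = (\<integral>x. cis (t \<bullet> x) \<partial>\<nu>)"
  shows "\<mu> = \<nu>"
proof (rule measure_eqI_bounded_continuous)
  interpret \<mu>: prob_space \<mu> by fact
  interpret \<nu>: prob_space \<nu> by fact
  note [measurable_cong] = sets
  have "tight_family \<mu> (\<lambda>_ x. x)"
    using \<mu>.ex_prob_norm_gt_less[of "\<lambda>x. x"] by (simp add: tight_family_def)
  then have "converges_in_distribution \<mu> (\<lambda>_ x. x) \<nu>"
    by (intro converges_in_distribution_charI assms) (simp_all add: eq)
  then show "(\<integral>x. f x \<partial>\<mu>) = (\<integral>x. f x \<partial>\<nu>)"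
    if "continuous_on UNIV f" "bounded (range f)" for f :: "'b \<Rightarrow> real"
    using that by (simp add: converges_in_distribution_def LIMSEQ_const_iff)
qed (use assms in \<open>auto intro: prob_space.finite_measure\<close>)

text \<open>A continuous test function is uniformly continuous only on bounded sets. Tightness of
  \<open>Z\<close> confines the comparison to a ball, off an event of small probability.\<close>

lemma converges_in_distribution_Slutsky:
  fixes Z Z' :: "nat \<Rightarrow> 'a \<Rightarrow> 'b::euclidean_space"
  assumes "prob_space M" and conv: "converges_in_distribution M Z \<mu>"
    and tight: "tight_family M Z"
    and Z'[measurable]: "\<And>n. Z' n \<in> borel_measurable M"
    and diff: "\<And>e. e > 0 \<Longrightarrow>
      (\<lambda>n. measure M {\<omega> \<in> space M. dist (Z' n \<omega>) (Z n \<omega>) > e}) \<longlonglongrightarrow> 0"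
  shows "converges_in_distribution M Z' \<mu>"
  unfolding converges_in_distribution_def
proof (intro conjI allI impI)
  interpret M: prob_space M by fact
  have Z[measurable]: "Z n \<in> borel_measurable M" for n
    using conv by (auto simp: converges_in_distribution_def)
  fix f :: "'b \<Rightarrow> real"
  assume cont: "continuous_on UNIV f" and bdd: "bounded (range f)"
  then obtain B where B: "\<And>x. \<bar>f x\<bar> \<le> B" and "B > 0" unfolding bounded_pos by auto
  have [measurable]: "f \<in> borel_measurable borel"
    using cont by (rule borel_measurable_continuous_onI)
  have f_int: "integrable M (\<lambda>\<omega>. f (Z n \<omega>))" "integrable M (\<lambda>\<omega>. f (Z' n \<omega>))" for n
    using B by (auto intro!: M.integrable_const_bound[of _ B])
  have "(\<lambda>n. (\<integral>\<omega>. f (Z' n \<omega>) \<partial>M) - (\<integral>\<omega>. f (Z n \<omega>) \<partial>M)) \<longlonglongrightarrow> 0"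
  proof (rule LIMSEQ_I)
    fix r :: real assume "r > 0"
    \<comment> \<open>The exceptional event has probability at most \<open>2 * e\<close>, so the
      difference is at most \<open>e + 4 * B * e\<close>; the remaining \<open>e\<close> makes the
      inequality strict.\<close>
    define e where "e = r / (2 + 4 * B)"
    have "e > 0" and "(2 + 4 * B) * e = r"
      using \<open>r > 0\<close> \<open>B > 0\<close> by (auto simp: e_def)
    then have e: "e > 0" "2 * e + 4 * B * e = r" "B * e > 0"
      using \<open>B > 0\<close> by (auto simp: algebra_simps)
    obtain R where R: "\<And>n. M.prob {\<omega> \<in> space M. norm (Z n \<omega>) > R} < e"
      using tight e unfolding tight_family_def by blast
    have "uniformly_continuous_on (cball 0 (R + 1)) f"
      using cont by (intro compact_uniformly_continuous continuous_on_subset[OF cont]) auto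
    then obtain d0 where "d0 > 0" and d0: "\<And>x y. x \<in> cball 0 (R + 1) \<Longrightarrow> y \<in> cball 0 (R + 1) \<Longrightarrow>
        dist x y < d0 \<Longrightarrow> dist (f x) (f y) < e"
      using e unfolding uniformly_continuous_on_def by metis
    \<comment> \<open>The bound 1 keeps \<open>Z' n\<close> in the ball of radius
      \<open>R + 1\<close> when \<open>Z n\<close> is in the ball of radius \<open>R\<close>;
      halving \<open>d0\<close> turns the weak inequality for the distance into the strict one
      needed.\<close>
    define d where "d = min (d0 / 2) 1"
    have d: "d > 0" "d < d0" "d \<le> 1" using \<open>d0 > 0\<close> by (auto simp: d_def)
    have close: "\<bar>f x - f y\<bar> \<le> e" if "norm y \<le> R" "dist x y \<le> d" for x y
    proof -
      have "norm x \<le> norm y + norm (x - y)" by (metis norm_triangle_sub)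
      then have "dist (f x) (f y) < e"
        using that d by (intro d0) (auto simp: dist_norm)
      then show ?thesis by (simp add: dist_real_def)
    qed
    obtain n0 where n0: "\<And>n. n \<ge> n0 \<Longrightarrow> M.prob {\<omega> \<in> space M. dist (Z' n \<omega>) (Z n \<omega>) > d} < e"
      using LIMSEQ_D[OF diff[OF \<open>d > 0\<close>] \<open>e > 0\<close>] by auto
    have "norm ((\<integral>\<omega>. f (Z' n \<omega>) \<partial>M) - (\<integral>\<omega>. f (Z n \<omega>) \<partial>M) - 0) < r" if "n \<ge> n0" for n
    proof -
      let ?A = "{\<omega> \<in> space M. norm (Z n \<omega>) > R}"
      let ?D = "{\<omega> \<in> space M. dist (Z' n \<omega>) (Z n \<omega>) > d}"
      have "\<bar>f x - f y\<bar> \<le> e + 2 * B" for x y using B[of x] B[of y] e by linarith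
      then have "\<bar>(\<integral>\<omega>. f (Z' n \<omega>) \<partial>M) - (\<integral>\<omega>. f (Z n \<omega>) \<partial>M)\<bar> \<le> e + 2 * B * M.prob (?A \<union> ?D)"
        using f_int close
        by (intro M.integral_diff_le_indicator) (auto split: split_indicator simp: not_less)
      moreover
      have "M.prob (?A \<union> ?D) \<le> M.prob ?A + M.prob ?D"
        by (rule measure_Un_le) measurable
      then have "M.prob (?A \<union> ?D) \<le> e + e"
        using R[of n] n0[OF that] by linarith
      then have "2 * B * M.prob (?A \<union> ?D) \<le> 2 * B * (e + e)"
        using \<open>B > 0\<close> by (intro mult_left_mono) auto
      ultimately show ?thesis
        using e by (simp add: algebra_simps)
    qed
    then show "\<exists>n0. \<forall>n\<ge>n0. norm ((\<integral>\<omega>. f (Z' n \<omega>) \<partial>M) - (\<integral>\<omega>. f (Z n \<omega>) \<partial>M) - 0) < r" by blast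
  qed
  from tendsto_add[OF this, of "\<lambda>n. \<integral>\<omega>. f (Z n \<omega>) \<partial>M" "\<integral>x. f x \<partial>\<mu>"]
  show "(\<lambda>n. \<integral>\<omega>. f (Z' n \<omega>) \<partial>M) \<longlonglongrightarrow> (\<integral>x. f x \<partial>\<mu>)"
    using conv cont bdd by (simp add: converges_in_distribution_def)
qed (rule Z')

section \<open>The standard Gaussian measure\<close>

lemma prod_Basis_vec:
  fixes h :: "real ^ 'd \<Rightarrow> 'c::comm_monoid_mult"
  shows "(\<Prod>b\<in>(Basis :: (real ^ 'd) set). h b) = (\<Prod>i\<in>UNIV. h (axis i 1))"
proof -
  have "(Basis :: (real ^ 'd) set) = range (\<lambda>i. axis i 1)"
    by (auto simp: Basis_vec_def)
  moreover have "inj (\<lambda>i :: 'd. axis i (1 :: real))"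
    by (auto simp: inj_def axis_eq_axis)
  ultimately show ?thesis
    using prod.reindex[of "\<lambda>i :: 'd. axis i (1 :: real)" UNIV h] by simp
qed

lemma measurable_vec_nth [measurable]: "(\<lambda>x :: real ^ 'd. x $ i) \<in> borel_measurable borel"
  by (intro borel_measurable_continuous_onI continuous_intros)

lemma power2_norm_vec: "(norm x)\<^sup>2 = (\<Sum>i\<in>UNIV. (x $ i)\<^sup>2)" for x :: "real ^ 'd"
  unfolding power2_norm_eq_inner inner_vec_def by (simp add: power2_eq_square)

lemma sets_std_gaussian [simp, measurable_cong]: "sets std_gaussian = sets borel"
  by (simp add: std_gaussian_def)

lemma space_std_gaussian [simp]: "space std_gaussian = UNIV"
  by (simp add: std_gaussian_def)

lemma nn_integral_std_gaussian_prod: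
  fixes f :: "'d::finite \<Rightarrow> real \<Rightarrow> ennreal"
  assumes [measurable]: "\<And>i. f i \<in> borel_measurable borel"
  shows "(\<integral>\<^sup>+x. (\<Prod>i\<in>UNIV. f i (x $ i)) \<partial>std_gaussian) =
    (\<Prod>i\<in>UNIV. \<integral>\<^sup>+z. f i z \<partial>std_normal_distribution)"
proof -
  \<comment> \<open>Product integration over \<open>lborel\<close> is indexed by basis vectors;
    \<open>j\<close> recovers the coordinate from its axis vector.\<close>
  define j where "j = inv (\<lambda>i :: 'd. axis i (1 :: real))"
  have j: "j (axis i 1) = i" for i
    unfolding j_def by (rule inv_f_f) (auto simp: inj_def axis_eq_axis)
  have "(\<integral>\<^sup>+x. (\<Prod>i\<in>UNIV. f i (x $ i)) \<partial>std_gaussian) =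
      (\<integral>\<^sup>+x. (\<Prod>i\<in>UNIV. ennreal (std_normal_density (x $ i)) * f i (x $ i)) \<partial>lborel)"
    unfolding std_gaussian_def
    by (subst nn_integral_density) (auto simp: prod.distrib prod_ennreal)
  also have "\<dots> = (\<integral>\<^sup>+x. (\<Prod>b\<in>Basis. ennreal (std_normal_density (x \<bullet> b)) * f (j b) (x \<bullet> b)) \<partial>lborel)"
    by (simp add: prod_Basis_vec j inner_axis)
  also have "\<dots> = (\<Prod>b\<in>(Basis :: (real ^ 'd) set). \<integral>\<^sup>+z. ennreal (std_normal_density z) * f (j b) z \<partial>lborel)"
    by (rule nn_integral_lborel_prod) auto
  also have "\<dots> = (\<Prod>i\<in>UNIV. \<integral>\<^sup>+z. f i z \<partial>std_normal_distribution)"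
    by (simp add: prod_Basis_vec j nn_integral_density)
  finally show ?thesis .
qed

lemma emeasure_std_gaussian_box:
  fixes A :: "'d::finite \<Rightarrow> real set"
  assumes [measurable]: "\<And>i. A i \<in> sets borel"
  shows "emeasure std_gaussian {x. \<forall>i. x $ i \<in> A i} = (\<Prod>i\<in>UNIV. emeasure std_normal_distribution (A i))"
proof -
  have "(\<Prod>i\<in>UNIV. indicator (A i) (x $ i)) = (indicator {x. \<forall>i. x $ i \<in> A i} x :: ennreal)" for x :: "real ^ 'd"
    by (auto split: split_indicator simp: prod_zero_iff)
  moreover have "{x :: real ^ 'd. \<forall>i. x $ i \<in> A i} \<in> sets std_gaussian"
  proof -
    have "{x \<in> space borel. \<forall>i\<in>UNIV. x $ i \<in> A i} \<in> sets (borel :: (real ^ 'd) measure)"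
      by measurable
    then show ?thesis by simp
  qed
  ultimately show ?thesis
    using nn_integral_std_gaussian_prod[of "\<lambda>i. indicator (A i)"] by simp
qed

lemma prob_space_std_normal: "prob_space std_normal_distribution"
  by (rule prob_space_normal_density) simp

lemma prob_space_std_gaussian: "prob_space std_gaussian"
  using emeasure_std_gaussian_box[of "\<lambda>_. UNIV"] prob_space.emeasure_space_1[OF prob_space_std_normal]
  by (intro prob_spaceI) simp

interpretation std_gaussian: prob_space std_gaussian
  by (rule prob_space_std_gaussian)

lemma distr_std_gaussian_component:
  "distr std_gaussian borel (\<lambda>x. x $ i) = std_normal_distribution"
proof (rule measure_eqI)
  fix A :: "real set" assume "A \<in> sets (distr std_gaussian borel (\<lambda>x. x $ i))"
  then have [measurable]: "A \<in> sets borel" by simp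
  have "emeasure (distr std_gaussian borel (\<lambda>x. x $ i)) A = emeasure std_gaussian {x. x $ i \<in> A}"
    by (subst emeasure_distr) (auto intro!: arg_cong[where f = "emeasure _"])
  also have "{x :: real ^ 'a. x $ i \<in> A} = {x. \<forall>j. x $ j \<in> (if j = i then A else UNIV)}"
    by auto
  also have "emeasure std_gaussian \<dots> = (\<Prod>j\<in>UNIV. emeasure std_normal_distribution (if j = i then A else UNIV))"
    by (rule emeasure_std_gaussian_box) auto
  also have "\<dots> = (\<Prod>j\<in>UNIV. if j = i then emeasure std_normal_distribution A else 1)"
    using prob_space.emeasure_space_1[OF prob_space_std_normal] by (intro prod.cong) auto
  finally show "emeasure (distr std_gaussian borel (\<lambda>x. x $ i)) A = emeasure std_normal_distribution A"
    by simp
qed simp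

lemma indep_components_std_gaussian:
  "std_gaussian.indep_vars (\<lambda>_. borel) (\<lambda>i x. x $ i) (UNIV :: 'd::finite set)"
proof (subst std_gaussian.indep_vars_finite[where E = "\<lambda>_. sets borel"])
  show "\<forall>A\<in>(UNIV :: 'd set) \<rightarrow> sets borel.
      std_gaussian.prob (\<Inter>j\<in>UNIV. (\<lambda>x. x $ j) -` A j \<inter> space std_gaussian) =
      (\<Prod>j\<in>UNIV. std_gaussian.prob ((\<lambda>x. x $ j) -` A j \<inter> space std_gaussian))"
  proof
    fix A :: "'d \<Rightarrow> real set" assume "A \<in> UNIV \<rightarrow> sets borel"
    then have [measurable]: "A i \<in> sets borel" for i by auto
    have "(\<Inter>j\<in>UNIV. (\<lambda>x. x $ j) -` A j \<inter> space std_gaussian) = {x. \<forall>i. x $ i \<in> A i}" by auto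
    then have "ennreal (std_gaussian.prob (\<Inter>j\<in>UNIV. (\<lambda>x. x $ j) -` A j \<inter> space std_gaussian)) =
        (\<Prod>i\<in>UNIV. emeasure (distr std_gaussian borel (\<lambda>x :: real ^ 'd. x $ i)) (A i))"
      by (simp add: emeasure_std_gaussian_box distr_std_gaussian_component flip: std_gaussian.emeasure_eq_measure)
    also have "\<dots> = (\<Prod>j\<in>UNIV. ennreal (std_gaussian.prob ((\<lambda>x. x $ j) -` A j \<inter> space std_gaussian)))"
      by (subst emeasure_distr) (auto simp: std_gaussian.emeasure_eq_measure)
    finally show "std_gaussian.prob (\<Inter>j\<in>UNIV. (\<lambda>x. x $ j) -` A j \<inter> space std_gaussian) =
      (\<Prod>j\<in>UNIV. std_gaussian.prob ((\<lambda>x. x $ j) -` A j \<inter> space std_gaussian))"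
      by (simp add: prod_ennreal prod_nonneg)
  qed
qed (auto simp: Int_stable_def sets.sigma_sets_eq[of borel, simplified])

lemma cis_sum: "finite A \<Longrightarrow> cis (\<Sum>i\<in>A. f i) = (\<Prod>i\<in>A. cis (f i))"
  by (induction A rule: finite_induct) (auto simp flip: cis_mult)

lemma integral_cis_std_gaussian:
  "(\<integral>x. cis (t \<bullet> x) \<partial>std_gaussian) = complex_of_real (exp (- (norm t)\<^sup>2 / 2))" for t :: "real ^ 'd"
proof -
  have [measurable]: "cis \<in> borel_measurable borel"
    unfolding cis_conv_exp by (intro borel_measurable_continuous_onI continuous_intros)
  have "(\<integral>x. cis (t \<bullet> x) \<partial>std_gaussian) = (\<integral>x. (\<Prod>i\<in>UNIV. cis (t $ i * x $ i)) \<partial>std_gaussian)"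
    by (simp add: inner_vec_def cis_sum)
  also have "\<dots> = (\<Prod>i\<in>UNIV. \<integral>x. cis (t $ i * x $ i) \<partial>std_gaussian)"
  proof (rule std_gaussian.indep_vars_lebesgue_integral)
    show "std_gaussian.indep_vars (\<lambda>_. borel) (\<lambda>i x. cis (t $ i * x $ i)) UNIV"
      by (rule std_gaussian.indep_vars_compose2[OF indep_components_std_gaussian]) measurable
    show "integrable std_gaussian (\<lambda>x. cis (t $ i * x $ i))" for i
      by (intro std_gaussian.integrable_const_bound[of _ 1]) auto
  qed auto
  also have "\<dots> = (\<Prod>i\<in>UNIV. char std_normal_distribution (t $ i))"
  proof (intro prod.cong refl)
    fix i
    show "(\<integral>x. cis (t $ i * x $ i) \<partial>std_gaussian) = char std_normal_distribution (t $ i)"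
      unfolding char_def distr_std_gaussian_component[of i, symmetric]
      by (subst integral_distr) (auto simp: cis_conv_exp)
  qed
  also have "\<dots> = complex_of_real (exp (\<Sum>i\<in>UNIV. - (t $ i)\<^sup>2 / 2))"
    by (simp add: char_std_normal_distribution exp_sum)
  also have "(\<Sum>i\<in>UNIV. - (t $ i)\<^sup>2 / 2) = - (norm t)\<^sup>2 / 2"
    by (simp add: power2_norm_vec sum_negf flip: sum_divide_distrib)
  finally show ?thesis .
qed

lemma sets_centered_gaussian [simp]: "sets (centered_gaussian \<Sigma>) = sets borel"
  by (simp add: centered_gaussian_def)

lemma measurable_matrix_vector_mult [measurable]:
  "(\<lambda>z. A *v z) \<in> borel_measurable borel" for A :: "real ^ 'n ^ 'm"
  by (intro borel_measurable_continuous_onI linear_continuous_on matrix_vector_mul_bounded_linear)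

lemma prob_space_centered_gaussian: "prob_space (centered_gaussian \<Sigma>)"
  unfolding centered_gaussian_def by (rule std_gaussian.prob_space_distr) measurable

text \<open>The given root \<open>A\<close> only guarantees that the choice operator returns some
  root. The value does not depend on which one, because the squared norm of
  \<open>transpose B *v t\<close> is \<open>t \<bullet> (\<Sigma> *v t)\<close> for every root
  \<open>B\<close>.\<close>

lemma integral_cis_centered_gaussian:
  fixes A \<Sigma> :: "real ^ 'd ^ 'd"
  assumes "A ** transpose A = \<Sigma>"
  shows "(\<integral>x. cis (t \<bullet> x) \<partial>centered_gaussian \<Sigma>) = complex_of_real (exp (- (t \<bullet> (\<Sigma> *v t)) / 2))"
proof -
  define B :: "real ^ 'd ^ 'd" where "B = (SOME A. A ** transpose A = \<Sigma>)"
  have B: "B ** transpose B = \<Sigma>"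
    unfolding B_def using assms by (rule someI)
  have [measurable]: "(\<lambda>x. cis (t \<bullet> x)) \<in> borel_measurable borel"
    unfolding cis_conv_exp by (intro borel_measurable_continuous_onI continuous_intros)
  have "(\<integral>x. cis (t \<bullet> x) \<partial>centered_gaussian \<Sigma>) = (\<integral>z. cis (t \<bullet> (B *v z)) \<partial>std_gaussian)"
    unfolding centered_gaussian_def B_def[symmetric] by (subst integral_distr) auto
  also have "\<dots> = (\<integral>z. cis ((transpose B *v t) \<bullet> z) \<partial>std_gaussian)"
    by (simp add: dot_lmul_matrix)
  also have "\<dots> = complex_of_real (exp (- (norm (transpose B *v t))\<^sup>2 / 2))"
    by (rule integral_cis_std_gaussian)
  also have "(norm (transpose B *v t))\<^sup>2 = t \<bullet> (\<Sigma> *v t)"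
    unfolding power2_norm_eq_inner
    by (metis B dot_lmul_matrix matrix_vector_mul_assoc transpose_matrix_vector)
  finally show ?thesis .
qed

text \<open>The characteristic function at \<open>t\<close> depends on \<open>norm t\<close> only,
  so uniqueness of characteristic functions gives rotation invariance.\<close>

lemma distr_std_gaussian_orthogonal:
  fixes T :: "real ^ 'd \<Rightarrow> real ^ 'd"
  assumes T: "orthogonal_transformation T"
  shows "distr std_gaussian borel T = std_gaussian"
proof (rule measure_eqI_char)
  have [measurable]: "T \<in> borel_measurable borel"
    using T by (intro borel_measurable_continuous_onI linear_continuous_on)
      (simp add: orthogonal_transformation_linear linear_conv_bounded_linear[symmetric])
  have [measurable]: "(\<lambda>x. cis (t \<bullet> x)) \<in> borel_measurable borel" for t :: "real ^ 'd"
    unfolding cis_conv_exp by (intro borel_measurable_continuous_onI continuous_intros)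
  show "prob_space (distr std_gaussian borel T)"
    by (rule std_gaussian.prob_space_distr) measurable
  fix t :: "real ^ 'd"
  obtain s where s: "t = T s"
    using orthogonal_transformation_surj[OF T] by (metis surjD)
  have "(\<integral>x. cis (t \<bullet> x) \<partial>distr std_gaussian borel T) = (\<integral>x. cis (s \<bullet> x) \<partial>std_gaussian)"
    using T by (subst integral_distr) (auto simp: s orthogonal_transformation_def)
  also have "\<dots> = (\<integral>x. cis (t \<bullet> x) \<partial>std_gaussian)"
    using T by (simp add: integral_cis_std_gaussian s orthogonal_transformation_norm)
  finally show "(\<integral>x. cis (t \<bullet> x) \<partial>distr std_gaussian borel T) = (\<integral>x. cis (t \<bullet> x) \<partial>std_gaussian)" .
qed (auto intro: prob_space_std_gaussian)

lemma integral_std_gaussian_orthogonal: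
  fixes T :: "real ^ 'd \<Rightarrow> real ^ 'd" and f :: "real ^ 'd \<Rightarrow> real"
  assumes T: "orthogonal_transformation T" and [measurable]: "f \<in> borel_measurable borel"
  shows "(\<integral>x. f (T x) \<partial>std_gaussian) = (\<integral>x. f x \<partial>std_gaussian)"
proof -
  have [measurable]: "T \<in> borel_measurable borel"
    using T by (intro borel_measurable_continuous_onI linear_continuous_on)
      (simp add: orthogonal_transformation_linear linear_conv_bounded_linear[symmetric])
  show ?thesis
    by (subst (2) distr_std_gaussian_orthogonal[OF T, symmetric]) (simp add: integral_distr)
qed

section \<open>Moments of the standard Gaussian\<close>

lemma integrable_std_gaussian_component:
  "integrable std_gaussian (\<lambda>x :: real ^ 'd. (x $ i) ^ k)"
proof -
  have "integrable (distr std_gaussian borel (\<lambda>x :: real ^ 'd. x $ i)) (\<lambda>z. z ^ k)"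
    unfolding distr_std_gaussian_component by (rule integrable_std_normal_distribution_moment)
  then show ?thesis by (subst (asm) integrable_distr_eq) auto
qed

lemma integral_std_gaussian_component_square:
  fixes i :: "'d::finite"
  shows "(\<integral>x. (x $ i)\<^sup>2 \<partial>std_gaussian) = 1"
proof -
  have "(\<integral>x. (x $ i)\<^sup>2 \<partial>std_gaussian) = (\<integral>z. z\<^sup>2 \<partial>std_normal_distribution)"
    unfolding distr_std_gaussian_component[of i, symmetric] by (subst integral_distr) auto
  then show ?thesis using std_normal_distribution_even_moments(1)[of 1] by simp
qed

text \<open>The highest moment that occurs: the variance of the entries of the empirical Hessian has
  degree four in the features. Cauchy-Schwarz reduces it to the coordinates.\<close>

lemma integrable_std_gaussian_norm_4: "integrable std_gaussian (\<lambda>x :: real ^ 'd. norm x ^ 4)"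
proof (rule Bochner_Integration.integrable_bound)
  show "integrable std_gaussian (\<lambda>x :: real ^ 'd. real CARD('d) * (\<Sum>i\<in>UNIV. (x $ i) ^ 4))"
    by (intro Bochner_Integration.integrable_sum integrable_mult_right integrable_std_gaussian_component)
  have "norm x ^ 4 \<le> real CARD('d) * (\<Sum>i\<in>UNIV. (x $ i) ^ 4)" for x :: "real ^ 'd"
  proof -
    have "norm x ^ 4 = ((norm x)\<^sup>2)\<^sup>2" by simp
    also have "\<dots> = (\<Sum>i\<in>UNIV. 1 * (x $ i)\<^sup>2)\<^sup>2" by (simp only: power2_norm_vec mult_1)
    also have "\<dots> \<le> (\<Sum>i\<in>(UNIV :: 'd set). 1\<^sup>2) * (\<Sum>i\<in>UNIV. ((x $ i)\<^sup>2)\<^sup>2)"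
      by (rule Cauchy_Schwarz_ineq_sum)
    finally show ?thesis by (simp flip: power_mult)
  qed
  from order_trans[OF this abs_ge_self]
  show "AE x in std_gaussian. norm (norm (x :: real ^ 'd) ^ 4) \<le> norm (real CARD('d) * (\<Sum>i\<in>UNIV. (x $ i) ^ 4))"
    by (intro AE_I2) simp
qed measurable

text \<open>Integrability test for the whole development: degrees 1 and 2 serve the score, 3 the
  Taylor remainder and 4 the squared Hessian entries.\<close>

lemma integrable_std_gaussian_dominated:
  fixes f :: "real ^ 'd \<Rightarrow> real"
  assumes [measurable]: "f \<in> borel_measurable borel" and "k \<le> 4"
    and "\<And>x. \<bar>f x\<bar> \<le> K * norm x ^ k"
  shows "integrable std_gaussian f"
proof (rule Bochner_Integration.integrable_bound)
  show "integrable std_gaussian (\<lambda>x :: real ^ 'd. \<bar>K\<bar> * (1 + norm x ^ 4))"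
    by (intro integrable_mult_right Bochner_Integration.integrable_add integrable_std_gaussian_norm_4) simp
  have "norm x ^ k \<le> 1 + norm x ^ 4" for x :: "real ^ 'd"
  proof (cases "norm x \<le> 1")
    case True
    then show ?thesis using power_le_one[of "norm x" k] by (simp add: add_increasing2)
  next
    case False
    then show ?thesis using power_increasing[OF \<open>k \<le> 4\<close>, of "norm x"] False by linarith
  qed
  then have "\<bar>K\<bar> * norm x ^ k \<le> \<bar>K\<bar> * (1 + norm x ^ 4)" for x :: "real ^ 'd"
    by (intro mult_left_mono) auto
  moreover have "K * norm x ^ k \<le> \<bar>K\<bar> * norm x ^ k" for x :: "real ^ 'd"
    by (intro mult_right_mono) auto
  ultimately have "\<bar>f x\<bar> \<le> \<bar>K\<bar> * (1 + norm x ^ 4)" for x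
    using assms(3)[of x] by (meson order_trans)
  from order_trans[OF this abs_ge_self]
  show "AE x in std_gaussian. norm (f x) \<le> norm (\<bar>K\<bar> * (1 + norm x ^ 4))"
    by (intro AE_I2) simp
qed simp

text \<open>Off the diagonal one of the two coordinates differs from \<open>k\<close>, and
  reflecting it changes the sign of the integrand but not the measure. On the diagonal off
  \<open>k\<close>, independence and unit variance leave the weight alone.\<close>

lemma std_gaussian_weighted_second_moment_axis:
  fixes k i j :: "'d::finite"
  assumes [measurable]: "g \<in> borel_measurable borel" and K: "\<And>z. \<bar>g z\<bar> \<le> K"
  shows "(\<integral>x. g (x $ k) * (x $ i * x $ j) \<partial>std_gaussian) =
    (if i \<noteq> j then 0 else if i = k then (\<integral>x. g (x $ k) * (x $ k)\<^sup>2 \<partial>std_gaussian)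
     else (\<integral>x. g (x $ k) \<partial>std_gaussian))"
proof -
  have off: "(\<integral>x. g (x $ k) * (x $ i * x $ j) \<partial>std_gaussian) = 0" if "i \<noteq> j" "i \<noteq> k" for i j
  proof -
    define R :: "real ^ 'd \<Rightarrow> real ^ 'd" where "R x = (\<chi> l. if l = i then - x $ l else x $ l)" for x
    have "linear R"
      by (auto simp: R_def linear_iff vec_eq_iff)
    moreover have "R v \<bullet> R w = v \<bullet> w" for v w
      by (auto simp: R_def inner_vec_def intro!: sum.cong)
    ultimately have "orthogonal_transformation R"
      by (simp add: orthogonal_transformation_def)
    from integral_std_gaussian_orthogonal[OF this, of "\<lambda>x. g (x $ k) * (x $ i * x $ j)"]
    show ?thesis using that by (simp add: R_def)
  qed
  consider "i \<noteq> j" "i \<noteq> k" | "i \<noteq> j" "i = k" | "i = j" "i = k" | "i = j" "i \<noteq> k" by blast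
  then show ?thesis
  proof cases
    case 1
    then show ?thesis by (simp add: off)
  next
    case 2
    \<comment> \<open>Here \<open>i = k\<close>, so coordinate \<open>j\<close> is the one to
      reflect.\<close>
    then show ?thesis using off[of j i] by (simp add: mult_ac)
  next
    case 3
    then show ?thesis by (simp add: power2_eq_square)
  next
    case 4
    \<comment> \<open>For \<open>i = j\<close> different from \<open>k\<close> the integrand is a
      product of functions of two distinct coordinates: the weight at \<open>k\<close> and the
      square at \<open>i\<close>.\<close>
    define h where "h l z = (if l = k then g z else z\<^sup>2)" for l :: 'd and z :: real
    have h[measurable]: "h l \<in> borel_measurable borel" for l
      unfolding h_def by (cases "l = k") auto
    have int: "integrable std_gaussian (\<lambda>x. h l (x $ l))" for l
      by (cases "l = k")
        (auto simp: h_def K integrable_std_gaussian_component intro!: std_gaussian.integrable_const_bound[of _ K])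
    have "(\<integral>x. (\<Prod>l\<in>{i, k}. h l (x $ l)) \<partial>std_gaussian) =
        (\<Prod>l\<in>{i, k}. \<integral>x. h l (x $ l) \<partial>std_gaussian)"
    proof (rule std_gaussian.indep_vars_lebesgue_integral)
      show "std_gaussian.indep_vars (\<lambda>_. borel) (\<lambda>l x. h l (x $ l)) {i, k}"
        by (rule std_gaussian.indep_vars_compose2
            [OF std_gaussian.indep_vars_subset[OF indep_components_std_gaussian]]) auto
    qed (auto intro: int)
    then show ?thesis
      using 4 integral_std_gaussian_component_square[of j]
      by (simp add: h_def power2_eq_square mult.commute)
  qed
qed

text \<open>A weight that depends only on the component along \<open>u\<close> leaves the law
  invariant under rotations fixing \<open>u\<close>, so the weighted second moment matrix has
  eigenvalues along \<open>u\<close> and on its complement only. The proof rotates \<open>u\<close>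
  to a coordinate axis.\<close>

lemma std_gaussian_weighted_second_moment:
  fixes u v w :: "real ^ 'd"
  assumes "norm u = 1" and [measurable]: "g \<in> borel_measurable borel" and K: "\<And>z. \<bar>g z\<bar> \<le> K"
  shows "(\<integral>x. g (u \<bullet> x) * ((v \<bullet> x) * (w \<bullet> x)) \<partial>std_gaussian) =
    (\<integral>x. g (u \<bullet> x) * (u \<bullet> x)\<^sup>2 \<partial>std_gaussian) * ((u \<bullet> v) * (u \<bullet> w)) +
    (\<integral>x. g (u \<bullet> x) \<partial>std_gaussian) * (v \<bullet> w - (u \<bullet> v) * (u \<bullet> w))"
proof -
  \<comment> \<open>An arbitrary coordinate; \<open>T\<close> carries its axis to
    \<open>u\<close>.\<close>
  fix k :: 'd
  obtain T :: "real ^ 'd \<Rightarrow> real ^ 'd" where T: "orthogonal_transformation T" and Tk: "T (axis k 1) = u"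
    using orthogonal_transformation_exists_1[of "axis k 1" u] assms(1) by (metis norm_axis_1)
  define v' w' where "v' = inv T v" and "w' = inv T w"
  have "surj T" using T by (rule orthogonal_transformation_surj)
  then have vw: "v = T v'" "w = T w'" by (simp_all add: v'_def w'_def surj_f_inv_f)
  have Tin: "T y \<bullet> T x = y \<bullet> x" for x y
    using T by (simp add: orthogonal_transformation_def)
  have ux: "u \<bullet> T x = x $ k" for x
    using Tin[of "axis k 1" x] by (simp add: Tk inner_axis' )
  let ?a = "\<integral>x. g (x $ k) * (x $ k)\<^sup>2 \<partial>std_gaussian"
  let ?b = "\<integral>x. g (x $ k) \<partial>std_gaussian"
  have int: "integrable std_gaussian (\<lambda>x :: real ^ 'd. g (x $ k) * (x $ i * x $ j))" for i j
  proof (rule integrable_std_gaussian_dominated[where K = K and k = 2])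
    fix x :: "real ^ 'd"
    have "\<bar>x $ i\<bar> * \<bar>x $ j\<bar> \<le> norm x * norm x"
      by (intro mult_mono component_le_norm_cart) auto
    moreover have "K \<ge> 0" using K[of 0] abs_ge_zero order_trans by blast
    ultimately show "\<bar>g (x $ k) * (x $ i * x $ j)\<bar> \<le> K * norm x ^ 2"
      unfolding abs_mult power2_eq_square by (intro mult_mono[OF K]) auto
  qed auto
  have "(\<integral>x. g (u \<bullet> x) * ((v \<bullet> x) * (w \<bullet> x)) \<partial>std_gaussian) =
      (\<integral>x. g (u \<bullet> T x) * ((v \<bullet> T x) * (w \<bullet> T x)) \<partial>std_gaussian)"
    by (rule integral_std_gaussian_orthogonal[OF T, symmetric]) measurable
  also have "\<dots> = (\<integral>x. (\<Sum>i\<in>UNIV. \<Sum>j\<in>UNIV. v' $ i * w' $ j * (g (x $ k) * (x $ i * x $ j))) \<partial>std_gaussian)"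
    unfolding ux unfolding vw Tin unfolding inner_vec_def
    unfolding sum_product unfolding sum_distrib_left
    by (intro Bochner_Integration.integral_cong sum.cong refl) simp
  also have "\<dots> = (\<Sum>i\<in>UNIV. \<Sum>j\<in>UNIV. v' $ i * w' $ j * (\<integral>x. g (x $ k) * (x $ i * x $ j) \<partial>std_gaussian))"
    using int by (simp add: Bochner_Integration.integral_sum)
  also have "\<dots> = (\<Sum>i\<in>UNIV. \<Sum>j\<in>UNIV. if j = i then v' $ i * w' $ i * (if i = k then ?a else ?b) else 0)"
    unfolding std_gaussian_weighted_second_moment_axis[OF assms(2) K]
    by (intro sum.cong refl) auto
  also have "\<dots> = (\<Sum>i\<in>UNIV. ?b * (v' $ i * w' $ i) + (if i = k then (?a - ?b) * (v' $ i * w' $ i) else 0))"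
    by (intro sum.cong refl) (auto simp: algebra_simps)
  also have "\<dots> = ?b * (v' \<bullet> w') + (?a - ?b) * (v' $ k * w' $ k)"
    by (simp add: sum.distrib inner_vec_def flip: sum_distrib_left)
  also have "v' \<bullet> w' = v \<bullet> w" by (simp add: vw Tin)
  also have "v' $ k = u \<bullet> v" by (simp add: vw ux)
  also have "w' $ k = u \<bullet> w" by (simp add: vw ux)
  also have "?a = (\<integral>x. g (u \<bullet> x) * (u \<bullet> x)\<^sup>2 \<partial>std_gaussian)"
    using integral_std_gaussian_orthogonal[OF T, of "\<lambda>x. g (u \<bullet> x) * (u \<bullet> x)\<^sup>2"] by (simp add: ux)
  also have "?b = (\<integral>x. g (u \<bullet> x) \<partial>std_gaussian)"
    using integral_std_gaussian_orthogonal[OF T, of "\<lambda>x. g (u \<bullet> x)"] by (simp add: ux)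
  finally show ?thesis by (simp add: algebra_simps)
qed

section \<open>Deterministic analysis of the logistic loss\<close>

definition softplus :: "real \<Rightarrow> real" where
  "softplus t = ln (1 + exp t)"

lemma sigma_lr_pos: "0 < sigma_lr t" and sigma_lr_less_1: "sigma_lr t < 1"
  by (auto simp: sigma_lr_def add_pos_pos)

lemma sigma_lr_minus: "sigma_lr (- t) = 1 - sigma_lr t"
proof -
  have "1 + exp t > 0" "1 + exp (- t) > 0" by (auto intro: add_pos_pos)
  then show ?thesis by (simp add: sigma_lr_def field_simps flip: exp_add)
qed

lemma measurable_sigma_lr [measurable]: "sigma_lr \<in> borel_measurable borel"
  unfolding sigma_lr_def by measurable

lemma DERIV_softplus: "(softplus has_real_derivative sigma_lr t) (at t)"
proof -
  have "1 + exp t > 0" "1 + exp (- t) > 0" by (auto intro: add_pos_pos)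
  then show ?thesis
    unfolding softplus_def sigma_lr_def
    by (auto intro!: derivative_eq_intros simp: field_simps simp flip: exp_add)
qed

lemma DERIV_sigma_lr: "(sigma_lr has_real_derivative sigma_lr t * (1 - sigma_lr t)) (at t)"
proof -
  have "1 + exp (- t) > 0" by (auto intro: add_pos_pos)
  then show ?thesis
    unfolding sigma_lr_def
    by (auto intro!: derivative_eq_intros simp: field_simps power2_eq_square)
qed

text \<open>The second derivative of \<open>softplus\<close>, and also the conditional variance of
  the indicator of a label being 1; this coincidence is the information identity behind the limit
  covariance.\<close>

definition dsigma :: "real \<Rightarrow> real" where
  "dsigma t = sigma_lr t * (1 - sigma_lr t)"

lemma dsigma_pos: "0 < dsigma t"
  by (simp add: dsigma_def sigma_lr_pos sigma_lr_less_1)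

lemma dsigma_le_1: "dsigma t \<le> 1"
  using mult_mono[of "sigma_lr t" 1 "1 - sigma_lr t" 1] sigma_lr_pos[of t] sigma_lr_less_1[of t]
  by (simp add: dsigma_def)

lemma measurable_dsigma [measurable]: "dsigma \<in> borel_measurable borel"
  unfolding dsigma_def by measurable

lemma DERIV_dsigma: "(dsigma has_real_derivative dsigma t * (1 - 2 * sigma_lr t)) (at t)"
proof -
  have "((\<lambda>t. sigma_lr t * (1 - sigma_lr t)) has_real_derivative dsigma t * (1 - 2 * sigma_lr t)) (at t)"
    by (auto intro!: derivative_eq_intros DERIV_sigma_lr simp: dsigma_def algebra_simps)
  then show ?thesis by (simp add: dsigma_def[abs_def])
qed

lemma convex_softplus: "convex_on UNIV softplus"
proof (rule f''_ge0_imp_convex)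
  show "(softplus has_real_derivative sigma_lr t) (at t)" for t by (rule DERIV_softplus)
  show "(sigma_lr has_real_derivative dsigma t) (at t)" for t
    unfolding dsigma_def by (rule DERIV_sigma_lr)
qed (auto simp: less_imp_le[OF dsigma_pos])

text \<open>The third derivative is \<open>dsigma\<close> times a factor of modulus below 1, so it
  is bounded by 1 everywhere. The bound is uniform in \<open>z\<close> and needs no control of the
  base point; the factor 1/6 is given away.\<close>

lemma softplus_Taylor:
  "\<bar>softplus (z + h) - softplus z - sigma_lr z * h - dsigma z * h\<^sup>2 / 2\<bar> \<le> \<bar>h\<bar> ^ 3"
proof -
  define D where "D k t = (if k = 0 then softplus (z + t) else if k = 1 then sigma_lr (z + t)
    else if k = 2 then dsigma (z + t) else dsigma (z + t) * (1 - 2 * sigma_lr (z + t)))"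
    for k :: nat and t
  have "\<exists>t. \<bar>t\<bar> \<le> \<bar>h\<bar> \<and> softplus (z + h) = (\<Sum>k<3. D k 0 / fact k * h ^ k) + D 3 t / fact 3 * h ^ 3"
  proof (rule Maclaurin_bi_le)
    show "D 0 = (\<lambda>t. softplus (z + t))" by (simp add: D_def[abs_def])
    have "((\<lambda>t. F (z + t)) has_real_derivative F') (at t)"
      if "(F has_real_derivative F') (at (z + t))" for F F' t
      using that DERIV_shift[of F F' t z] by (simp add: add.commute)
    then show "\<forall>k t. k < 3 \<and> \<bar>t\<bar> \<le> \<bar>h\<bar> \<longrightarrow> (D k has_real_derivative D (Suc k) t) (at t)"
      using DERIV_softplus DERIV_sigma_lr[folded dsigma_def] DERIV_dsigma
      by (auto simp: D_def[abs_def] less_Suc_eq numeral_3_eq_3)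
  qed
  then obtain t where t: "softplus (z + h) = (\<Sum>k<3. D k 0 / fact k * h ^ k) + D 3 t / fact 3 * h ^ 3"
    by blast
  have "(\<Sum>k<3. D k 0 / fact k * h ^ k) = softplus z + sigma_lr z * h + dsigma z * h\<^sup>2 / 2"
    by (simp add: D_def numeral_3_eq_3 power2_eq_square)
  with t have "softplus (z + h) - softplus z - sigma_lr z * h - dsigma z * h\<^sup>2 / 2 = D 3 t / 6 * h ^ 3"
    by (simp add: fact_numeral)
  moreover have "\<bar>D 3 t\<bar> \<le> 1"
  proof -
    have "\<bar>dsigma (z + t)\<bar> * \<bar>1 - 2 * sigma_lr (z + t)\<bar> \<le> 1 * 1"
      using sigma_lr_pos[of "z + t"] sigma_lr_less_1[of "z + t"] dsigma_pos[of "z + t"] dsigma_le_1[of "z + t"]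
      by (intro mult_mono) auto
    then show ?thesis by (simp add: D_def abs_mult)
  qed
  then have "\<bar>D 3 t / 6\<bar> * \<bar>h ^ 3\<bar> \<le> 1 * \<bar>h ^ 3\<bar>"
    by (intro mult_right_mono) auto
  ultimately show ?thesis by (simp only: abs_mult power_abs mult_1_left)
qed

text \<open>The label enters only through a term linear in \<open>z\<close>. Hence second and third
  derivatives of the loss do not depend on the labels.\<close>

lemma ln_1_exp_label:
  assumes "y \<in> {-1, 1}"
  shows "ln (1 + exp (- y * z)) = softplus z - (1 + y) / 2 * z"
proof -
  have "ln (1 + exp (- z)) = softplus z - z"
  proof -
    have "1 + exp z > 0" by (auto intro: add_pos_pos)
    then have "ln (exp (- z) * (1 + exp z)) = - z + softplus z"
      by (subst ln_mult) (auto simp: softplus_def)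
    moreover have "exp (- z) * (1 + exp z) = 1 + exp (- z)"
      by (simp add: distrib_left flip: exp_add)
    ultimately show ?thesis by simp
  qed
  then show ?thesis using assms by (auto simp: softplus_def)
qed

text \<open>\<open>(1 + y) / 2\<close> is the indicator of the label \<open>y = 1\<close>.\<close>
definition label_mean :: "nat \<Rightarrow> (nat \<Rightarrow> real) \<Rightarrow> real" where
  "label_mean m y = (\<Sum>j<m. (1 + y j) / 2) / real m"

text \<open>The labels of one example matter only through their mean, which leaves a sum of one term
  per example.\<close>

lemma logistic_loss_eq:
  assumes "m \<ge> 1" and "\<And>i j. j < m \<Longrightarrow> y i j \<in> {-1, 1}"
  shows "logistic_loss n m x y \<theta> =
    (\<Sum>i<n. softplus (x i \<bullet> \<theta>) - label_mean m (y i) * (x i \<bullet> \<theta>)) / real n"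
proof -
  have "(\<Sum>j<m. ln (1 + exp (- y i j * (x i \<bullet> \<theta>)))) =
      real m * (softplus (x i \<bullet> \<theta>) - label_mean m (y i) * (x i \<bullet> \<theta>))" for i
  proof -
    have "(\<Sum>j<m. ln (1 + exp (- y i j * (x i \<bullet> \<theta>)))) =
        (\<Sum>j<m. softplus (x i \<bullet> \<theta>) - (1 + y i j) / 2 * (x i \<bullet> \<theta>))"
      using assms(2) by (intro sum.cong refl ln_1_exp_label) auto
    also have "\<dots> = real m * softplus (x i \<bullet> \<theta>) - (\<Sum>j<m. (1 + y i j) / 2) * (x i \<bullet> \<theta>)"
      by (simp only: sum_subtractf sum_distrib_right) simp
    finally show ?thesis
      using assms(1) by (simp add: label_mean_def right_diff_distrib)
  qed
  then show ?thesis
    using assms(1) by (simp add: logistic_loss_def flip: sum_distrib_left)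
qed

text \<open>On the segment from \<open>c\<close> to a point outside the ball, convexity carries the
  strict increase on the sphere to that point. Thus a minimizer over the compact ball is global, and
  no minimizer lies on or outside the sphere.\<close>

lemma convex_argmin_near_center:
  fixes f :: "'b::euclidean_space \<Rightarrow> real"
  assumes convex: "convex_on UNIV f" and cont: "continuous_on UNIV f" and "r > 0"
    and sphere: "\<And>x. dist c x = r \<Longrightarrow> f c < f x"
  shows "\<exists>x. is_arg_min f (\<lambda>_. True) x"
    and "\<And>x. is_arg_min f (\<lambda>_. True) x \<Longrightarrow> dist c x < r"
proof -
  have out: "f c < f x" if "dist c x \<ge> r" for x
  proof -
    \<comment> \<open>The parameter at which the segment from \<open>c\<close> to \<open>x\<close>
      crosses the sphere.\<close>
    define t where "t = r / dist c x"
    have cx: "dist c x > 0" using that \<open>r > 0\<close> by linarith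
    then have t: "0 < t" "t \<le> 1" using that \<open>r > 0\<close> by (auto simp: t_def simp del: zero_less_dist_iff)
    define p where "p = (1 - t) *\<^sub>R c + t *\<^sub>R x"
    have "c - p = t *\<^sub>R (c - x)" by (simp add: p_def algebra_simps)
    then have "dist c p = t * dist c x" using t by (simp add: dist_norm)
    then have "dist c p = r" using cx by (simp add: t_def)
    then have "f c < f p" by (rule sphere)
    also have "f p \<le> (1 - t) * f c + t * f x"
      unfolding p_def using convex_onD[OF convex] t by auto
    finally have "t * f c < t * f x" by (simp add: algebra_simps)
    then show ?thesis using t by simp
  qed
  obtain x0 where x0: "x0 \<in> cball c r" "\<And>x. x \<in> cball c r \<Longrightarrow> f x0 \<le> f x"
    using continuous_attains_inf[of "cball c r" f] continuous_on_subset[OF cont] \<open>r > 0\<close> by auto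
  have "f x0 \<le> f x" for x
    using x0(2)[of x] x0(2)[of c] out[of x] \<open>r > 0\<close> by (cases "x \<in> cball c r") auto
  then show "\<exists>x. is_arg_min f (\<lambda>_. True) x"
    by (auto simp: is_arg_min_def not_less)
  show "dist c x < r" if "is_arg_min f (\<lambda>_. True) x" for x
    using that out[of x] by (auto simp: is_arg_min_def not_le[symmetric])
qed

text \<open>Cauchy-Schwarz over index pairs: the matrix with entries \<open>s $ k * s $ l\<close>
  has Frobenius norm \<open>(norm s)\<^sup>2\<close>.\<close>

lemma frobenius_bound:
  fixes s :: "real ^ 'd" and D :: "'d \<Rightarrow> 'd \<Rightarrow> real"
  assumes "(\<Sum>k\<in>UNIV. \<Sum>l\<in>UNIV. (D k l)\<^sup>2) \<le> \<eta>\<^sup>2" and "\<eta> \<ge> 0"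
  shows "\<bar>\<Sum>k\<in>UNIV. \<Sum>l\<in>UNIV. s $ k * s $ l * D k l\<bar> \<le> (norm s)\<^sup>2 * \<eta>"
proof (rule power2_le_imp_le)
  have "(\<Sum>k\<in>UNIV. \<Sum>l\<in>UNIV. s $ k * s $ l * D k l)\<^sup>2 =
      (\<Sum>p\<in>UNIV \<times> UNIV. (s $ fst p * s $ snd p) * D (fst p) (snd p))\<^sup>2"
    by (simp add: sum.cartesian_product split_beta)
  also have "\<dots> \<le> (\<Sum>p\<in>UNIV \<times> UNIV. (s $ fst p * s $ snd p)\<^sup>2) *
      (\<Sum>p\<in>UNIV \<times> UNIV. (D (fst p) (snd p))\<^sup>2)"
    by (rule Cauchy_Schwarz_ineq_sum)
  also have "(\<Sum>p\<in>UNIV \<times> UNIV. (s $ fst p * s $ snd p)\<^sup>2) = ((norm s)\<^sup>2)\<^sup>2"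
    unfolding power2_norm_vec power2_eq_square[of "sum _ _"] sum_product
    by (simp add: sum.cartesian_product split_beta power_mult_distrib)
  also have "(\<Sum>p\<in>UNIV \<times> UNIV. (D (fst p) (snd p))\<^sup>2) = (\<Sum>k\<in>UNIV. \<Sum>l\<in>UNIV. (D k l)\<^sup>2)"
    by (simp add: sum.cartesian_product split_beta)
  also have "((norm s)\<^sup>2)\<^sup>2 * \<dots> \<le> ((norm s)\<^sup>2)\<^sup>2 * \<eta>\<^sup>2"
    using assms(1) by (intro mult_left_mono) auto
  finally show "\<bar>\<Sum>k\<in>UNIV. \<Sum>l\<in>UNIV. s $ k * s $ l * D k l\<bar>\<^sup>2 \<le> ((norm s)\<^sup>2 * \<eta>)\<^sup>2"
    by (simp add: power_mult_distrib)
qed (use assms in auto)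

text \<open>
  The quadratic form of the matrix \<open>a u u\<^sup>T + b (I - u u\<^sup>T)\<close>, for a unit vector \<open>u\<close>, and the action
  of the inverse matrix.
\<close>
definition spiked_form :: "real \<Rightarrow> real \<Rightarrow> real ^ 'd \<Rightarrow> real ^ 'd \<Rightarrow> real" where
  "spiked_form a b u s = a * (u \<bullet> s)\<^sup>2 + b * ((norm s)\<^sup>2 - (u \<bullet> s)\<^sup>2)"

definition spiked_inverse :: "real \<Rightarrow> real \<Rightarrow> real ^ 'd \<Rightarrow> real ^ 'd \<Rightarrow> real ^ 'd" where
  "spiked_inverse a b u v = (1 / b) *\<^sub>R v + ((1 / a - 1 / b) * (u \<bullet> v)) *\<^sub>R u"

text \<open>The eigenvalues are \<open>a\<close> along \<open>u\<close> and \<open>b\<close> on the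
  orthogonal complement.\<close>

lemma spiked_form_ge:
  assumes "norm u = 1"
  shows "spiked_form a b u s \<ge> min a b * (norm s)\<^sup>2"
proof -
  have "(u \<bullet> s)\<^sup>2 \<le> (norm s)\<^sup>2"
    using Cauchy_Schwarz_ineq[of u s] assms by (simp add: norm_eq_1 power2_norm_eq_inner)
  then have "min a b * (u \<bullet> s)\<^sup>2 + min a b * ((norm s)\<^sup>2 - (u \<bullet> s)\<^sup>2) \<le> spiked_form a b u s"
    unfolding spiked_form_def by (intro add_mono mult_right_mono) auto
  then show ?thesis by (simp add: algebra_simps)
qed

text \<open>Completing the square.\<close>
lemma spiked_form_shift:
  fixes u v s :: "real ^ 'd"
  assumes "norm u = 1" and "a > 0" and "b > 0"
  defines "c \<equiv> - spiked_inverse a b u v"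
  shows "v \<bullet> s + spiked_form a b u s / 2 = v \<bullet> c + spiked_form a b u c / 2 + spiked_form a b u (s - c) / 2"
proof -
  define e where "e = s - c"
  have s: "s = c + e" by (simp add: e_def)
  have uu: "u \<bullet> u = 1" using assms(1) by (simp add: norm_eq_1)
  have uc: "u \<bullet> c = - (u \<bullet> v) / a"
    using assms(2,3) by (simp add: c_def spiked_inverse_def inner_simps uu field_simps)
  have ce: "c \<bullet> e = - (v \<bullet> e) / b - (1 / a - 1 / b) * (u \<bullet> v) * (u \<bullet> e)"
    by (simp add: c_def spiked_inverse_def inner_simps)
  have n: "(norm (c + e))\<^sup>2 = (norm c)\<^sup>2 + (norm e)\<^sup>2 + 2 * (c \<bullet> e)"
    unfolding power2_norm_eq_inner by (simp add: inner_simps inner_commute)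
  have "spiked_form a b u (c + e) = spiked_form a b u c + spiked_form a b u e +
      2 * (a * (u \<bullet> c) * (u \<bullet> e) + b * (c \<bullet> e - (u \<bullet> c) * (u \<bullet> e)))"
    by (simp add: spiked_form_def n inner_right_distrib power2_sum algebra_simps)
  also have "a * (u \<bullet> c) * (u \<bullet> e) + b * (c \<bullet> e - (u \<bullet> c) * (u \<bullet> e)) = - (v \<bullet> e)"
    unfolding uc ce using assms(2,3) by (simp add: field_simps)
  finally show ?thesis
    unfolding e_def[symmetric] unfolding s by (simp add: inner_right_distrib field_simps)
qed

lemma norm_spiked_inverse_le:
  assumes "norm u = 1"
  shows "norm (spiked_inverse a b u v) \<le> (\<bar>1 / b\<bar> + \<bar>1 / a - 1 / b\<bar>) * norm v"
proof -
  have "norm (spiked_inverse a b u v) \<le> \<bar>1 / b\<bar> * norm v + \<bar>1 / a - 1 / b\<bar> * \<bar>u \<bullet> v\<bar>"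
    unfolding spiked_inverse_def using norm_triangle_ineq by (rule order_trans) (simp add: abs_mult assms)
  also have "\<dots> \<le> \<bar>1 / b\<bar> * norm v + \<bar>1 / a - 1 / b\<bar> * norm v"
    using Cauchy_Schwarz_ineq2[of u v] assms by (intro add_left_mono mult_left_mono) auto
  finally show ?thesis by (simp add: distrib_right)
qed

text \<open>Taylor's formula for each example at displacement \<open>s / sqrt n\<close>. The cubic
  remainders add up to \<open>norm s ^ 3\<close> times the quantity in the hypothesis
  \<open>T\<close>; replacing the empirical Hessian by \<open>H\<close> costs its Frobenius
  distance. One \<open>\<eta>\<close> bounds both.\<close>

lemma logistic_objective_expansion:
  fixes x :: "nat \<Rightarrow> real ^ 'd" and c :: "nat \<Rightarrow> real" and n :: nat
  defines "J \<equiv> \<lambda>\<theta>. \<Sum>i<n. softplus (x i \<bullet> \<theta>) - c i * (x i \<bullet> \<theta>)"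
  assumes "n \<ge> 1"
    and form: "\<And>s. (\<Sum>k\<in>UNIV. \<Sum>l\<in>UNIV. s $ k * s $ l * H k l) = q s"
    and Q: "(\<Sum>k\<in>UNIV. \<Sum>l\<in>UNIV.
      ((\<Sum>i<n. dsigma (x i \<bullet> \<theta>) * (x i $ k * x i $ l)) / real n - H k l)\<^sup>2) \<le> \<eta>\<^sup>2"
    and T: "(\<Sum>i<n. norm (x i) ^ 3) / (real n * sqrt (real n)) \<le> \<eta>" and "\<eta> \<ge> 0"
  shows "\<bar>J (\<theta> + (1 / sqrt (real n)) *\<^sub>R s) - J \<theta> -
      (((1 / sqrt (real n)) *\<^sub>R (\<Sum>i<n. (sigma_lr (x i \<bullet> \<theta>) - c i) *\<^sub>R x i)) \<bullet> s + q s / 2)\<bar>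
    \<le> \<eta> * ((norm s)\<^sup>2 / 2 + norm s ^ 3)"
proof -
  define w where "w = 1 / sqrt (real n)"
  have w: "w > 0" "w\<^sup>2 = 1 / real n" "w ^ 3 = 1 / (real n * sqrt (real n))"
    using \<open>n \<ge> 1\<close> by (auto simp: w_def power_divide power3_eq_cube)
  define h where "h i = w * (x i \<bullet> s)" for i
  define D where "D k l = (\<Sum>i<n. dsigma (x i \<bullet> \<theta>) * (x i $ k * x i $ l)) / real n - H k l" for k l
  define rem where "rem i = softplus (x i \<bullet> \<theta> + h i) - softplus (x i \<bullet> \<theta>) - sigma_lr (x i \<bullet> \<theta>) * h i
    - dsigma (x i \<bullet> \<theta>) * (h i)\<^sup>2 / 2" for i
  have "\<bar>\<Sum>i<n. rem i\<bar> \<le> (\<Sum>i<n. (w * norm s) ^ 3 * norm (x i) ^ 3)"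
  proof (rule order_trans[OF sum_abs sum_mono])
    fix i
    have "\<bar>h i\<bar> \<le> w * norm s * norm (x i)"
      using Cauchy_Schwarz_ineq2[of "x i" s] w by (simp add: h_def abs_mult mult_ac)
    then have "\<bar>h i\<bar> ^ 3 \<le> (w * norm s * norm (x i)) ^ 3" by (intro power_mono) auto
    then show "\<bar>rem i\<bar> \<le> (w * norm s) ^ 3 * norm (x i) ^ 3"
      using softplus_Taylor[of "x i \<bullet> \<theta>" "h i"] by (simp add: rem_def power_mult_distrib)
  qed
  also have "\<dots> = norm s ^ 3 * ((\<Sum>i<n. norm (x i) ^ 3) / (real n * sqrt (real n)))"
    by (simp add: power_mult_distrib w sum_distrib_left sum_divide_distrib)
  also have "\<dots> \<le> norm s ^ 3 * \<eta>" using T by (intro mult_left_mono) auto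
  finally have rem: "\<bar>\<Sum>i<n. rem i\<bar> \<le> norm s ^ 3 * \<eta>" .

  \<comment> \<open>Expanding the squared inner products and exchanging sums yields the quadratic
    form of the empirical Hessian, split into the limit \<open>H\<close> and the error
    \<open>D\<close>.\<close>
  have quad: "(\<Sum>i<n. dsigma (x i \<bullet> \<theta>) * (h i)\<^sup>2) = q s + (\<Sum>k\<in>UNIV. \<Sum>l\<in>UNIV. s $ k * s $ l * D k l)"
  proof -
    have "(\<Sum>i<n. dsigma (x i \<bullet> \<theta>) * (h i)\<^sup>2) =
        (\<Sum>i<n. \<Sum>k\<in>UNIV. \<Sum>l\<in>UNIV. s $ k * s $ l * (dsigma (x i \<bullet> \<theta>) * (x i $ k * x i $ l) / real n))"
    proof (rule sum.cong[OF refl])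
      fix i
      have "(x i \<bullet> s)\<^sup>2 = (\<Sum>k\<in>UNIV. \<Sum>l\<in>UNIV. (x i $ k * s $ k) * (x i $ l * s $ l))"
        unfolding power2_eq_square inner_vec_def sum_product by simp
      then have "dsigma (x i \<bullet> \<theta>) * (h i)\<^sup>2 =
          (dsigma (x i \<bullet> \<theta>) / real n) * (\<Sum>k\<in>UNIV. \<Sum>l\<in>UNIV. (x i $ k * s $ k) * (x i $ l * s $ l))"
        by (simp add: h_def power_mult_distrib w)
      then show "dsigma (x i \<bullet> \<theta>) * (h i)\<^sup>2 =
          (\<Sum>k\<in>UNIV. \<Sum>l\<in>UNIV. s $ k * s $ l * (dsigma (x i \<bullet> \<theta>) * (x i $ k * x i $ l) / real n))"
        by (simp only: sum_distrib_left) (simp add: mult_ac)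
    qed
    also have "\<dots> = (\<Sum>k\<in>UNIV. \<Sum>i<n. \<Sum>l\<in>UNIV. s $ k * s $ l * (dsigma (x i \<bullet> \<theta>) * (x i $ k * x i $ l) / real n))"
      by (rule sum.swap)
    also have "\<dots> = (\<Sum>k\<in>UNIV. \<Sum>l\<in>UNIV. \<Sum>i<n. s $ k * s $ l * (dsigma (x i \<bullet> \<theta>) * (x i $ k * x i $ l) / real n))"
      by (intro sum.cong refl sum.swap)
    also have "\<dots> = (\<Sum>k\<in>UNIV. \<Sum>l\<in>UNIV. s $ k * s $ l * H k l + s $ k * s $ l * D k l)"
      by (intro sum.cong refl)
        (simp add: D_def right_diff_distrib sum_divide_distrib sum_distrib_left mult.assoc)
    finally show ?thesis by (simp add: sum.distrib form)
  qed
  have "(\<Sum>k\<in>UNIV. \<Sum>l\<in>UNIV. (D k l)\<^sup>2) \<le> \<eta>\<^sup>2" using Q by (simp add: D_def)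
  note DQ = frobenius_bound[OF this \<open>\<eta> \<ge> 0\<close>, of s]

  have "J (\<theta> + w *\<^sub>R s) - J \<theta> =
      (\<Sum>i<n. rem i + (sigma_lr (x i \<bullet> \<theta>) - c i) * h i + dsigma (x i \<bullet> \<theta>) * (h i)\<^sup>2 / 2)"
    unfolding J_def sum_subtractf[symmetric]
    by (intro sum.cong refl) (simp add: rem_def h_def inner_right_distrib algebra_simps)
  also have "\<dots> = (\<Sum>i<n. rem i) + (w *\<^sub>R (\<Sum>i<n. (sigma_lr (x i \<bullet> \<theta>) - c i) *\<^sub>R x i)) \<bullet> s
      + (\<Sum>i<n. dsigma (x i \<bullet> \<theta>) * (h i)\<^sup>2) / 2"
    by (simp add: sum.distrib h_def inner_sum_left sum_distrib_left sum_divide_distrib mult_ac)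
  moreover have "\<eta> * ((norm s)\<^sup>2 / 2 + norm s ^ 3) = (norm s)\<^sup>2 * \<eta> / 2 + norm s ^ 3 * \<eta>"
    by (simp add: algebra_simps)
  ultimately show ?thesis
    unfolding w_def[symmetric] using rem DQ quad by linarith
qed

text \<open>On the sphere of radius \<open>\<delta>\<close> around the minimizer of the quadratic
  model, the model has grown by at least \<open>min a b * \<delta>\<^sup>2 / 2\<close>. The
  expansion errors at the center and at the sphere point sum to at most
  \<open>\<eta> * (\<rho>\<^sup>2 + 2 * \<rho> ^ 3)\<close>, which the last hypothesis keeps below
  this gain.\<close>

lemma mle_localization:
  fixes x :: "nat \<Rightarrow> real ^ 'd" and y :: "nat \<Rightarrow> nat \<Rightarrow> real" and \<theta> u :: "real ^ 'd"
  assumes "n \<ge> 1" and "m \<ge> 1" and y: "\<And>i j. j < m \<Longrightarrow> y i j \<in> {-1, 1}"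
    and u: "norm u = 1" and ab: "a > 0" "b > 0"
    and form: "\<And>s. (\<Sum>k\<in>UNIV. \<Sum>l\<in>UNIV. s $ k * s $ l * H k l) = spiked_form a b u s"
    and Q: "(\<Sum>k\<in>UNIV. \<Sum>l\<in>UNIV.
      ((\<Sum>i<n. dsigma (x i \<bullet> \<theta>) * (x i $ k * x i $ l)) / real n - H k l)\<^sup>2) \<le> \<eta>\<^sup>2"
    and T: "(\<Sum>i<n. norm (x i) ^ 3) / (real n * sqrt (real n)) \<le> \<eta>" and "\<eta> \<ge> 0"
    and U: "U = (1 / sqrt (real n)) *\<^sub>R (\<Sum>i<n. (sigma_lr (x i \<bullet> \<theta>) - label_mean m (y i)) *\<^sub>R x i)"
    and R: "norm U \<le> R" and "\<delta> > 0"
    and \<rho>: "\<rho> = (\<bar>1 / b\<bar> + \<bar>1 / a - 1 / b\<bar>) * R + \<delta>"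
    and \<eta>: "\<eta> * (\<rho>\<^sup>2 + 2 * \<rho> ^ 3) < min a b * \<delta>\<^sup>2 / 2"
  shows "\<exists>\<theta>'. is_arg_min (logistic_loss n m x y) (\<lambda>_. True) \<theta>'"
    and "\<And>\<theta>'. is_arg_min (logistic_loss n m x y) (\<lambda>_. True) \<theta>' \<Longrightarrow>
      norm (sqrt (real n) *\<^sub>R (\<theta>' - \<theta>) + spiked_inverse a b u U) < \<delta>"
proof -
  define J where "J \<theta>' = (\<Sum>i<n. softplus (x i \<bullet> \<theta>') - label_mean m (y i) * (x i \<bullet> \<theta>'))" for \<theta>'
  have L: "logistic_loss n m x y = (\<lambda>\<theta>'. J \<theta>' / real n)"
    by (intro ext) (simp only: J_def logistic_loss_eq[OF \<open>m \<ge> 1\<close> y])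
  have argmin: "is_arg_min (logistic_loss n m x y) (\<lambda>_. True) = is_arg_min J (\<lambda>_. True)"
    using \<open>n \<ge> 1\<close> by (auto simp: is_arg_min_def L fun_eq_iff divide_less_cancel)
  define c where "c = - spiked_inverse a b u U"
  define w where "w = 1 / sqrt (real n)"
  have w: "w > 0" "sqrt (real n) = 1 / w" using \<open>n \<ge> 1\<close> by (auto simp: w_def)
  have "R \<ge> 0" using R norm_ge_zero order_trans by blast
  \<comment> \<open>This is why \<open>\<rho>\<close> has the summand \<open>\<delta>\<close>: the
    ball of radius \<open>\<rho>\<close> around 0 contains the center \<open>c\<close> and the whole
    sphere around it.\<close>
  have c_le: "norm c \<le> \<rho> - \<delta>"
  proof -
    have "norm c \<le> (\<bar>1 / b\<bar> + \<bar>1 / a - 1 / b\<bar>) * norm U"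
      using norm_spiked_inverse_le[OF u] by (simp add: c_def)
    also have "\<dots> \<le> (\<bar>1 / b\<bar> + \<bar>1 / a - 1 / b\<bar>) * R"
      using R by (intro mult_left_mono) auto
    finally show ?thesis by (simp add: \<rho>)
  qed
  have err: "\<bar>J (\<theta> + w *\<^sub>R s) - J \<theta> - (U \<bullet> s + spiked_form a b u s / 2)\<bar> \<le> \<eta> * (\<rho>\<^sup>2 / 2 + \<rho> ^ 3)"
    if "norm s \<le> \<rho>" for s
  proof -
    have "\<bar>J (\<theta> + w *\<^sub>R s) - J \<theta> - (U \<bullet> s + spiked_form a b u s / 2)\<bar>
        \<le> \<eta> * ((norm s)\<^sup>2 / 2 + norm s ^ 3)"
      unfolding J_def U w_def by (rule logistic_objective_expansion) fact+
    also have "\<dots> \<le> \<eta> * (\<rho>\<^sup>2 / 2 + \<rho> ^ 3)"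
      using that \<open>\<eta> \<ge> 0\<close> by (intro mult_left_mono add_mono divide_right_mono power_mono) auto
    finally show ?thesis .
  qed
  \<comment> \<open>The sphere in the original parameter; its radius \<open>w * \<delta>\<close> is
    \<open>\<delta>\<close> in the local variable.\<close>
  have sphere: "J (\<theta> + w *\<^sub>R c) < J \<theta>'" if "dist (\<theta> + w *\<^sub>R c) \<theta>' = w * \<delta>" for \<theta>'
  proof -
    define s where "s = (1 / w) *\<^sub>R (\<theta>' - \<theta>)"
    have \<theta>': "\<theta>' = \<theta> + w *\<^sub>R s" using w by (simp add: s_def)
    have "norm (w *\<^sub>R (c - s)) = w * \<delta>"
      using that by (simp add: \<theta>' dist_norm algebra_simps)
    then have sc: "norm (s - c) = \<delta>" using w by (simp add: norm_minus_commute)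
    then have "norm s \<le> \<rho>" using c_le norm_triangle_sub[of s c] by linarith
    note es = err[OF this]
    have "norm c \<le> \<rho>" using c_le \<open>\<delta> > 0\<close> by linarith
    note ec = err[OF this]
    have "spiked_form a b u (s - c) \<ge> min a b * \<delta>\<^sup>2"
      using spiked_form_ge[OF u, of a b "s - c"] sc by simp
    moreover have "U \<bullet> s + spiked_form a b u s / 2 =
        U \<bullet> c + spiked_form a b u c / 2 + spiked_form a b u (s - c) / 2"
      unfolding c_def by (rule spiked_form_shift[OF u ab])
    moreover have "\<eta> * (\<rho>\<^sup>2 + 2 * \<rho> ^ 3) = 2 * (\<eta> * (\<rho>\<^sup>2 / 2 + \<rho> ^ 3))"
      by (simp add: algebra_simps)
    ultimately show ?thesis
      using es ec \<eta> unfolding \<theta>' by linarith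
  qed
  have "continuous_on UNIV softplus"
    using DERIV_softplus by (meson DERIV_continuous_on has_field_derivative_at_within)
  then have cont: "continuous_on UNIV J"
    unfolding J_def by (intro continuous_intros continuous_on_compose2[OF \<open>continuous_on UNIV softplus\<close>]) auto
  have convex: "convex_on UNIV J"
  proof (rule convex_onI)
    fix t :: real and v v' :: "real ^ 'd" assume t: "0 < t" "t < 1"
    show "J ((1 - t) *\<^sub>R v + t *\<^sub>R v') \<le> (1 - t) * J v + t * J v'"
      unfolding J_def sum_distrib_left sum.distrib[symmetric]
    proof (rule sum_mono)
      fix i
      have "softplus ((1 - t) * (x i \<bullet> v) + t * (x i \<bullet> v')) \<le>
          (1 - t) * softplus (x i \<bullet> v) + t * softplus (x i \<bullet> v')"
        using convex_onD[OF convex_softplus, of t "x i \<bullet> v" "x i \<bullet> v'"] t by simp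
      then show "softplus (x i \<bullet> ((1 - t) *\<^sub>R v + t *\<^sub>R v')) -
          label_mean m (y i) * (x i \<bullet> ((1 - t) *\<^sub>R v + t *\<^sub>R v')) \<le>
          (1 - t) * (softplus (x i \<bullet> v) - label_mean m (y i) * (x i \<bullet> v)) +
          t * (softplus (x i \<bullet> v') - label_mean m (y i) * (x i \<bullet> v'))"
        by (simp add: inner_right_distrib algebra_simps)
    qed
  qed simp
  have "w * \<delta> > 0" using w \<open>\<delta> > 0\<close> by simp
  note near = convex_argmin_near_center[OF convex cont this sphere]
  show "\<exists>\<theta>'. is_arg_min (logistic_loss n m x y) (\<lambda>_. True) \<theta>'"
    unfolding argmin using near(1) by blast
  show "norm (sqrt (real n) *\<^sub>R (\<theta>' - \<theta>) + spiked_inverse a b u U) < \<delta>"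
    if "is_arg_min (logistic_loss n m x y) (\<lambda>_. True) \<theta>'" for \<theta>'
  proof -
    have "dist (\<theta> + w *\<^sub>R c) \<theta>' < w * \<delta>"
      using near(2) that unfolding argmin by blast
    also have "dist (\<theta> + w *\<^sub>R c) \<theta>' = norm (w *\<^sub>R (sqrt (real n) *\<^sub>R (\<theta>' - \<theta>) - c))"
      using w by (simp add: dist_norm norm_minus_commute algebra_simps)
    finally show ?thesis using w by (simp add: c_def)
  qed
qed

text \<open>Origin of the projection and of the factor 1/t in the limit: to first order,
  normalization discards the radial part and divides the tangential part by the length.\<close>

lemma has_derivative_normalize:
  fixes v :: "'b::real_inner"
  assumes "v \<noteq> 0"
  defines "u \<equiv> v /\<^sub>R norm v"
  shows "((\<lambda>x. x /\<^sub>R norm x) has_derivative (\<lambda>h. (h - (u \<bullet> h) *\<^sub>R u) /\<^sub>R norm v)) (at v)"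
proof -
  have "((\<lambda>x. inverse (norm x) *\<^sub>R x) has_derivative
      (\<lambda>h. inverse (norm v) *\<^sub>R h + (- (inverse (norm v) * (h \<bullet> sgn v) * inverse (norm v))) *\<^sub>R v)) (at v)"
    using assms(1) by (auto intro!: derivative_eq_intros has_derivative_norm)
  moreover have "(\<lambda>h. inverse (norm v) *\<^sub>R h + (- (inverse (norm v) * (h \<bullet> sgn v) * inverse (norm v))) *\<^sub>R v)
      = (\<lambda>h. (h - (u \<bullet> h) *\<^sub>R u) /\<^sub>R norm v)"
    by (auto simp: u_def sgn_div_norm fun_eq_iff scaleR_diff_right inner_commute algebra_simps)
  ultimately show ?thesis by simp
qed

section \<open>Moments of the score\<close>

text \<open>Cross terms vanish by independence and centering. Serves both for projections of the
  score and for the entries of the empirical Hessian.\<close>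

lemma (in prob_space) indep_sum_second_moment:
  fixes Z :: "nat \<Rightarrow> 'a \<Rightarrow> real"
  assumes indep: "indep_vars (\<lambda>_. borel) Z UNIV"
    and int: "\<And>i. integrable M (\<lambda>\<omega>. (Z i \<omega>)\<^sup>2)"
    and mean: "\<And>i. expectation (Z i) = 0" and var: "\<And>i. expectation (\<lambda>\<omega>. (Z i \<omega>)\<^sup>2) = v"
  shows "integrable M (\<lambda>\<omega>. (\<Sum>i<n. Z i \<omega>)\<^sup>2)" and "expectation (\<lambda>\<omega>. (\<Sum>i<n. Z i \<omega>)\<^sup>2) = real n * v"
proof -
  have [measurable]: "Z i \<in> borel_measurable M" for i
    using indep unfolding indep_vars_def2 by simp
  have int1: "integrable M (Z i)" for i
    by (rule square_integrable_imp_integrable[OF _ int]) simp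
  have pair: "integrable M (\<lambda>\<omega>. Z i \<omega> * Z j \<omega>)"
      "expectation (\<lambda>\<omega>. Z i \<omega> * Z j \<omega>) = (if i = j then v else 0)" for i j
  proof -
    have "integrable M (\<lambda>\<omega>. Z i \<omega> * Z j \<omega>) \<and>
      expectation (\<lambda>\<omega>. Z i \<omega> * Z j \<omega>) = (if i = j then v else 0)"
    proof (cases "i = j")
      case True
      then show ?thesis using int var by (simp add: power2_eq_square)
    next
      case False
      have "indep_vars (\<lambda>_. borel) Z {i, j}"
        by (rule indep_vars_subset[OF indep]) auto
      from indep_vars_lebesgue_integral[OF _ this] indep_vars_integrable[OF _ this] False
      show ?thesis by (simp add: int1 mean)
    qed
    then show "integrable M (\<lambda>\<omega>. Z i \<omega> * Z j \<omega>)"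
      "expectation (\<lambda>\<omega>. Z i \<omega> * Z j \<omega>) = (if i = j then v else 0)" by auto
  qed
  have sq: "(\<Sum>i<n. Z i \<omega>)\<^sup>2 = (\<Sum>i<n. \<Sum>j<n. Z i \<omega> * Z j \<omega>)" for \<omega>
    by (simp add: power2_eq_square sum_product)
  show "integrable M (\<lambda>\<omega>. (\<Sum>i<n. Z i \<omega>)\<^sup>2)"
    unfolding sq by (intro Bochner_Integration.integrable_sum pair)
  have "expectation (\<lambda>\<omega>. (\<Sum>i<n. Z i \<omega>)\<^sup>2) = (\<Sum>i<n. \<Sum>j<n. if i = j then v else 0)"
    unfolding sq by (simp add: Bochner_Integration.integral_sum Bochner_Integration.integrable_sum pair)
  then show "expectation (\<lambda>\<omega>. (\<Sum>i<n. Z i \<omega>)\<^sup>2) = real n * v" by simp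
qed

section \<open>Conditional moments as finite sums over label vectors\<close>

abbreviation labels :: "nat \<Rightarrow> (nat \<Rightarrow> real) set" where
  "labels m \<equiv> {..<m} \<rightarrow>\<^sub>E {-1, 1}"

lemma finite_labels: "finite (labels m)"
  by (intro finite_PiE) auto

text \<open>Distributivity, playing the role of Fubini's theorem for conditionally independent
  labels. The label vectors are extensional, so that they form a finite set.\<close>

lemma sum_labels_prod:
  fixes \<phi> :: "nat \<Rightarrow> real \<Rightarrow> real"
  shows "(\<Sum>y\<in>labels m. \<Prod>j<m. \<phi> j (y j)) = (\<Prod>j<m. \<phi> j (-1) + \<phi> j 1)"
  by (subst prod_sum_PiE[symmetric]) auto

text \<open>\<open>e\<close> is \<open>sigma_lr z\<close> with weight \<open>1 - sigma_lr z\<close>,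
  and \<open>sigma_lr z - 1\<close> with weight \<open>sigma_lr z\<close>: mean 0 and variance
  \<open>dsigma z\<close>. The weights of every other label sum to 1, and two distinct labels
  contribute a product of zero means.\<close>

lemma sum_labels_centered:
  fixes z :: real
  assumes "j < m"
  defines "e \<equiv> \<lambda>v. sigma_lr z - (1 + v) / 2"
  shows "(\<Sum>y\<in>labels m. e (y j) * (\<Prod>l<m. sigma_lr (y l * z))) = 0"
    and "k < m \<Longrightarrow> (\<Sum>y\<in>labels m. e (y j) * e (y k) * (\<Prod>l<m. sigma_lr (y l * z))) =
      (if j = k then dsigma z else 0)"
proof -
  have e: "e (-1) = sigma_lr z" "e 1 = sigma_lr z - 1" by (simp_all add: e_def)
  \<comment> \<open>Writes \<open>e (y j)\<close> as a product over all labels with trivial factors,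
    so that it merges with the product of weights.\<close>
  have pick: "(\<Prod>l<m. if l = j then f (y l) else 1) = f (y j)" if "j < m" for f :: "real \<Rightarrow> real" and j y
    using that by (simp add: prod.delta)
  have "(\<Sum>y\<in>labels m. e (y j) * (\<Prod>l<m. sigma_lr (y l * z))) =
      (\<Sum>y\<in>labels m. \<Prod>l<m. (if l = j then e (y l) else 1) * sigma_lr (y l * z))"
    using pick[OF \<open>j < m\<close>, of e] by (simp only: prod.distrib)
  also have "\<dots> = (\<Prod>l<m. (if l = j then e (-1) else 1) * sigma_lr (-1 * z) +
      (if l = j then e 1 else 1) * sigma_lr (1 * z))"
    by (rule sum_labels_prod[of "\<lambda>l v. (if l = j then e v else 1) * sigma_lr (v * z)"])
  also have "\<dots> = 0"
    using \<open>j < m\<close> by (intro prod_zero bexI[of _ j]) (auto simp: e sigma_lr_minus algebra_simps)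
  finally show "(\<Sum>y\<in>labels m. e (y j) * (\<Prod>l<m. sigma_lr (y l * z))) = 0" .
  assume "k < m"
  have "(\<Sum>y\<in>labels m. e (y j) * e (y k) * (\<Prod>l<m. sigma_lr (y l * z))) =
      (\<Sum>y\<in>labels m. \<Prod>l<m. (if l = j then e (y l) else 1) * (if l = k then e (y l) else 1) * sigma_lr (y l * z))"
    using pick[OF \<open>j < m\<close>, of e] pick[OF \<open>k < m\<close>, of e] by (simp only: prod.distrib)
  also have "\<dots> = (\<Prod>l<m. (if l = j then e (-1) else 1) * (if l = k then e (-1) else 1) * sigma_lr (-1 * z) +
      (if l = j then e 1 else 1) * (if l = k then e 1 else 1) * sigma_lr (1 * z))" (is "_ = ?P")
    by (rule sum_labels_prod[of "\<lambda>l v. (if l = j then e v else 1) * (if l = k then e v else 1) * sigma_lr (v * z)"])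
  also have "?P = (if j = k then dsigma z else 0)"
  proof (cases "j = k")
    case True
    then have "?P = (\<Prod>l<m. if l = j then dsigma z else 1)"
      by (intro prod.cong refl)
        (auto simp: e sigma_lr_minus dsigma_def algebra_simps power2_eq_square)
    then show ?thesis using True \<open>j < m\<close> by simp
  next
    case False
    then show ?thesis
      using \<open>j < m\<close> by (simp, intro bexI[of _ j]) (auto simp: e sigma_lr_minus algebra_simps)
  qed
  finally show "(\<Sum>y\<in>labels m. e (y j) * e (y k) * (\<Prod>l<m. sigma_lr (y l * z))) =
      (if j = k then dsigma z else 0)" .
qed

lemma centered_label_mean:
  "m \<ge> 1 \<Longrightarrow> s - label_mean m y = (\<Sum>j<m. s - (1 + y j) / 2) / real m"
  by (simp add: label_mean_def sum_subtractf diff_divide_distrib)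

text \<open>Given the features, the residual is a mean of \<open>m\<close> centered independent
  terms: only \<open>m\<close> of the \<open>m * m\<close> products survive, against the divisor
  \<open>m * m\<close>. This is the origin of the factor 1/m in the limit covariance.\<close>

lemma sum_labels_score:
  assumes "m \<ge> 1"
  shows "(\<Sum>y\<in>labels m. (sigma_lr z - label_mean m y) * (\<Prod>l<m. sigma_lr (y l * z))) = 0"
    and "(\<Sum>y\<in>labels m. (sigma_lr z - label_mean m y)\<^sup>2 * (\<Prod>l<m. sigma_lr (y l * z))) = dsigma z / real m"
proof -
  define e where "e v = sigma_lr z - (1 + v) / 2" for v
  define P where "P y = (\<Prod>l<m. sigma_lr (y l * z))" for y
  have r: "sigma_lr z - label_mean m y = (\<Sum>j<m. e (y j)) / real m" for y
    using centered_label_mean[OF assms] by (simp add: e_def)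
  have "(\<Sum>y\<in>labels m. (sigma_lr z - label_mean m y) * P y) =
      (\<Sum>y\<in>labels m. \<Sum>j<m. e (y j) * P y) / real m"
    by (simp add: r sum_distrib_right sum_divide_distrib)
  also have "\<dots> = (\<Sum>j<m. \<Sum>y\<in>labels m. e (y j) * P y) / real m"
    by (subst sum.swap) simp
  finally show "(\<Sum>y\<in>labels m. (sigma_lr z - label_mean m y) * (\<Prod>l<m. sigma_lr (y l * z))) = 0"
    using sum_labels_centered(1)[of _ m z] by (simp add: P_def e_def)
  have "(\<Sum>j<m. e (y j))\<^sup>2 * P y = (\<Sum>j<m. \<Sum>k<m. e (y j) * e (y k) * P y)" for y
    unfolding power2_eq_square sum_product unfolding sum_distrib_right ..
  then have "((\<Sum>j<m. e (y j)) / real m)\<^sup>2 * P y = (\<Sum>j<m. \<Sum>k<m. e (y j) * e (y k) * P y) / (real m)\<^sup>2" for y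
    by (simp only: power_divide times_divide_eq_left)
  then have "(\<Sum>y\<in>labels m. (sigma_lr z - label_mean m y)\<^sup>2 * P y) =
      (\<Sum>y\<in>labels m. \<Sum>j<m. \<Sum>k<m. e (y j) * e (y k) * P y) / (real m)\<^sup>2"
    by (simp only: r sum_divide_distrib)
  also have "(\<Sum>y\<in>labels m. \<Sum>j<m. \<Sum>k<m. e (y j) * e (y k) * P y) =
      (\<Sum>j<m. \<Sum>y\<in>labels m. \<Sum>k<m. e (y j) * e (y k) * P y)"
    by (rule sum.swap)
  also have "\<dots> = (\<Sum>j<m. \<Sum>k<m. \<Sum>y\<in>labels m. e (y j) * e (y k) * P y)"
    by (intro sum.cong refl sum.swap)
  also have "\<dots> = (\<Sum>j<m. \<Sum>k<m. if j = k then dsigma z else 0)"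
    using sum_labels_centered(2)[of _ m _ z] by (intro sum.cong refl) (simp add: P_def e_def)
  finally show "(\<Sum>y\<in>labels m. (sigma_lr z - label_mean m y)\<^sup>2 * (\<Prod>l<m. sigma_lr (y l * z))) = dsigma z / real m"
    using assms by (simp add: P_def power2_eq_square)
qed

lemma label_mean_bounds:
  assumes "y \<in> labels m"
  shows "0 \<le> label_mean m y" and "label_mean m y \<le> 1"
proof -
  have y: "y j = -1 \<or> y j = 1" if "j < m" for j using assms that by (auto simp: PiE_def)
  have "0 \<le> (1 + y j) / 2" "(1 + y j) / 2 \<le> 1" if "j < m" for j
    using y[OF that] by auto
  then have "0 \<le> (\<Sum>j<m. (1 + y j) / 2)" "(\<Sum>j<m. (1 + y j) / 2) \<le> real m"
    using sum_mono[of "{..<m}" "\<lambda>j. (1 + y j) / 2" "\<lambda>_. 1"] by (auto intro!: sum_nonneg)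
  then show "0 \<le> label_mean m y" and "label_mean m y \<le> 1"
    by (auto simp: label_mean_def divide_le_eq_1)
qed

lemma abs_score_le_1: "y \<in> labels m \<Longrightarrow> \<bar>sigma_lr z - label_mean m y\<bar> \<le> 1"
  using label_mean_bounds[of y m] sigma_lr_pos[of z] sigma_lr_less_1[of z] by linarith

lemma prod_sigma_lr_bounds:
  "0 \<le> (\<Prod>l\<in>A. sigma_lr (f l))" "(\<Prod>l\<in>A. sigma_lr (f l)) \<le> 1"
  by (intro prod_nonneg prod_le_1; simp add: sigma_lr_pos sigma_lr_less_1 less_imp_le)+

section \<open>Law of one example and of its score\<close>

locale logistic_sample = prob_space M for M :: "'a measure" +
  fixes X :: "nat \<Rightarrow> 'a \<Rightarrow> real ^ 'd" and Y :: "nat \<Rightarrow> nat \<Rightarrow> 'a \<Rightarrow> real"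
    and \<theta> :: "real ^ 'd" and m :: nat
  assumes model: "logistic_model M std_gaussian \<theta> m X Y"
    and m: "m \<ge> 1" and \<theta>: "\<theta> \<noteq> 0"
begin

lemma X_measurable [measurable]: "X i \<in> borel_measurable M"
  and X_distr: "distr M borel (X i) = std_gaussian"
  and Y_measurable: "j < m \<Longrightarrow> Y i j \<in> borel_measurable M"
  and Y_values: "j < m \<Longrightarrow> \<omega> \<in> space M \<Longrightarrow> Y i j \<omega> \<in> {-1, 1}"
  using model by (auto simp: logistic_model_def)

lemma indep_pairs: "indep_vars (\<lambda>_. borel \<Otimes>\<^sub>M (\<Pi>\<^sub>M j\<in>{..<m}. borel))
    (\<lambda>i \<omega>. (X i \<omega>, \<lambda>j\<in>{..<m}. Y i j \<omega>)) UNIV"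
  using model by (simp add: logistic_model_def)

lemma integral_X:
  fixes f :: "real ^ 'd \<Rightarrow> real"
  assumes [measurable]: "f \<in> borel_measurable borel"
  shows "(\<integral>\<omega>. f (X i \<omega>) \<partial>M) = (\<integral>x. f x \<partial>std_gaussian)"
    and "integrable M (\<lambda>\<omega>. f (X i \<omega>)) \<longleftrightarrow> integrable std_gaussian f"
  unfolding X_distr[of i, symmetric] by (simp_all add: integral_distr integrable_distr_eq)

definition label_event :: "nat \<Rightarrow> (nat \<Rightarrow> real) \<Rightarrow> 'a set" where
  "label_event i y = {\<omega> \<in> space M. \<forall>j<m. Y i j \<omega> = y j}"

lemma label_event_measurable [measurable]: "label_event i y \<in> events"
proof -
  have "{\<omega> \<in> space M. \<forall>j\<in>{..<m}. Y i j \<omega> = y j} \<in> events"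
    using Y_measurable by (intro sets.sets_Collect_finite_All) auto
  also have "{\<omega> \<in> space M. \<forall>j\<in>{..<m}. Y i j \<omega> = y j} = label_event i y"
    by (auto simp: label_event_def)
  finally show ?thesis .
qed

text \<open>Conditional independence factorizes the probability of a whole label vector, and the
  marginals give each factor; finitely many null sets are discarded.\<close>

lemma cond_prob_labels:
  assumes y: "y \<in> {..<m} \<rightarrow> {-1, 1}"
  shows "AE \<omega> in M. real_cond_exp M (vimage_algebra (space M) (X i) borel) (indicator (label_event i y)) \<omega> =
    (\<Prod>j<m. sigma_lr (y j * (\<theta> \<bullet> X i \<omega>)))"
proof -
  have marginal: "\<forall>i. \<forall>j<m. \<forall>v\<in>{-1, 1}. AE \<omega> in M.
      cond_prob_given M (X i) {\<omega> \<in> space M. Y i j \<omega> = v} \<omega> = sigma_lr (v * (\<theta> \<bullet> X i \<omega>))"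
    using model unfolding logistic_model_def by blast
  have "AE \<omega> in M. \<forall>j\<in>{..<m}.
      cond_prob_given M (X i) {\<omega> \<in> space M. Y i j \<omega> = y j} \<omega> = sigma_lr (y j * (\<theta> \<bullet> X i \<omega>))"
    using y by (intro AE_finite_allI marginal[rule_format]) (auto simp only: Pi_iff lessThan_iff finite_lessThan)
  moreover have "AE \<omega> in M. cond_prob_given M (X i) {\<omega> \<in> space M. \<forall>j<m. Y i j \<omega> = y j} \<omega> =
      (\<Prod>j<m. cond_prob_given M (X i) {\<omega> \<in> space M. Y i j \<omega> = y j} \<omega>)"
    using model y by (auto simp: logistic_model_def)
  ultimately show ?thesis
    by eventually_elim (simp add: cond_prob_given_def label_event_def)
qed

text \<open>As \<open>g (X i \<omega>)\<close> is measurable for the sigma-algebra of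
  \<open>X i\<close>, the indicator may be replaced by its conditional expectation. What remains is
  a function of \<open>X i\<close>, integrated against its Gaussian law.\<close>

lemma integral_label_event:
  fixes g :: "real ^ 'd \<Rightarrow> real"
  assumes y: "y \<in> {..<m} \<rightarrow> {-1, 1}" and [measurable]: "g \<in> borel_measurable borel"
    and int: "integrable std_gaussian g"
  shows "integrable M (\<lambda>\<omega>. g (X i \<omega>) * indicator (label_event i y) \<omega>)"
    and "(\<integral>\<omega>. g (X i \<omega>) * indicator (label_event i y) \<omega> \<partial>M) =
      (\<integral>x. g x * (\<Prod>j<m. sigma_lr (y j * (\<theta> \<bullet> x))) \<partial>std_gaussian)"
proof -
  let ?F = "vimage_algebra (space M) (X i) borel"
  have XF: "X i \<in> ?F \<rightarrow>\<^sub>M borel"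
    by (rule measurable_vimage_algebra1) simp
  have "subalgebra M ?F"
    unfolding subalgebra_def using measurable_sets[OF X_measurable, of _ i]
    by (auto simp: sets_vimage_algebra2)
  then interpret F: finite_measure_subalgebra M ?F by unfold_locales
  have gF: "(\<lambda>\<omega>. g (X i \<omega>)) \<in> borel_measurable ?F"
    using XF by measurable
  show int': "integrable M (\<lambda>\<omega>. g (X i \<omega>) * indicator (label_event i y) \<omega>)"
    using int by (intro integrable_real_mult_indicator) (auto simp: integral_X)
  have "(\<integral>\<omega>. g (X i \<omega>) * indicator (label_event i y) \<omega> \<partial>M) =
      (\<integral>\<omega>. g (X i \<omega>) * real_cond_exp M ?F (indicator (label_event i y)) \<omega> \<partial>M)"
    by (rule F.real_cond_exp_intg(2)[symmetric]) (use int' gF in auto)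
  also have "\<dots> = (\<integral>\<omega>. g (X i \<omega>) * (\<Prod>j<m. sigma_lr (y j * (\<theta> \<bullet> X i \<omega>))) \<partial>M)"
    using cond_prob_labels[OF y, of i] by (intro integral_cong_AE) auto
  also have "\<dots> = (\<integral>x. g x * (\<Prod>j<m. sigma_lr (y j * (\<theta> \<bullet> x))) \<partial>std_gaussian)"
    by (rule integral_X) measurable
  finally show "(\<integral>\<omega>. g (X i \<omega>) * indicator (label_event i y) \<omega> \<partial>M) =
      (\<integral>x. g x * (\<Prod>j<m. sigma_lr (y j * (\<theta> \<bullet> x))) \<partial>std_gaussian)" .
qed

text \<open>Stands in for the joint law of features and labels: every expectation over one example
  becomes a Gaussian integral of a finite sum.\<close>

lemma integral_example:
  fixes G :: "real ^ 'd \<Rightarrow> (nat \<Rightarrow> real) \<Rightarrow> real"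
  assumes G: "\<And>y. y \<in> labels m \<Longrightarrow> (\<lambda>x. G x y) \<in> borel_measurable borel"
    and int: "\<And>y. y \<in> labels m \<Longrightarrow> integrable std_gaussian (\<lambda>x. G x y)"
  shows "integrable M (\<lambda>\<omega>. G (X i \<omega>) (\<lambda>j\<in>{..<m}. Y i j \<omega>))"
    and "(\<integral>\<omega>. G (X i \<omega>) (\<lambda>j\<in>{..<m}. Y i j \<omega>) \<partial>M) =
      (\<integral>x. (\<Sum>y\<in>labels m. G x y * (\<Prod>j<m. sigma_lr (y j * (\<theta> \<bullet> x)))) \<partial>std_gaussian)"
proof -
  let ?Y = "\<lambda>\<omega>. \<lambda>j\<in>{..<m}. Y i j \<omega>"
  \<comment> \<open>Exactly one label vector occurs at each point; the indicators of the label
    events select its term.\<close>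
  have eq: "G (X i \<omega>) (?Y \<omega>) = (\<Sum>y\<in>labels m. G (X i \<omega>) y * indicator (label_event i y) \<omega>)"
    if "\<omega> \<in> space M" for \<omega>
  proof -
    have "?Y \<omega> \<in> labels m" using Y_values[OF _ that] by auto
    have "indicator (label_event i y) \<omega> = (if ?Y \<omega> = y then 1 else 0 :: real)" if "y \<in> labels m" for y
    proof -
      have "(\<forall>j<m. Y i j \<omega> = y j) \<longleftrightarrow> ?Y \<omega> = y"
        using \<open>y \<in> labels m\<close> by (auto simp: fun_eq_iff restrict_def PiE_def extensional_def)
      then show ?thesis using \<open>\<omega> \<in> space M\<close> by (auto simp: label_event_def)
    qed
    then have "(\<Sum>y\<in>labels m. G (X i \<omega>) y * indicator (label_event i y) \<omega>) =
        (\<Sum>y\<in>labels m. if ?Y \<omega> = y then G (X i \<omega>) y else 0)"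
      by (intro sum.cong) auto
    also have "\<dots> = G (X i \<omega>) (?Y \<omega>)"
      using \<open>?Y \<omega> \<in> labels m\<close> finite_labels[of m] by (simp add: sum.delta')
    finally show ?thesis ..
  qed
  have PiE: "y \<in> {..<m} \<rightarrow> {-1, 1}" if "y \<in> labels m" for y :: "nat \<Rightarrow> real"
    using that by (auto simp: PiE_def)
  note I = integral_label_event[OF PiE G int]
  show "integrable M (\<lambda>\<omega>. G (X i \<omega>) (?Y \<omega>))"
    by (subst Bochner_Integration.integrable_cong[OF refl eq]) (auto intro!: Bochner_Integration.integrable_sum I)
  have "(\<integral>\<omega>. G (X i \<omega>) (?Y \<omega>) \<partial>M) = (\<Sum>y\<in>labels m. \<integral>\<omega>. G (X i \<omega>) y * indicator (label_event i y) \<omega> \<partial>M)"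
    by (subst Bochner_Integration.integral_cong[OF refl eq]) (auto intro!: Bochner_Integration.integral_sum I)
  also have "\<dots> = (\<Sum>y\<in>labels m. \<integral>x. G x y * (\<Prod>j<m. sigma_lr (y j * (\<theta> \<bullet> x))) \<partial>std_gaussian)"
    by (intro sum.cong refl I)
  also have "\<dots> = (\<integral>x. (\<Sum>y\<in>labels m. G x y * (\<Prod>j<m. sigma_lr (y j * (\<theta> \<bullet> x)))) \<partial>std_gaussian)"
  proof (rule Bochner_Integration.integral_sum[symmetric])
    fix y assume y: "y \<in> labels m"
    note [measurable] = G[OF y]
    show "integrable std_gaussian (\<lambda>x. G x y * (\<Prod>j<m. sigma_lr (y j * (\<theta> \<bullet> x))))"
    proof (rule Bochner_Integration.integrable_bound[OF int[OF y]])
      show "AE x in std_gaussian. norm (G x y * (\<Prod>j<m. sigma_lr (y j * (\<theta> \<bullet> x)))) \<le> norm (G x y)"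
        by (intro AE_I2) (simp add: abs_mult mult_left_le prod_sigma_lr_bounds abs_of_nonneg)
    qed measurable
  qed
  finally show "(\<integral>\<omega>. G (X i \<omega>) (?Y \<omega>) \<partial>M) =
      (\<integral>x. (\<Sum>y\<in>labels m. G x y * (\<Prod>j<m. sigma_lr (y j * (\<theta> \<bullet> x)))) \<partial>std_gaussian)" .
qed

text \<open>The gradient at \<open>\<theta>\<close> of the contribution of example \<open>i\<close>
  to the loss, averaged over its labels.\<close>

definition score :: "nat \<Rightarrow> 'a \<Rightarrow> real ^ 'd" where
  "score i \<omega> = (sigma_lr (X i \<omega> \<bullet> \<theta>) - label_mean m (\<lambda>j. Y i j \<omega>)) *\<^sub>R X i \<omega>"

text \<open>The score as a function of features and labels, needed because the model states
  independence for the pairs of features and restricted label vectors.\<close>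

definition score_fun :: "real ^ 'd \<Rightarrow> (nat \<Rightarrow> real) \<Rightarrow> real ^ 'd" where
  "score_fun x y = (sigma_lr (x \<bullet> \<theta>) - label_mean m y) *\<^sub>R x"

lemma score_eq: "score i \<omega> = score_fun (X i \<omega>) (\<lambda>j\<in>{..<m}. Y i j \<omega>)"
  by (simp add: score_def score_fun_def label_mean_def)

lemma score_fun_measurable [measurable]:
  "(\<lambda>(x, y). score_fun x y) \<in> borel_measurable (borel \<Otimes>\<^sub>M (\<Pi>\<^sub>M j\<in>{..<m}. borel))"
  unfolding score_fun_def label_mean_def by measurable

lemma score_measurable [measurable]: "score i \<in> borel_measurable M"
proof -
  have "random_variable (borel \<Otimes>\<^sub>M (\<Pi>\<^sub>M j\<in>{..<m}. borel)) (\<lambda>\<omega>. (X i \<omega>, \<lambda>j\<in>{..<m}. Y i j \<omega>))"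
    using indep_pairs by (simp add: indep_vars_def2)
  from measurable_compose[OF this score_fun_measurable] show ?thesis
    by (simp add: score_eq[abs_def])
qed

lemma indep_score: "indep_vars (\<lambda>_. borel) (\<lambda>i \<omega>. t \<bullet> score i \<omega>) UNIV"
  unfolding score_eq
  using indep_vars_compose2[OF indep_pairs, of "\<lambda>_ (x, y). t \<bullet> score_fun x y" "\<lambda>_. borel"]
    measurable_compose[OF score_fun_measurable, of "\<lambda>v. t \<bullet> v" borel]
  by (simp add: case_prod_beta')

lemma score_fun_bound:
  assumes "y \<in> labels m"
  shows "\<bar>t \<bullet> score_fun x y\<bar> \<le> norm t * norm x"
proof -
  have "\<bar>sigma_lr (x \<bullet> \<theta>) - label_mean m y\<bar> * \<bar>t \<bullet> x\<bar> \<le> 1 * (norm t * norm x)"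
    using abs_score_le_1[OF assms] Cauchy_Schwarz_ineq2 by (intro mult_mono) auto
  then show ?thesis by (simp add: score_fun_def abs_mult)
qed

lemma score_fun_measurable1 [measurable]: "(\<lambda>x. score_fun x y) \<in> borel_measurable borel"
  unfolding score_fun_def by measurable

text \<open>Sums over labels inside the Gaussian integral give conditional mean 0 and conditional
  variance \<open>dsigma / m\<close>. The covariance of the score is thus the Fisher information
  divided by \<open>m\<close>.\<close>

lemma score_mean: "expectation (\<lambda>\<omega>. t \<bullet> score i \<omega>) = 0"
  and score_variance: "integrable M (\<lambda>\<omega>. (t \<bullet> score i \<omega>)\<^sup>2)"
    "expectation (\<lambda>\<omega>. (t \<bullet> score i \<omega>)\<^sup>2) =
      (\<integral>x. dsigma (\<theta> \<bullet> x) * ((t \<bullet> x) * (t \<bullet> x)) \<partial>std_gaussian) / real m"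
proof -
  have int1: "integrable std_gaussian (\<lambda>x. t \<bullet> score_fun x y)" if "y \<in> labels m" for y
    using score_fun_bound[OF that]
    by (intro integrable_std_gaussian_dominated[where k = 1 and K = "norm t"]) auto
  have int2: "integrable std_gaussian (\<lambda>x. (t \<bullet> score_fun x y)\<^sup>2)" if "y \<in> labels m" for y
  proof (rule integrable_std_gaussian_dominated[where k = 2 and K = "(norm t)\<^sup>2"])
    show "\<bar>(t \<bullet> score_fun x y)\<^sup>2\<bar> \<le> (norm t)\<^sup>2 * norm x ^ 2" for x
      using power_mono[OF score_fun_bound[OF that, of t x] abs_ge_zero, of 2]
      by (simp add: power_mult_distrib)
  qed auto
  have "expectation (\<lambda>\<omega>. t \<bullet> score i \<omega>) =
      (\<integral>x. (\<Sum>y\<in>labels m. (t \<bullet> score_fun x y) * (\<Prod>j<m. sigma_lr (y j * (\<theta> \<bullet> x)))) \<partial>std_gaussian)"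
    unfolding score_eq by (rule integral_example(2)) (use int1 in auto)
  also have "(\<lambda>x. \<Sum>y\<in>labels m. (t \<bullet> score_fun x y) * (\<Prod>j<m. sigma_lr (y j * (\<theta> \<bullet> x)))) =
      (\<lambda>x. (t \<bullet> x) * (\<Sum>y\<in>labels m. (sigma_lr (\<theta> \<bullet> x) - label_mean m y) * (\<Prod>j<m. sigma_lr (y j * (\<theta> \<bullet> x)))))"
    by (simp add: score_fun_def sum_distrib_left inner_commute[of _ \<theta>] mult_ac)
  finally show "expectation (\<lambda>\<omega>. t \<bullet> score i \<omega>) = 0"
    by (simp add: sum_labels_score[OF m])
  show "integrable M (\<lambda>\<omega>. (t \<bullet> score i \<omega>)\<^sup>2)"
    unfolding score_eq by (rule integral_example(1)) (use int2 in auto)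
  have "expectation (\<lambda>\<omega>. (t \<bullet> score i \<omega>)\<^sup>2) =
      (\<integral>x. (\<Sum>y\<in>labels m. (t \<bullet> score_fun x y)\<^sup>2 * (\<Prod>j<m. sigma_lr (y j * (\<theta> \<bullet> x)))) \<partial>std_gaussian)"
    unfolding score_eq by (rule integral_example(2)) (use int2 in auto)
  also have "(\<lambda>x. \<Sum>y\<in>labels m. (t \<bullet> score_fun x y)\<^sup>2 * (\<Prod>j<m. sigma_lr (y j * (\<theta> \<bullet> x)))) =
      (\<lambda>x. (t \<bullet> x)\<^sup>2 * (\<Sum>y\<in>labels m. (sigma_lr (\<theta> \<bullet> x) - label_mean m y)\<^sup>2 * (\<Prod>j<m. sigma_lr (y j * (\<theta> \<bullet> x)))))"
    by (simp add: score_fun_def sum_distrib_left inner_commute[of _ \<theta>] power_mult_distrib mult_ac)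
  finally show "expectation (\<lambda>\<omega>. (t \<bullet> score i \<omega>)\<^sup>2) =
      (\<integral>x. dsigma (\<theta> \<bullet> x) * ((t \<bullet> x) * (t \<bullet> x)) \<partial>std_gaussian) / real m"
    by (simp only: sum_labels_score[OF m]) (simp add: power2_eq_square mult_ac)
qed

text \<open>The central limit theorem asks for identical laws, which the model provides only
  indirectly: the formula for the probability of \<open>B\<close> does not contain
  \<open>i\<close>.\<close>

lemma score_distr: "distr M borel (\<lambda>\<omega>. t \<bullet> score i \<omega>) = distr M borel (\<lambda>\<omega>. t \<bullet> score 0 \<omega>)"
proof (rule measure_eqI)
  fix B assume "B \<in> sets (distr M borel (\<lambda>\<omega>. t \<bullet> score i \<omega>))"
  then have [measurable]: "B \<in> sets borel" by simp
  have "prob ((\<lambda>\<omega>. t \<bullet> score i \<omega>) -` B \<inter> space M) =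
      (\<integral>x. (\<Sum>y\<in>labels m. indicator B (t \<bullet> score_fun x y) * (\<Prod>j<m. sigma_lr (y j * (\<theta> \<bullet> x)))) \<partial>std_gaussian)"
    for i
  proof -
    have "prob ((\<lambda>\<omega>. t \<bullet> score i \<omega>) -` B \<inter> space M) = expectation (indicator ((\<lambda>\<omega>. t \<bullet> score i \<omega>) -` B \<inter> space M))"
      by simp
    also have "\<dots> = (\<integral>\<omega>. indicator B (t \<bullet> score i \<omega>) \<partial>M)"
      by (intro Bochner_Integration.integral_cong) (auto split: split_indicator)
    also have "\<dots> = (\<integral>x. (\<Sum>y\<in>labels m. indicator B (t \<bullet> score_fun x y) * (\<Prod>j<m. sigma_lr (y j * (\<theta> \<bullet> x)))) \<partial>std_gaussian)"
      unfolding score_eq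
    proof (rule integral_example(2)[of "\<lambda>x y. indicator B (t \<bullet> score_fun x y)"])
      show "integrable std_gaussian (\<lambda>x. indicat_real B (t \<bullet> score_fun x y))" for y
        by (rule std_gaussian.integrable_const_bound[of _ 1]) auto
    qed measurable
    finally show ?thesis .
  qed
  then show "emeasure (distr M borel (\<lambda>\<omega>. t \<bullet> score i \<omega>)) B = emeasure (distr M borel (\<lambda>\<omega>. t \<bullet> score 0 \<omega>)) B"
    by (simp add: emeasure_distr emeasure_eq_measure)
qed simp

end

section \<open>Asymptotics of the maximum likelihood estimator\<close>

lemma (in prob_space) Markov_gt:
  assumes "integrable M f" and "\<And>\<omega>. \<omega> \<in> space M \<Longrightarrow> 0 \<le> f \<omega>" and "(c::real) > 0"
  shows "prob {\<omega> \<in> space M. f \<omega> > c} \<le> expectation f / c"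
proof -
  have [measurable]: "f \<in> borel_measurable M" using assms(1) by simp
  have "prob {\<omega> \<in> space M. f \<omega> > c} \<le> prob {\<omega> \<in> space M. f \<omega> \<ge> c}"
    by (intro finite_measure_mono) auto
  also have "\<dots> \<le> expectation f / c"
    using assms by (intro integral_Markov_inequality_measure[where A = "{}"]) auto
  finally show ?thesis .
qed

context logistic_sample
begin

definition u where "u = \<theta> /\<^sub>R norm \<theta>"
text \<open>\<open>a\<close> and \<open>b\<close> are the eigenvalues of the Fisher information
  along \<open>u\<close> and on its orthogonal complement.\<close>

definition a where "a = (\<integral>x. dsigma (\<theta> \<bullet> x) * (u \<bullet> x)\<^sup>2 \<partial>std_gaussian)"
definition b where "b = (\<integral>x. dsigma (\<theta> \<bullet> x) \<partial>std_gaussian)"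
definition H where "H k l = (\<integral>x. dsigma (\<theta> \<bullet> x) * (x $ k * x $ l) \<partial>std_gaussian)"

lemma norm_u: "norm u = 1"
  using \<theta> by (simp add: u_def)

text \<open>The inner product with \<open>\<theta>\<close> is \<open>norm \<theta>\<close> times
  that with \<open>u\<close>, so the weight is a bounded function of the component along
  \<open>u\<close>.\<close>

lemma fisher_information:
  "(\<integral>x. dsigma (\<theta> \<bullet> x) * ((v \<bullet> x) * (w \<bullet> x)) \<partial>std_gaussian) =
    a * ((u \<bullet> v) * (u \<bullet> w)) + b * (v \<bullet> w - (u \<bullet> v) * (u \<bullet> w))"
proof -
  have "\<theta> \<bullet> x = norm \<theta> * (u \<bullet> x)" for x using \<theta> by (simp add: u_def)
  moreover have "\<bar>dsigma z\<bar> \<le> 1" for z using dsigma_pos[of z] dsigma_le_1[of z] by simp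
  ultimately show ?thesis
    unfolding a_def b_def
    using std_gaussian_weighted_second_moment[OF norm_u, of "\<lambda>z. dsigma (norm \<theta> * z)" 1 v w] by simp
qed

lemma fisher_information_form:
  "(\<integral>x. dsigma (\<theta> \<bullet> x) * ((t \<bullet> x) * (t \<bullet> x)) \<partial>std_gaussian) = spiked_form a b u t"
  unfolding fisher_information spiked_form_def power2_norm_eq_inner unfolding power2_eq_square ..

lemma H_form: "(\<Sum>k\<in>UNIV. \<Sum>l\<in>UNIV. s $ k * s $ l * H k l) = spiked_form a b u s"
proof -
  have H: "H k l = (a - b) * (u $ k * u $ l) + (if k = l then b else 0)" for k l
  proof -
    have "axis k 1 \<bullet> (axis l 1 :: real ^ 'd) = (if k = l then 1 else 0)"
      by (simp add: inner_axis_axis)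
    then show ?thesis
      using fisher_information[of "axis k 1" "axis l 1"]
      by (simp add: H_def inner_axis' inner_axis[of u] algebra_simps)
  qed
  have "(\<Sum>k\<in>UNIV. \<Sum>l\<in>UNIV. s $ k * s $ l * H k l) =
      (\<Sum>k\<in>UNIV. \<Sum>l\<in>UNIV. (a - b) * ((u $ k * s $ k) * (u $ l * s $ l)) + (if k = l then b * (s $ k * s $ l) else 0))"
    unfolding H by (intro sum.cong refl) (auto simp: algebra_simps)
  also have "\<dots> = (a - b) * (u \<bullet> s)\<^sup>2 + b * (norm s)\<^sup>2"
    unfolding power2_norm_eq_inner unfolding power2_eq_square inner_vec_def sum_product
    by (simp add: sum.distrib sum_distrib_left)
  finally show ?thesis by (simp add: spiked_form_def algebra_simps)
qed

lemma b_pos: "b > 0"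
proof -
  have "(\<integral>x. 0 \<partial>(std_gaussian :: (real ^ 'd) measure)) < b"
    unfolding b_def
  proof (rule std_gaussian.integral_less_AE_space)
    show "integrable std_gaussian (\<lambda>x. dsigma (\<theta> \<bullet> x))"
      using dsigma_pos dsigma_le_1
      by (intro std_gaussian.integrable_const_bound[of _ 1]) (auto simp: abs_of_pos)
  qed (auto simp: dsigma_pos std_gaussian.emeasure_space_1[simplified])
  then show ?thesis by simp
qed

lemma integrable_dsigma_form: "integrable std_gaussian (\<lambda>x. dsigma (\<theta> \<bullet> x) * ((v \<bullet> x) * (w \<bullet> x)))"
proof (rule integrable_std_gaussian_dominated[where k = 2 and K = "norm v * norm w"])
  fix x
  have "\<bar>dsigma (\<theta> \<bullet> x)\<bar> * (\<bar>v \<bullet> x\<bar> * \<bar>w \<bullet> x\<bar>) \<le> 1 * ((norm v * norm x) * (norm w * norm x))"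
    using dsigma_pos[of "\<theta> \<bullet> x"] dsigma_le_1[of "\<theta> \<bullet> x"]
    by (intro mult_mono Cauchy_Schwarz_ineq2) auto
  then show "\<bar>dsigma (\<theta> \<bullet> x) * ((v \<bullet> x) * (w \<bullet> x))\<bar> \<le> norm v * norm w * norm x ^ 2"
    by (simp add: abs_mult power2_eq_square mult_ac)
qed auto

text \<open>If \<open>a\<close> were 0, the strictly positive weight would force the component along
  \<open>u\<close> to vanish almost everywhere, against its variance 1.\<close>

lemma a_pos: "a > 0"
proof -
  have int: "integrable std_gaussian (\<lambda>x. dsigma (\<theta> \<bullet> x) * (u \<bullet> x)\<^sup>2)"
    using integrable_dsigma_form[of u u] by (simp add: power2_eq_square)
  have "a \<ge> 0"
    unfolding a_def using dsigma_pos by (intro integral_nonneg_AE AE_I2) (simp add: less_imp_le)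
  moreover have "a \<noteq> 0"
  proof
    assume "a = 0"
    then have "AE x in std_gaussian. dsigma (\<theta> \<bullet> x) * (u \<bullet> x)\<^sup>2 = 0"
      using integral_nonneg_eq_0_iff_AE[OF int] dsigma_pos by (simp add: a_def less_imp_le)
    then have "AE x in std_gaussian. (u \<bullet> x)\<^sup>2 = 0"
      by eventually_elim (metis dsigma_pos less_irrefl mult_eq_0_iff)
    then have "(\<integral>x. (u \<bullet> x)\<^sup>2 \<partial>std_gaussian) = 0"
      by (intro integral_eq_zero_AE)
    moreover have "(\<integral>x. (u \<bullet> x)\<^sup>2 \<partial>std_gaussian) = 1"
    proof -
      fix k :: 'd
      have "(\<integral>x. (u \<bullet> x) * (u \<bullet> x) \<partial>std_gaussian) = u \<bullet> u"
        \<comment> \<open>With constant weight 1 both eigenvalues are 1, whatever axis is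
          used.\<close>
        using std_gaussian_weighted_second_moment[of "axis k 1 :: real ^ 'd" "\<lambda>_. 1" 1 u u]
          integral_std_gaussian_component_square[of k]
        by (simp add: inner_axis' std_gaussian.prob_space[simplified])
      then show ?thesis using norm_u by (simp add: power2_eq_square norm_eq_1)
    qed
    ultimately show False by simp
  qed
  ultimately show ?thesis by simp
qed

section \<open>Stochastic bounds for the normalized score and the expansion errors\<close>

definition U :: "nat \<Rightarrow> 'a \<Rightarrow> real ^ 'd" where
  "U n \<omega> = (1 / sqrt (real n)) *\<^sub>R (\<Sum>i<n. score i \<omega>)"

lemma U_measurable [measurable]: "U n \<in> borel_measurable M"
  unfolding U_def by measurable

lemma U_inner: "t \<bullet> U n \<omega> = (\<Sum>i<n. t \<bullet> score i \<omega>) / sqrt (real n)"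
  by (simp add: U_def inner_sum_right)

text \<open>An inequality because of \<open>n = 0\<close>, where \<open>U\<close> vanishes; for
  positive \<open>n\<close> the second moment equals the bound.\<close>

lemma U_second_moment:
  "integrable M (\<lambda>\<omega>. (t \<bullet> U n \<omega>)\<^sup>2)" "expectation (\<lambda>\<omega>. (t \<bullet> U n \<omega>)\<^sup>2) \<le> spiked_form a b u t / real m"
proof -
  have v: "expectation (\<lambda>\<omega>. (t \<bullet> score i \<omega>)\<^sup>2) = spiked_form a b u t / real m" for i
    by (simp add: score_variance fisher_information_form)
  note S = indep_sum_second_moment[OF indep_score[of t] score_variance(1) score_mean v]
  show "integrable M (\<lambda>\<omega>. (t \<bullet> U n \<omega>)\<^sup>2)"
    using S(1)[of n] by (simp add: U_inner power_divide)
  have "0 \<le> expectation (\<lambda>\<omega>. (t \<bullet> score 0 \<omega>)\<^sup>2)" by simp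
  then have "0 \<le> spiked_form a b u t / real m" by (simp only: v)
  then show "expectation (\<lambda>\<omega>. (t \<bullet> U n \<omega>)\<^sup>2) \<le> spiked_form a b u t / real m"
    using S(2)[of n] by (cases "n = 0") (simp_all add: U_inner power_divide)
qed

lemma tight_U: "tight_family M U"
  unfolding tight_family_def
proof (intro allI impI)
  fix e :: real assume "e > 0"
  define C where "C = (\<Sum>k\<in>UNIV. spiked_form a b u (axis k 1) / real m)"
  have sq: "(norm (U n \<omega>))\<^sup>2 = (\<Sum>k\<in>UNIV. (axis k 1 \<bullet> U n \<omega>)\<^sup>2)" for n \<omega>
    by (simp add: power2_norm_vec inner_axis')
  have int: "integrable M (\<lambda>\<omega>. (norm (U n \<omega>))\<^sup>2)" for n
    unfolding sq by (intro Bochner_Integration.integrable_sum U_second_moment)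
  have C: "expectation (\<lambda>\<omega>. (norm (U n \<omega>))\<^sup>2) \<le> C" for n
    unfolding sq C_def using U_second_moment
    by (subst Bochner_Integration.integral_sum) (auto intro!: sum_mono)
  have "0 \<le> expectation (\<lambda>\<omega>. (norm (U 0 \<omega>))\<^sup>2)" by simp
  then have "C \<ge> 0" using C[of 0] by linarith
  \<comment> \<open>The summand 1 gives \<open>R \<ge> 1\<close>, hence
    \<open>C < e * R \<le> e * R\<^sup>2\<close>, as Markov's inequality for the squared norm
    requires.\<close>
  define R where "R = C / e + 1"
  have "R \<ge> 1" using \<open>C \<ge> 0\<close> \<open>e > 0\<close> by (simp add: R_def)
  have "C < e * R" using \<open>e > 0\<close> by (simp add: R_def distrib_left)
  also have "e * R \<le> e * R\<^sup>2"
    using \<open>R \<ge> 1\<close> \<open>e > 0\<close> by (intro mult_left_mono self_le_power) auto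
  finally have CR: "C / R\<^sup>2 < e" using \<open>R \<ge> 1\<close> by (simp add: field_simps)
  have "prob {\<omega> \<in> space M. norm (U n \<omega>) > R} < e" for n
  proof -
    have "{\<omega> \<in> space M. norm (U n \<omega>) > R} = {\<omega> \<in> space M. (norm (U n \<omega>))\<^sup>2 > R\<^sup>2}"
      using \<open>R \<ge> 1\<close> by (auto simp: power2_less_imp_less intro: power_strict_mono)
    also have "prob \<dots> \<le> expectation (\<lambda>\<omega>. (norm (U n \<omega>))\<^sup>2) / R\<^sup>2"
      using \<open>R \<ge> 1\<close> by (intro Markov_gt int) auto
    also have "\<dots> \<le> C / R\<^sup>2" by (intro divide_right_mono C) simp
    finally show ?thesis using CR by simp
  qed
  then show "\<exists>R. \<forall>n. prob {\<omega> \<in> space M. norm (U n \<omega>) > R} < e" by blast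
qed

text \<open>The squared Frobenius distance rather than an operator norm: its expectation is a finite
  sum of variances of averages.\<close>

definition hessian_error :: "nat \<Rightarrow> 'a \<Rightarrow> real" where
  "hessian_error n \<omega> = (\<Sum>k\<in>UNIV. \<Sum>l\<in>UNIV.
    ((\<Sum>i<n. dsigma (X i \<omega> \<bullet> \<theta>) * (X i \<omega> $ k * X i \<omega> $ l)) / real n - H k l)\<^sup>2)"

definition cubic_term :: "nat \<Rightarrow> 'a \<Rightarrow> real" where
  "cubic_term n \<omega> = (\<Sum>i<n. norm (X i \<omega>) ^ 3) / (real n * sqrt (real n))"

lemma indep_X: "indep_vars (\<lambda>_. borel) X UNIV"
  using indep_vars_compose2[OF indep_pairs, of "\<lambda>_. fst" "\<lambda>_. borel"] by simp

text \<open>Each entry is an average of independent centered variables, whose variances are finite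
  by the fourth moment of the features.\<close>

lemma hessian_error_expectation:
  obtains C where "\<And>n. integrable M (hessian_error n)"
    and "\<And>n. n \<ge> 1 \<Longrightarrow> expectation (hessian_error n) = C / real n"
proof -
  define g where "g k l x = dsigma (\<theta> \<bullet> x) * (x $ k * x $ l) - H k l" for k l and x :: "real ^ 'd"
  define v where "v k l = (\<integral>x. (g k l x)\<^sup>2 \<partial>std_gaussian)" for k l
  have [measurable]: "g k l \<in> borel_measurable borel" for k l
    unfolding g_def by measurable
  have int1: "integrable std_gaussian (\<lambda>x. dsigma (\<theta> \<bullet> x) * (x $ k * x $ l))" for k l
    using integrable_dsigma_form[of "axis k 1" "axis l 1"] by (simp add: inner_axis')
  have int2: "integrable std_gaussian (\<lambda>x. (dsigma (\<theta> \<bullet> x) * (x $ k * x $ l))\<^sup>2)" for k l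
  proof (rule integrable_std_gaussian_dominated[where k = 4 and K = 1])
    fix x :: "real ^ 'd"
    have "\<bar>dsigma (\<theta> \<bullet> x)\<bar> * (\<bar>x $ k\<bar> * \<bar>x $ l\<bar>) \<le> 1 * (norm x * norm x)"
      using dsigma_pos[of "\<theta> \<bullet> x"] dsigma_le_1[of "\<theta> \<bullet> x"]
      by (intro mult_mono component_le_norm_cart) auto
    then have "\<bar>dsigma (\<theta> \<bullet> x) * (x $ k * x $ l)\<bar>\<^sup>2 \<le> (norm x * norm x)\<^sup>2"
      by (intro power_mono) (auto simp: abs_mult)
    also have "(norm x * norm x)\<^sup>2 = norm x ^ 4" by (simp add: power_mult_distrib flip: power_add)
    finally show "\<bar>(dsigma (\<theta> \<bullet> x) * (x $ k * x $ l))\<^sup>2\<bar> \<le> 1 * norm x ^ 4" by simp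
  qed auto
  have int_g: "integrable std_gaussian (\<lambda>x. (g k l x)\<^sup>2)" for k l
    unfolding g_def power2_diff using int1 int2
    by (intro Bochner_Integration.integrable_add Bochner_Integration.integrable_diff integrable_mult_left integrable_mult_right) auto
  have mean_g: "(\<integral>x. g k l x \<partial>std_gaussian) = 0" for k l
    unfolding g_def using int1 by (simp add: H_def std_gaussian.prob_space[simplified])
  have indep: "indep_vars (\<lambda>_. borel) (\<lambda>i \<omega>. g k l (X i \<omega>)) UNIV" for k l
    by (rule indep_vars_compose2[OF indep_X]) measurable
  have int_gX: "integrable M (\<lambda>\<omega>. (g k l (X i \<omega>))\<^sup>2)" for i k l
    using integral_X(2)[of "\<lambda>x. (g k l x)\<^sup>2" i] int_g by simp
  have mean_gX: "expectation (\<lambda>\<omega>. g k l (X i \<omega>)) = 0" for i k l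
    using integral_X(1)[of "g k l" i] mean_g by simp
  have var_gX: "expectation (\<lambda>\<omega>. (g k l (X i \<omega>))\<^sup>2) = v k l" for i k l
    using integral_X(1)[of "\<lambda>x. (g k l x)\<^sup>2" i] by (simp add: v_def)
  note S = indep_sum_second_moment[OF indep int_gX mean_gX var_gX]
  have eq: "hessian_error n \<omega> = (\<Sum>k\<in>UNIV. \<Sum>l\<in>UNIV. (\<Sum>i<n. g k l (X i \<omega>))\<^sup>2 / (real n)\<^sup>2)"
    if "n \<ge> 1" for n \<omega>
  proof -
    have "(\<Sum>i<n. dsigma (X i \<omega> \<bullet> \<theta>) * (X i \<omega> $ k * X i \<omega> $ l)) / real n - H k l =
        (\<Sum>i<n. g k l (X i \<omega>)) / real n" for k l
      using that by (simp add: g_def sum_subtractf diff_divide_distrib inner_commute)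
    then show ?thesis by (simp add: hessian_error_def power_divide)
  qed
  show thesis
  proof
    show "integrable M (hessian_error n)" for n
    proof (cases "n \<ge> 1")
      case True
      then show ?thesis
        unfolding eq[OF True, abs_def] by (intro Bochner_Integration.integrable_sum integrable_divide S)
    next
      case False
      \<comment> \<open>Division by 0 gives 0, so the error is then a constant and still
        integrable.\<close>
      then have "n = 0" by simp
      then have "hessian_error n = (\<lambda>_. \<Sum>k\<in>UNIV. \<Sum>l\<in>UNIV. (H k l)\<^sup>2)"
        by (simp add: hessian_error_def[abs_def])
      then show ?thesis by simp
    qed
    fix n :: nat assume n: "n \<ge> 1"
    have "expectation (hessian_error n) = (\<Sum>k\<in>UNIV. \<Sum>l\<in>UNIV. real n * v k l / (real n)\<^sup>2)"
      unfolding eq[OF n, abs_def]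
      by (simp add: Bochner_Integration.integral_sum Bochner_Integration.integrable_sum S)
    also have "\<dots> = (\<Sum>k\<in>UNIV. \<Sum>l\<in>UNIV. v k l) / real n"
      using n by (simp add: power2_eq_square sum_divide_distrib)
    finally show "expectation (hessian_error n) = (\<Sum>k\<in>UNIV. \<Sum>l\<in>UNIV. v k l) / real n" .
  qed
qed

lemma cubic_term_expectation:
  obtains C where "\<And>n. integrable M (cubic_term n)"
    and "\<And>n. n \<ge> 1 \<Longrightarrow> expectation (cubic_term n) = C / sqrt (real n)"
proof
  have "integrable std_gaussian (\<lambda>x :: real ^ 'd. norm x ^ 3)"
    by (rule integrable_std_gaussian_dominated[where k = 3 and K = 1]) auto
  then have int: "integrable M (\<lambda>\<omega>. norm (X i \<omega>) ^ 3)" for i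
    using integral_X(2)[of "\<lambda>x. norm x ^ 3" i] by simp
  show "integrable M (cubic_term n)" for n
    unfolding cubic_term_def by (intro integrable_divide Bochner_Integration.integrable_sum int)
  show "expectation (cubic_term n) = (\<integral>x. norm (x :: real ^ 'd) ^ 3 \<partial>std_gaussian) / sqrt (real n)" if "n \<ge> 1" for n
    unfolding cubic_term_def
    using that int integral_X(1)[of "\<lambda>x. norm x ^ 3"] by (simp add: Bochner_Integration.integral_sum)
qed

text \<open>Markov's inequality and tightness make the three hypotheses of the localization hold
  outside one event \<open>A\<close>, each failing with probability below a third of
  \<open>\<epsilon>\<close>. The order of choice is \<open>R\<close> from tightness, then
  \<open>\<rho>\<close>, then \<open>\<eta>\<close>, then \<open>n\<close>.\<close>

lemma mle_linearization:
  assumes mle: "logistic_mle M m X Y \<theta>hat" and "\<delta> > 0" and "\<epsilon> > 0"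
  obtains \<rho> where "\<rho> > 0"
    and "\<forall>\<^sub>F n in sequentially. \<exists>A\<in>events. prob A < \<epsilon> \<and> (\<forall>\<omega>\<in>space M - A.
      norm (sqrt (real n) *\<^sub>R (\<theta>hat n \<omega> - \<theta>) + spiked_inverse a b u (U n \<omega>)) < \<delta> \<and>
      norm (sqrt (real n) *\<^sub>R (\<theta>hat n \<omega> - \<theta>)) \<le> \<rho>)"
proof -
  have "\<epsilon> / 3 > 0" using \<open>\<epsilon> > 0\<close> by simp
  then obtain R0 where R0: "\<And>n. prob {\<omega> \<in> space M. norm (U n \<omega>) > R0} < \<epsilon> / 3"
    using tight_U unfolding tight_family_def by blast
  define R where "R = max R0 0"
  have "prob {\<omega> \<in> space M. norm (U n \<omega>) > R} \<le> prob {\<omega> \<in> space M. norm (U n \<omega>) > R0}" for n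
    by (intro finite_measure_mono) (auto simp: R_def)
  then have R: "prob {\<omega> \<in> space M. norm (U n \<omega>) > R} < \<epsilon> / 3" for n
    using R0[of n] by (rule order_le_less_trans)
  define \<kappa> where "\<kappa> = \<bar>1 / b\<bar> + \<bar>1 / a - 1 / b\<bar>"
  define \<rho> where "\<rho> = \<kappa> * R + \<delta>"
  have "\<rho> > 0"
    unfolding \<rho>_def using \<open>\<delta> > 0\<close> by (intro add_nonneg_pos mult_nonneg_nonneg) (auto simp: \<kappa>_def R_def)
  define K where "K = \<rho>\<^sup>2 + 2 * \<rho> ^ 3"
  \<comment> \<open>Makes \<open>\<eta> * K\<close> half of the admissible bound
    \<open>min a b * \<delta>\<^sup>2 / 2\<close>, so that the inequality is strict.\<close>
  define \<eta> where "\<eta> = min a b * \<delta>\<^sup>2 / 4 / K"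
  have pos: "K > 0" "min a b * \<delta>\<^sup>2 > 0"
    using \<open>\<rho> > 0\<close> \<open>\<delta> > 0\<close> a_pos b_pos by (auto simp: K_def intro: add_pos_pos)
  have "\<eta> > 0" using pos by (simp add: \<eta>_def)
  have \<eta>: "\<eta> * (\<rho>\<^sup>2 + 2 * \<rho> ^ 3) < min a b * \<delta>\<^sup>2 / 2"
    unfolding K_def[symmetric] using pos by (simp add: \<eta>_def)
  obtain CQ where Q: "\<And>n. integrable M (hessian_error n)"
      "\<And>n. n \<ge> 1 \<Longrightarrow> expectation (hessian_error n) = CQ / real n"
    using hessian_error_expectation by blast
  obtain CT where T: "\<And>n. integrable M (cubic_term n)"
      "\<And>n. n \<ge> 1 \<Longrightarrow> expectation (cubic_term n) = CT / sqrt (real n)"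
    using cubic_term_expectation by blast
  have "(\<lambda>n. CQ / real n / \<eta>\<^sup>2) \<longlonglongrightarrow> 0 / \<eta>\<^sup>2"
    by (intro tendsto_divide lim_const_over_n tendsto_const) (use \<open>\<eta> > 0\<close> in auto)
  then have evQ: "\<forall>\<^sub>F n in sequentially. CQ / real n / \<eta>\<^sup>2 < \<epsilon> / 3"
    using \<open>\<epsilon> > 0\<close> by (intro order_tendstoD(2)) auto
  have "filterlim (\<lambda>n. sqrt (real n)) at_infinity sequentially"
    by (intro filterlim_at_top_imp_at_infinity filterlim_compose[OF sqrt_at_top filterlim_real_sequentially])
  then have "(\<lambda>n. CT / sqrt (real n)) \<longlonglongrightarrow> 0"
    by (rule tendsto_divide_0[OF tendsto_const])
  then have "(\<lambda>n. CT / sqrt (real n) / \<eta>) \<longlonglongrightarrow> 0 / \<eta>"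
    by (intro tendsto_divide tendsto_const) (use \<open>\<eta> > 0\<close> in auto)
  then have evT: "\<forall>\<^sub>F n in sequentially. CT / sqrt (real n) / \<eta> < \<epsilon> / 3"
    using \<open>\<epsilon> > 0\<close> by (intro order_tendstoD(2)) auto
  show thesis
  proof
    show "\<rho> > 0" by fact
    show "\<forall>\<^sub>F n in sequentially. \<exists>A\<in>events. prob A < \<epsilon> \<and> (\<forall>\<omega>\<in>space M - A.
      norm (sqrt (real n) *\<^sub>R (\<theta>hat n \<omega> - \<theta>) + spiked_inverse a b u (U n \<omega>)) < \<delta> \<and>
      norm (sqrt (real n) *\<^sub>R (\<theta>hat n \<omega> - \<theta>)) \<le> \<rho>)"
      using evQ evT eventually_ge_at_top[of 1]
    proof eventually_elim
      case (elim n)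
      let ?AU = "{\<omega> \<in> space M. norm (U n \<omega>) > R}"
      let ?AQ = "{\<omega> \<in> space M. hessian_error n \<omega> > \<eta>\<^sup>2}"
      let ?AT = "{\<omega> \<in> space M. cubic_term n \<omega> > \<eta>}"
      have [measurable]: "hessian_error n \<in> borel_measurable M" "cubic_term n \<in> borel_measurable M"
        using Q(1) T(1) by auto
      have sets: "?AU \<in> events" "?AQ \<in> events" "?AT \<in> events" by measurable
      have "prob ?AQ \<le> expectation (hessian_error n) / \<eta>\<^sup>2"
      proof (rule Markov_gt[OF Q(1)])
        show "0 \<le> hessian_error n \<omega>" for \<omega>
          unfolding hessian_error_def by (intro sum_nonneg) auto
      qed (use \<open>\<eta> > 0\<close> in auto)
      then have pQ: "prob ?AQ < \<epsilon> / 3"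
        unfolding Q(2)[OF elim(3)] by (rule order_le_less_trans[OF _ elim(1)])
      have "prob ?AT \<le> expectation (cubic_term n) / \<eta>"
      proof (rule Markov_gt[OF T(1)])
        show "0 \<le> cubic_term n \<omega>" for \<omega>
          unfolding cubic_term_def by (intro divide_nonneg_nonneg sum_nonneg) auto
      qed (use \<open>\<eta> > 0\<close> in auto)
      then have pT: "prob ?AT < \<epsilon> / 3"
        unfolding T(2)[OF elim(3)] by (rule order_le_less_trans[OF _ elim(2)])
      have "prob (?AU \<union> ?AQ \<union> ?AT) \<le> prob ?AU + prob ?AQ + prob ?AT"
        using measure_Un_le[OF sets.Un[OF sets(1,2)] sets(3)] measure_Un_le[OF sets(1,2)] by linarith
      then have "prob (?AU \<union> ?AQ \<union> ?AT) < \<epsilon>" using R[of n] pQ pT by linarith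
      moreover have "norm (sqrt (real n) *\<^sub>R (\<theta>hat n \<omega> - \<theta>) + spiked_inverse a b u (U n \<omega>)) < \<delta> \<and>
          norm (sqrt (real n) *\<^sub>R (\<theta>hat n \<omega> - \<theta>)) \<le> \<rho>" if "\<omega> \<in> space M - (?AU \<union> ?AQ \<union> ?AT)" for \<omega>
      proof -
        let ?L = "logistic_loss n m (\<lambda>i. X i \<omega>) (\<lambda>i j. Y i j \<omega>)"
        have \<omega>: "\<omega> \<in> space M" "norm (U n \<omega>) \<le> R" "hessian_error n \<omega> \<le> \<eta>\<^sup>2" "cubic_term n \<omega> \<le> \<eta>"
          using that by auto
        note loc = mle_localization[where x = "\<lambda>i. X i \<omega>" and y = "\<lambda>i j. Y i j \<omega>" and \<theta> = \<theta> and U = "U n \<omega>",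
            OF elim(3) m Y_values[OF _ \<omega>(1)] norm_u a_pos b_pos H_form
              \<omega>(3)[unfolded hessian_error_def] \<omega>(4)[unfolded cubic_term_def] less_imp_le[OF \<open>\<eta> > 0\<close>]
              U_def[of n \<omega>, unfolded score_def] \<omega>(2) \<open>\<delta> > 0\<close> \<rho>_def[unfolded \<kappa>_def] \<eta>]
        \<comment> \<open>A minimizer exists outside \<open>A\<close>, so the estimator cannot take
          its default value there.\<close>
        have "is_arg_min ?L (\<lambda>_. True) (\<theta>hat n \<omega>)"
          using mle loc(1) \<omega>(1) by (simp add: logistic_mle_def Let_def)
        from loc(2)[OF _ this]
        have near: "norm (sqrt (real n) *\<^sub>R (\<theta>hat n \<omega> - \<theta>) + spiked_inverse a b u (U n \<omega>)) < \<delta>" .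
        have "norm (spiked_inverse a b u (U n \<omega>)) \<le> \<kappa> * norm (U n \<omega>)"
          unfolding \<kappa>_def by (rule norm_spiked_inverse_le[OF norm_u])
        also have "\<dots> \<le> \<kappa> * R" using \<omega>(2) by (intro mult_left_mono) (auto simp: \<kappa>_def)
        finally have "norm (sqrt (real n) *\<^sub>R (\<theta>hat n \<omega> - \<theta>)) \<le> \<rho>"
          using near norm_triangle_ineq4[of "sqrt (real n) *\<^sub>R (\<theta>hat n \<omega> - \<theta>) + spiked_inverse a b u (U n \<omega>)"
            "spiked_inverse a b u (U n \<omega>)"] by (simp add: \<rho>_def)
        with near show ?thesis by blast
      qed
      ultimately show ?case using sets by (intro bexI[of _ "?AU \<union> ?AQ \<union> ?AT"]) auto
    qed
  qed
qed

lemma sqrt_n_bound_small: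
  assumes "(e::real) > 0"
  shows "\<forall>\<^sub>F n in sequentially. n \<ge> 1 \<and> \<rho> / sqrt (real n) < e"
proof -
  have "filterlim (\<lambda>n. sqrt (real n)) at_infinity sequentially"
    by (intro filterlim_at_top_imp_at_infinity filterlim_compose[OF sqrt_at_top filterlim_real_sequentially])
  then have "(\<lambda>n. \<rho> / sqrt (real n)) \<longlonglongrightarrow> 0"
    by (rule tendsto_divide_0[OF tendsto_const])
  then show ?thesis
    using assms by (intro eventually_conj eventually_ge_at_top order_tendstoD(2)) auto
qed

lemma tendsto_prob_zeroI:
  assumes meas: "\<And>n. B n \<in> events"
    and small: "\<And>\<epsilon>. \<epsilon> > 0 \<Longrightarrow> \<forall>\<^sub>F n in sequentially. \<exists>A\<in>events. prob A < \<epsilon> \<and> B n \<subseteq> A"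
  shows "(\<lambda>n. prob (B n)) \<longlonglongrightarrow> 0"
proof (rule order_tendstoI)
  show "\<forall>\<^sub>F n in sequentially. c < prob (B n)" if "c < 0" for c
    using that by (intro always_eventually allI) (meson measure_nonneg order_less_le_trans)
  show "\<forall>\<^sub>F n in sequentially. prob (B n) < c" if "0 < c" for c
    using small[OF that]
    by eventually_elim (meson finite_measure_mono order_le_less_trans)
qed

text \<open>Off an event of small probability, the error is at most \<open>\<rho> / sqrt n\<close>,
  which tends to 0.\<close>

lemma consistency:
  assumes mle: "logistic_mle M m X Y \<theta>hat"
  shows "converges_in_probability M \<theta>hat \<theta>"
  unfolding converges_in_probability_def
proof (intro conjI allI impI)
  show [measurable]: "\<theta>hat n \<in> borel_measurable M" for n
    using mle by (simp add: logistic_mle_def)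
  fix e :: real assume "e > 0"
  show "(\<lambda>n. prob {\<omega> \<in> space M. dist (\<theta>hat n \<omega>) \<theta> > e}) \<longlonglongrightarrow> 0"
  proof (rule tendsto_prob_zeroI)
    fix \<epsilon> :: real assume "\<epsilon> > 0"
    obtain \<rho> where ev: "\<forall>\<^sub>F n in sequentially. \<exists>A\<in>events. prob A < \<epsilon> \<and> (\<forall>\<omega>\<in>space M - A.
        norm (sqrt (real n) *\<^sub>R (\<theta>hat n \<omega> - \<theta>) + spiked_inverse a b u (U n \<omega>)) < 1 \<and>
        norm (sqrt (real n) *\<^sub>R (\<theta>hat n \<omega> - \<theta>)) \<le> \<rho>)"
      \<comment> \<open>Any positive radius would serve; only the bound \<open>\<rho>\<close>
        enters.\<close>
      using mle_linearization[OF mle zero_less_one \<open>\<epsilon> > 0\<close>] by blast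
    from ev sqrt_n_bound_small[OF \<open>e > 0\<close>, of \<rho>]
    show "\<forall>\<^sub>F n in sequentially. \<exists>A\<in>events. prob A < \<epsilon> \<and> {\<omega> \<in> space M. dist (\<theta>hat n \<omega>) \<theta> > e} \<subseteq> A"
    proof eventually_elim
      case (elim n)
      then obtain A where A: "A \<in> events" "prob A < \<epsilon>"
        and le: "\<And>\<omega>. \<omega> \<in> space M - A \<Longrightarrow> norm (sqrt (real n) *\<^sub>R (\<theta>hat n \<omega> - \<theta>)) \<le> \<rho>" by blast
      have "dist (\<theta>hat n \<omega>) \<theta> \<le> e" if "\<omega> \<in> space M - A" for \<omega>
      proof -
        have "dist (\<theta>hat n \<omega>) \<theta> \<le> \<rho> / sqrt (real n)"
        proof -
          have "norm (\<theta>hat n \<omega> - \<theta>) * sqrt (real n) \<le> \<rho>"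
            using le[OF that] by (simp add: mult.commute)
          then show ?thesis using elim by (simp add: dist_norm pos_le_divide_eq)
        qed
        then show ?thesis using elim by simp
      qed
      then show ?case using A by (intro bexI[of _ A]) (auto simp: not_less[symmetric])
    qed
  qed measurable
qed

text \<open>The Cramer-Wold idea on characteristic functions: for fixed \<open>t\<close> the
  projections of the scores obey the one-dimensional central limit theorem. At \<open>t = 0\<close>
  their variance degenerates, hence the case split.\<close>

lemma char_U: "(\<lambda>n. \<integral>\<omega>. cis (t \<bullet> U n \<omega>) \<partial>M) \<longlonglongrightarrow> complex_of_real (exp (- spiked_form a b u t / (2 * real m)))"
proof (cases "t = 0")
  case True
  then show ?thesis by (simp add: spiked_form_def prob_space)
next
  case False
  define v where "v = spiked_form a b u t / real m"
  define \<sigma> where "\<sigma> = sqrt v"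
  have "0 < min a b * (norm t)\<^sup>2" using False a_pos b_pos by simp
  also have "\<dots> \<le> spiked_form a b u t" by (rule spiked_form_ge[OF norm_u])
  finally have "v > 0" using m by (simp add: v_def)
  then have \<sigma>: "\<sigma> > 0" "\<sigma>\<^sup>2 = v" by (simp_all add: \<sigma>_def)
  let ?S = "\<lambda>n \<omega>. (\<Sum>i<n. t \<bullet> score i \<omega>) / sqrt (real n * \<sigma>\<^sup>2)"
  have "weak_conv_m (\<lambda>n. distr M borel (?S n)) std_normal_distribution"
  proof (rule central_limit_theorem_zero_mean[OF indep_score score_mean \<sigma>(1) score_variance(1) _ score_distr])
    show "variance (\<lambda>\<omega>. t \<bullet> score n \<omega>) = \<sigma>\<^sup>2" for n
      by (simp add: score_mean score_variance fisher_information_form \<sigma>(2) v_def)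
  qed
  \<comment> \<open>Evaluation at \<open>\<sigma>\<close> undoes the standardization, as
    \<open>\<sigma>\<close> times the standardized sum is
    \<open>t \<bullet> U n \<omega>\<close>.\<close>
  then have "(\<lambda>n. char (distr M borel (?S n)) \<sigma>) \<longlonglongrightarrow> char std_normal_distribution \<sigma>"
    by (intro levy_continuity1 real_dist_normal_dist real_distribution_distr) auto
  moreover have "char (distr M borel (?S n)) \<sigma> = (\<integral>\<omega>. cis (t \<bullet> U n \<omega>) \<partial>M)" for n
  proof -
    have "\<sigma> * ?S n \<omega> = t \<bullet> U n \<omega>" for \<omega>
      using \<sigma>(1) by (simp add: U_inner real_sqrt_mult)
    then show ?thesis
      unfolding char_def by (subst integral_distr) (auto simp flip: cis_conv_exp)
  qed
  ultimately show ?thesis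
    by (simp add: char_std_normal_distribution \<sigma>(2) v_def mult.commute)
qed

section \<open>The delta method for the direction\<close>

definition proj_scaled :: "real ^ 'd \<Rightarrow> real ^ 'd" where
  "proj_scaled h = (h - (u \<bullet> h) *\<^sub>R u) /\<^sub>R norm \<theta>"

lemma norm_proj_scaled_le: "norm (proj_scaled h) \<le> 2 * norm h / norm \<theta>"
proof -
  have "norm (h - (u \<bullet> h) *\<^sub>R u) \<le> norm h + \<bar>u \<bullet> h\<bar>"
    using norm_triangle_ineq4[of h "(u \<bullet> h) *\<^sub>R u"] norm_u by simp
  also have "\<dots> \<le> 2 * norm h" using Cauchy_Schwarz_ineq2[of u h] norm_u by simp
  finally have "norm (h - (u \<bullet> h) *\<^sub>R u) / norm \<theta> \<le> 2 * norm h / norm \<theta>"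
    by (rule divide_right_mono) simp
  then show ?thesis by (simp add: proj_scaled_def divide_inverse mult.commute)
qed

lemma linear_proj_scaled: "linear proj_scaled"
  by (rule linearI) (simp_all add: proj_scaled_def inner_right_distrib algebra_simps)

text \<open>The derivative of normalization at \<open>\<theta>\<close>, applied to the leading term
  of the rescaled estimation error.\<close>

definition W :: "nat \<Rightarrow> 'a \<Rightarrow> real ^ 'd" where
  "W n \<omega> = proj_scaled (- spiked_inverse a b u (U n \<omega>))"

text \<open>\<open>spiked_inverse\<close> differs from division by \<open>b\<close> only by a
  multiple of \<open>u\<close>, which the projection annihilates; here the eigenvalue
  \<open>a\<close> disappears.\<close>

lemma W_eq: "W n \<omega> = proj_scaled (- (1 / b) *\<^sub>R U n \<omega>)"
proof -
  have "u \<bullet> u = 1" using norm_u by (simp add: norm_eq_1)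
  then show ?thesis
    by (simp add: W_def proj_scaled_def spiked_inverse_def inner_simps algebra_simps)
qed

text \<open>The projection is self-adjoint and can be moved to \<open>t\<close>, so the
  characteristic function of \<open>W\<close> is that of \<open>U\<close> at another point.\<close>

lemma W_inner: "t \<bullet> W n \<omega> = proj_scaled (- (1 / b) *\<^sub>R t) \<bullet> U n \<omega>"
  by (simp add: W_eq proj_scaled_def inner_simps inner_commute algebra_simps)

lemma W_measurable [measurable]: "W n \<in> borel_measurable M"
  unfolding W_eq proj_scaled_def by measurable

definition asymptotic_covariance :: "real ^ 'd ^ 'd" where
  "asymptotic_covariance = (inverse (real m) * inverse ((norm \<theta>)\<^sup>2) * inverse b) *\<^sub>R perp_proj u"

lemma asymptotic_covariance_form:
  "t \<bullet> (asymptotic_covariance *v t) = ((norm t)\<^sup>2 - (u \<bullet> t)\<^sup>2) / (real m * (norm \<theta>)\<^sup>2 * b)"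
proof -
  have "perp_proj u *v t = t - (u \<bullet> t) *\<^sub>R u"
    by (simp add: perp_proj_def matrix_vector_mult_diff_rdistrib vec_eq_iff)
      (simp add: matrix_vector_mult_def inner_vec_def sum_distrib_left mult_ac)
  then have "t \<bullet> (perp_proj u *v t) = (norm t)\<^sup>2 - (u \<bullet> t)\<^sup>2"
    by (simp add: inner_diff_right power2_norm_eq_inner power2_eq_square[of "t \<bullet> u"] inner_commute)
  then show ?thesis
    by (simp add: asymptotic_covariance_def flip: scaleR_matrix_vector_assoc) (simp add: field_simps)
qed

text \<open>The projected vector is orthogonal to \<open>u\<close>, so only the eigenvalue
  \<open>b\<close> acts; against the two factors 1/b it leaves a single 1/b.\<close>

lemma spiked_form_proj_scaled:
  "spiked_form a b u (proj_scaled (- (1 / b) *\<^sub>R t)) = ((norm t)\<^sup>2 - (u \<bullet> t)\<^sup>2) / ((norm \<theta>)\<^sup>2 * b)"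
proof -
  have uu: "u \<bullet> u = 1" using norm_u by (simp add: norm_eq_1)
  have "u \<bullet> proj_scaled h = 0" for h
    by (simp add: proj_scaled_def inner_simps uu)
  moreover have "(norm (proj_scaled h))\<^sup>2 = ((norm h)\<^sup>2 - (u \<bullet> h)\<^sup>2) / (norm \<theta>)\<^sup>2" for h
  proof -
    have "(norm (h - (u \<bullet> h) *\<^sub>R u))\<^sup>2 = (norm h)\<^sup>2 - (u \<bullet> h)\<^sup>2"
      unfolding power2_norm_eq_inner by (simp add: inner_simps uu inner_commute power2_eq_square)
    then show ?thesis by (simp add: proj_scaled_def power_divide divide_inverse power_mult_distrib power_inverse mult.commute)
  qed
  ultimately have "spiked_form a b u (proj_scaled (- (1 / b) *\<^sub>R t)) =
      b * (((norm t)\<^sup>2 / b\<^sup>2 - (u \<bullet> t)\<^sup>2 / b\<^sup>2) / (norm \<theta>)\<^sup>2)"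
    by (simp add: spiked_form_def power_mult_distrib power_divide)
  also have "\<dots> = ((norm t)\<^sup>2 - (u \<bullet> t)\<^sup>2) / ((norm \<theta>)\<^sup>2 * b)"
    using b_pos by (simp add: power2_eq_square[of b] mult.commute flip: diff_divide_distrib)
  finally show ?thesis .
qed

lemma tight_W: "tight_family M W"
  unfolding tight_family_def
proof (intro allI impI)
  fix e :: real assume "e > 0"
  then obtain R where R: "\<And>n. prob {\<omega> \<in> space M. norm (U n \<omega>) > R} < e"
    using tight_U unfolding tight_family_def by blast
  define C where "C = 2 * (1 / b) / norm \<theta>"
  have "C > 0" using b_pos \<theta> by (simp add: C_def)
  have "norm (W n \<omega>) \<le> C * norm (U n \<omega>)" for n \<omega>
    using norm_proj_scaled_le[of "- (1 / b) *\<^sub>R U n \<omega>"] b_pos by (simp add: W_eq C_def)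
  then have "norm (U n \<omega>) > R" if "norm (W n \<omega>) > C * R" for n \<omega>
    using that \<open>C > 0\<close> by (meson less_le_trans mult_less_cancel_left_pos)
  then have "prob {\<omega> \<in> space M. norm (W n \<omega>) > C * R} \<le> prob {\<omega> \<in> space M. norm (U n \<omega>) > R}" for n
    by (intro finite_measure_mono) auto
  then have "prob {\<omega> \<in> space M. norm (W n \<omega>) > C * R} < e" for n
    using R[of n] by (rule order_le_less_trans)
  then show "\<exists>R. \<forall>n. prob {\<omega> \<in> space M. norm (W n \<omega>) > R} < e" by blast
qed

lemma W_converges: "converges_in_distribution M W (centered_gaussian asymptotic_covariance)"
proof (rule converges_in_distribution_charI[OF prob_space_axioms prob_space_centered_gaussian])
  fix t :: "real ^ 'd"
  define c where "c = inverse (real m) * inverse ((norm \<theta>)\<^sup>2) * inverse b"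
  have "c \<ge> 0" using b_pos by (simp add: c_def)
  \<comment> \<open>Exhibits a square root of the covariance, without which the choice in
    \<open>centered_gaussian\<close> would be meaningless.\<close>
  have "(sqrt c *\<^sub>R perp_proj u) ** transpose (sqrt c *\<^sub>R perp_proj u) = asymptotic_covariance"
    unfolding asymptotic_covariance_def c_def[symmetric]
    by (rule perp_proj_square_root[OF norm_u \<open>c \<ge> 0\<close>])
  from integral_cis_centered_gaussian[OF this]
  have "(\<integral>x. cis (t \<bullet> x) \<partial>centered_gaussian asymptotic_covariance) =
      complex_of_real (exp (- (((norm t)\<^sup>2 - (u \<bullet> t)\<^sup>2) / (real m * (norm \<theta>)\<^sup>2 * b)) / 2))"
    by (simp only: asymptotic_covariance_form)
  also have "- (((norm t)\<^sup>2 - (u \<bullet> t)\<^sup>2) / (real m * (norm \<theta>)\<^sup>2 * b)) / 2 =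
      - spiked_form a b u (proj_scaled (- (1 / b) *\<^sub>R t)) / (2 * real m)"
    unfolding spiked_form_proj_scaled by (simp add: mult_ac)
  finally show "(\<lambda>n. \<integral>\<omega>. cis (t \<bullet> W n \<omega>) \<partial>M) \<longlonglongrightarrow>
      (\<integral>x. cis (t \<bullet> x) \<partial>centered_gaussian asymptotic_covariance)"
    unfolding W_inner using char_U by simp
qed (auto intro: tight_W)

text \<open>The distance to \<open>W\<close> has two sources, the nonlinearity of normalization and
  the linearization error of the estimator; each gets half of \<open>e\<close>.\<close>

lemma normalized_mle_converges:
  assumes mle: "logistic_mle M m X Y \<theta>hat"
  shows "converges_in_distribution M
    (\<lambda>n \<omega>. sqrt (real n) *\<^sub>R (\<theta>hat n \<omega> /\<^sub>R norm (\<theta>hat n \<omega>) - u)) (centered_gaussian asymptotic_covariance)"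
proof (rule converges_in_distribution_Slutsky[OF prob_space_axioms W_converges tight_W])
  have [measurable]: "\<theta>hat n \<in> borel_measurable M" for n
    using mle by (simp add: logistic_mle_def)
  let ?V = "\<lambda>n \<omega>. sqrt (real n) *\<^sub>R (\<theta>hat n \<omega> /\<^sub>R norm (\<theta>hat n \<omega>) - u)"
  show V: "?V n \<in> borel_measurable M" for n by measurable
  fix e :: real assume "e > 0"
  show "(\<lambda>n. prob {\<omega> \<in> space M. dist (?V n \<omega>) (W n \<omega>) > e}) \<longlonglongrightarrow> 0"
  proof (rule tendsto_prob_zeroI)
    show "{\<omega> \<in> space M. dist (?V n \<omega>) (W n \<omega>) > e} \<in> events" for n using V by measurable
    fix \<epsilon> :: real assume "\<epsilon> > 0"
    \<comment> \<open>\<open>proj_scaled\<close> enlarges norms by at most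
      \<open>2 / norm \<theta>\<close>, so an error below \<open>\<delta>\<close> becomes at most
      \<open>e / 2\<close>.\<close>
    define \<delta> where "\<delta> = e * norm \<theta> / 4"
    have "\<delta> > 0" using \<open>e > 0\<close> \<theta> by (simp add: \<delta>_def)
    obtain \<rho> where "\<rho> > 0" and ev: "\<forall>\<^sub>F n in sequentially. \<exists>A\<in>events. prob A < \<epsilon> \<and> (\<forall>\<omega>\<in>space M - A.
        norm (sqrt (real n) *\<^sub>R (\<theta>hat n \<omega> - \<theta>) + spiked_inverse a b u (U n \<omega>)) < \<delta> \<and>
        norm (sqrt (real n) *\<^sub>R (\<theta>hat n \<omega> - \<theta>)) \<le> \<rho>)"
      using mle_linearization[OF mle \<open>\<delta> > 0\<close> \<open>\<epsilon> > 0\<close>] by blast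
    have "((\<lambda>x. x /\<^sub>R norm x) has_derivative proj_scaled) (at \<theta>)"
      using has_derivative_normalize[OF \<theta>] by (simp add: proj_scaled_def[abs_def] u_def)
    \<comment> \<open>Slope allowed for the remainder of the derivative: multiplied by the bound
      \<open>\<rho>\<close> on the rescaled error it gives \<open>e / 2\<close>.\<close>
    moreover have "e / (2 * \<rho>) > 0" using \<open>e > 0\<close> \<open>\<rho> > 0\<close> by simp
    ultimately obtain d where "d > 0" and d: "\<And>x. norm (x - \<theta>) < d \<Longrightarrow>
        norm (x /\<^sub>R norm x - u - proj_scaled (x - \<theta>)) \<le> e / (2 * \<rho>) * norm (x - \<theta>)"
      unfolding has_derivative_at_alt u_def by meson
    from ev sqrt_n_bound_small[OF \<open>d > 0\<close>, of \<rho>]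
    show "\<forall>\<^sub>F n in sequentially. \<exists>A\<in>events. prob A < \<epsilon> \<and> {\<omega> \<in> space M. dist (?V n \<omega>) (W n \<omega>) > e} \<subseteq> A"
    proof eventually_elim
      case (elim n)
      then obtain A where A: "A \<in> events" "prob A < \<epsilon>"
        and le: "\<And>\<omega>. \<omega> \<in> space M - A \<Longrightarrow> norm (sqrt (real n) *\<^sub>R (\<theta>hat n \<omega> - \<theta>)) \<le> \<rho>"
        and near: "\<And>\<omega>. \<omega> \<in> space M - A \<Longrightarrow>
          norm (sqrt (real n) *\<^sub>R (\<theta>hat n \<omega> - \<theta>) + spiked_inverse a b u (U n \<omega>)) < \<delta>" by blast
      have "dist (?V n \<omega>) (W n \<omega>) \<le> e" if \<omega>: "\<omega> \<in> space M - A" for \<omega>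
      proof -
        define h where "h = \<theta>hat n \<omega> - \<theta>"
        define r where "r = \<theta>hat n \<omega> /\<^sub>R norm (\<theta>hat n \<omega>) - u - proj_scaled h"
        have "norm h \<le> \<rho> / sqrt (real n)"
        proof -
          have "norm h * sqrt (real n) \<le> \<rho>"
            using le[OF \<omega>] by (simp add: h_def mult.commute)
          then show ?thesis using elim by (simp add: pos_le_divide_eq)
        qed
        then have "norm r \<le> e / (2 * \<rho>) * norm h"
          using d[of "\<theta>hat n \<omega>"] elim by (simp add: r_def h_def)
        then have "sqrt (real n) * norm r \<le> sqrt (real n) * (e / (2 * \<rho>) * norm h)"
          by (intro mult_left_mono) auto
        also have "\<dots> = e / (2 * \<rho>) * norm (sqrt (real n) *\<^sub>R h)" by simp
        also have "\<dots> \<le> e / (2 * \<rho>) * \<rho>"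
          using le[OF \<omega>] \<open>e > 0\<close> \<open>\<rho> > 0\<close> by (intro mult_left_mono) (auto simp: h_def)
        finally have r: "norm (sqrt (real n) *\<^sub>R r) \<le> e / 2" using \<open>\<rho> > 0\<close> by simp
        have "?V n \<omega> - W n \<omega> = sqrt (real n) *\<^sub>R r +
            proj_scaled (sqrt (real n) *\<^sub>R h + spiked_inverse a b u (U n \<omega>))"
          by (simp add: r_def W_def linear_add[OF linear_proj_scaled] linear_neg[OF linear_proj_scaled]
            linear_scale[OF linear_proj_scaled] algebra_simps)
        moreover have "norm (proj_scaled (sqrt (real n) *\<^sub>R h + spiked_inverse a b u (U n \<omega>))) \<le> e / 2"
        proof -
          have "2 * norm (sqrt (real n) *\<^sub>R h + spiked_inverse a b u (U n \<omega>)) / norm \<theta> \<le> 2 * \<delta> / norm \<theta>"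
            using near[OF \<omega>] by (intro divide_right_mono) (auto simp: h_def)
          also have "\<dots> = e / 2" using \<theta> by (simp add: \<delta>_def)
          finally show ?thesis by (rule order_trans[OF norm_proj_scaled_le])
        qed
        ultimately have "norm (?V n \<omega> - W n \<omega>) \<le> e / 2 + e / 2"
          using r by (simp only: norm_triangle_mono)
        then show ?thesis by (simp add: dist_norm)
      qed
      then show ?case using A by (intro bexI[of _ A]) (auto simp: not_less[symmetric])
    qed
  qed
qed

end

theorem corollary1:
  fixes M :: "'a measure"
    and X :: "nat \<Rightarrow> 'a \<Rightarrow> real ^ 'd"
    and Y :: "nat \<Rightarrow> nat \<Rightarrow> 'a \<Rightarrow> real"
    and \<theta>star ustar :: "real ^ 'd"
    and tstar :: real
    and m :: nat
    and \<theta>hat uhat :: "nat \<Rightarrow> 'a \<Rightarrow> real ^ 'd"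
  assumes "\<theta>star \<noteq> 0" and "m \<ge> 1"
    and "tstar = norm \<theta>star" and "ustar = \<theta>star /\<^sub>R tstar"
    and "logistic_model M std_gaussian \<theta>star m X Y"
    and "logistic_mle M m X Y \<theta>hat"
    and "\<And>n \<omega>. uhat n \<omega> = \<theta>hat n \<omega> /\<^sub>R norm (\<theta>hat n \<omega>)"
  shows "converges_in_probability M \<theta>hat \<theta>star \<and>
    converges_in_distribution M (\<lambda>n \<omega>. sqrt (real n) *\<^sub>R (uhat n \<omega> - ustar))
      (centered_gaussian
        ((inverse (real m) * inverse (tstar\<^sup>2) *
          inverse (\<integral>x. sigma_lr (\<theta>star \<bullet> x) * (1 - sigma_lr (\<theta>star \<bullet> x)) \<partial>std_gaussian))
         *\<^sub>R perp_proj ustar))"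
proof -
  interpret prob_space M
    using assms(5) by (simp add: logistic_model_def)
  interpret logistic_sample M X Y \<theta>star m
    by unfold_locales (use assms in auto)
  have u: "u = ustar" using assms(3,4) by (simp add: u_def)
  have b: "b = (\<integral>x. sigma_lr (\<theta>star \<bullet> x) * (1 - sigma_lr (\<theta>star \<bullet> x)) \<partial>std_gaussian)"
    by (simp add: b_def dsigma_def)
  show ?thesis
    using consistency[OF assms(6)] normalized_mle_converges[OF assms(6)]
    unfolding asymptotic_covariance_def assms(7) u b assms(3) by blast
qed

end
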